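(* Let $n\ge1$ and let $\Lambda^{(0,\bullet)}_q$ be the quantum exterior algebra associated to the tangent space $T^{(0,1)}$ of $\mathcal O_q(\mathrm{SU}_{n+1})$, endowed with the Frobenius structure $B(v,w)=\iota(v\wedge w)$, where $\iota:\Lambda^{(0,|\Delta^+|)}_q\to\mathbb C$ is a linear isomorphism extended by zero to the components of other degrees. Then the Nakayama automorphism $\sigma$ of $\Lambda^{(0,\bullet)}_q$ is determined by $$\sigma(e_\gamma)=(-1)^{|\Delta^+|-1}e_\gamma,\qquad\text{for any }\gamma\in\Delta^+.$$
   Context: A Frobenius algebra is an associative algebra $R$ with a non-degenerate bilinear map $B$ satisfying $B(ab,c)=B(a,bc)$; its Nakayama automorphism is the algebra automorphism $\sigma:R\to R$ uniquely defined by $B(x,y)=B(y,\sigma(x))$ for all $x,y\in R$. All algebras are over $\mathbb C$. Fix $q\in\mathbb R$, $q\ne-1,0,1$; $[a,b]_c:=ab-c\,ba$. $\Delta^+=\{\alpha_{ij}=\varepsilon_i-\varepsilon_j\mid1\le i<j\le n+1\}$. $U_q(\mathfrak{sl}_{n+1})$ is the standard Drinfeld--Jimbo algebra with generators $E_i,F_i,K_i^{\pm1}$, $i=1,\dots,n$ ($K_iE_j=q^{a_{ij}}E_jK_i$, $K_iF_j=q^{-a_{ij}}F_jK_i$, $E_iF_j-F_jE_i=\delta_{ij}\frac{K_i-K_i^{-1}}{q-q^{-1}}$, $K_i$'s commuting and invertible, quantum Serre relations), and coproduct $\Delta(K_i)=K_i\otimes K_i$, $\Delta(E_i)=E_i\otimes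 K_i+1\otimes E_i$, $\Delta(F_i)=F_i\otimes1+K_i^{-1}\otimes F_i$. $A:=\mathcal O_q(\mathrm{SU}_{n+1})$ is the Hopf algebra of matrix coefficients of the finite-dimensional type-1 representations of $U_q(\mathfrak{sl}_{n+1})$. It is generated by $u_{ij}$, $i,j=1,\dots,n+1$, with $\Delta(u_{ij})=\sum_au_{ia}\otimes u_{aj}$, $\varepsilon(u_{ij})=\delta_{ij}$; the evaluation pairing satisfies $\langle E_i,u_{i+1,i}\rangle=1$, $\langle F_i,u_{i,i+1}\rangle=1$, $\langle K_j^{\pm1},u_{ii}\rangle=q^{\pm(\delta_{j+1,i}-\delta_{ij})}$, all other pairings of generators being zero. For $1\le i<j\le n+1$ put $E_{ji}:=[E_{j-1},[E_{j-2},[\cdots[E_{i+1},E_i]_{q^{-1}}\cdots]_{q^{-1}}]_{q^{-1}}$ (with $E_{i+1,i}=E_i$), and $T^{(0,1)}:=\mathrm{span}_{\mathbb C}\{E_{ji}\}$. Put $A^+=\ker\varepsilon$, $a^+:=a-\varepsilon(a)1$, $I:=\{x\in A^+\mid\langle X,x\rangle=0\ \forall X\in T^{(0,1)}\}$, and $\Lambda^{(0,1)}_q:=A^+/I$. The elements $e_{\alpha_{ij}}:=e_{ji}:=[u_{ji}]$, $i<j$, form the basis dual to $\{E_{ji}\}$. With $I^{(2)}:=\{[x_{(1)}^+]\otimes[x_{(2)}^+]\mid x\in I\}$, the quantum exterior algebra is the $\mathbb Z_{\ge0}$-graded algebra $\Lambda^{(0,\bullet)}_q:=\mathcal T(\Lambda^{(0,1)}_q)/\langle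 I^{(2)}\rangle$, with multiplication $\wedge$; its top non-zero component is the one-dimensional space $\Lambda^{(0,|\Delta^+|)}_q$. *)

theory Defs
  imports "HOL-Algebra.QuotRing" "HOL-Algebra.Module" "HOL-Library.Poly_Mapping"
    "Jordan_Normal_Form.Matrix"
begin

text \<open>
  Complex algebras and complex vector spaces are records of type \<^typ>\<open>(complex, 'a) module\<close>.
\<close>

section \<open>Free algebras, quotient algebras, tensor algebras\<close>

datatype 'g fmon = Mon (letters: "'g list")

instantiation fmon :: (type) monoid_add
begin

definition "0 = Mon []"

definition "v + w = Mon (letters v @ letters w)"

instance
  by standard (simp_all add: zero_fmon_def plus_fmon_def)

end

text \<open>
  The free algebra on a type of letters: finitely supported functions on words.  The product of
  \<^typ>\<open>'g fmon \<Rightarrow>\<^sub>0 complex\<close> is convolution with respect to concatenation of words.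
\<close>

type_synonym 'g falg = "'g fmon \<Rightarrow>\<^sub>0 complex"

definition gen :: "'g \<Rightarrow> 'g falg" where
  "gen g = Poly_Mapping.single (Mon [g]) 1"

definition scal :: "complex \<Rightarrow> 'g falg \<Rightarrow> 'g falg" where
  "scal c p = Poly_Mapping.single 0 c * p"

definition free_alg :: "'g set \<Rightarrow> (complex, 'g falg) module" where
  "free_alg S = \<lparr>carrier = {p. \<forall>w\<in>Poly_Mapping.keys p. set (letters w) \<subseteq> S},
     monoid.mult = (*), one = 1, zero = 0, add = (+), smult = scal\<rparr>"

definition quot_alg :: "(complex, 'a) module \<Rightarrow> 'a set \<Rightarrow> (complex, 'a set) module" where
  "quot_alg R J = \<lparr>carrier = carrier (R Quot J), monoid.mult = monoid.mult (R Quot J), one = one (R Quot J),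
     zero = zero (R Quot J), add = add (R Quot J),
     smult = (\<lambda>c X. \<Union>x\<in>X. J +>\<^bsub>R\<^esub> (c \<odot>\<^bsub>R\<^esub> x))\<rparr>"

text \<open>
  The tensor algebra of a vector space \<open>M\<close>: the free algebra on the set of vectors of \<open>M\<close>,
  modulo the relations that make the insertion of \<open>M\<close> linear.
\<close>

definition linear_rels :: "(complex, 'v) module \<Rightarrow> 'v falg set" where
  "linear_rels M =
     {gen (v \<oplus>\<^bsub>M\<^esub> w) - gen v - gen w | v w. v \<in> carrier M \<and> w \<in> carrier M} \<union>
     {gen (c \<odot>\<^bsub>M\<^esub> v) - scal c (gen v) | c v. v \<in> carrier M}"

definition linear_ideal :: "(complex, 'v) module \<Rightarrow> 'v falg set" where
  "linear_ideal M = Idl\<^bsub>free_alg (carrier M)\<^esub> (linear_rels M)"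

definition tensor_alg :: "(complex, 'v) module \<Rightarrow> (complex, 'v falg set) module" where
  "tensor_alg M = quot_alg (free_alg (carrier M)) (linear_ideal M)"

definition tensor_cls :: "(complex, 'v) module \<Rightarrow> 'v falg \<Rightarrow> 'v falg set" where
  "tensor_cls M p = linear_ideal M +>\<^bsub>free_alg (carrier M)\<^esub> p"

definition tensor_component :: "(complex, 'v) module \<Rightarrow> nat \<Rightarrow> 'v falg set set" where
  "tensor_component M k = tensor_cls M `
     {p \<in> carrier (free_alg (carrier M)). \<forall>w\<in>Poly_Mapping.keys p. length (letters w) = k}"


section \<open>Frobenius algebras and Nakayama automorphisms\<close>

definition frobenius_form :: "(complex, 'a) module \<Rightarrow> ('a \<Rightarrow> 'a \<Rightarrow> complex) \<Rightarrow> bool" where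
  "frobenius_form R B \<longleftrightarrow>
     (\<forall>x\<in>carrier R. \<forall>y\<in>carrier R. \<forall>z\<in>carrier R.
        B (x \<oplus>\<^bsub>R\<^esub> y) z = B x z + B y z \<and> B x (y \<oplus>\<^bsub>R\<^esub> z) = B x y + B x z) \<and>
     (\<forall>c. \<forall>x\<in>carrier R. \<forall>y\<in>carrier R.
        B (c \<odot>\<^bsub>R\<^esub> x) y = c * B x y \<and> B x (c \<odot>\<^bsub>R\<^esub> y) = c * B x y) \<and>
     (\<forall>x\<in>carrier R. \<forall>y\<in>carrier R. \<forall>z\<in>carrier R.
        B (x \<otimes>\<^bsub>R\<^esub> y) z = B x (y \<otimes>\<^bsub>R\<^esub> z)) \<and>
     (\<forall>x\<in>carrier R. (\<forall>y\<in>carrier R. B x y = 0) \<longrightarrow> x = \<zero>\<^bsub>R\<^esub>) \<and>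
     (\<forall>y\<in>carrier R. (\<forall>x\<in>carrier R. B x y = 0) \<longrightarrow> y = \<zero>\<^bsub>R\<^esub>)"

definition algebra_automorphism :: "(complex, 'a) module \<Rightarrow> ('a \<Rightarrow> 'a) \<Rightarrow> bool" where
  "algebra_automorphism R \<sigma> \<longleftrightarrow>
     \<sigma> \<in> ring_iso R R \<and> (\<forall>c. \<forall>x\<in>carrier R. \<sigma> (c \<odot>\<^bsub>R\<^esub> x) = c \<odot>\<^bsub>R\<^esub> \<sigma> x)"

definition nakayama_automorphism ::
    "(complex, 'a) module \<Rightarrow> ('a \<Rightarrow> 'a \<Rightarrow> complex) \<Rightarrow> ('a \<Rightarrow> 'a) \<Rightarrow> bool" where
  "nakayama_automorphism R B \<sigma> \<longleftrightarrow> algebra_automorphism R \<sigma> \<and>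
     (\<forall>x\<in>carrier R. \<forall>y\<in>carrier R. B x y = B y (\<sigma> x))"

section \<open>The Drinfeld--Jimbo algebra of type $A_n$\<close>

datatype uq_gen = Egen nat | Fgen nat | Kgen nat | Kinv nat

type_synonym uq = "uq_gen falg set"

definition uq_gens :: "nat \<Rightarrow> uq_gen set" where
  "uq_gens n = (\<Union>i\<in>{1..n}. {Egen i, Fgen i, Kgen i, Kinv i})"

definition cartan :: "nat \<Rightarrow> nat \<Rightarrow> int" where
  "cartan i j = (if i = j then 2 else if j = i + 1 \<or> i = j + 1 then - 1 else 0)"

definition serre :: "real \<Rightarrow> (nat \<Rightarrow> uq_gen) \<Rightarrow> nat \<Rightarrow> nat \<Rightarrow> uq_gen falg" where
  "serre q X i j =
     (let x = gen (X i); y = gen (X j) in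
      if j = i + 1 \<or> i = j + 1
      then x * x * y - scal (of_real (q + 1 / q)) (x * y * x) + y * x * x
      else x * y - y * x)"

definition uq_rels :: "nat \<Rightarrow> real \<Rightarrow> uq_gen falg set" where
  "uq_rels n q = (\<Union>i\<in>{1..n}.
     {gen (Kgen i) * gen (Kinv i) - 1, gen (Kinv i) * gen (Kgen i) - 1} \<union> (\<Union>j\<in>{1..n}.
       {gen (Kgen i) * gen (Kgen j) - gen (Kgen j) * gen (Kgen i),
        gen (Kgen i) * gen (Egen j)
          - scal (of_real q powi cartan i j) (gen (Egen j) * gen (Kgen i)),
        gen (Kgen i) * gen (Fgen j)
          - scal (of_real q powi (- cartan i j)) (gen (Fgen j) * gen (Kgen i)),
        gen (Egen i) * gen (Fgen j) - gen (Fgen j) * gen (Egen i)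
          - (if i = j then scal (of_real (1 / (q - 1 / q))) (gen (Kgen i) - gen (Kinv i)) else 0)}
       \<union> (if i \<noteq> j then {serre q Egen i j, serre q Fgen i j} else {})))"

definition uq_ideal :: "nat \<Rightarrow> real \<Rightarrow> uq_gen falg set" where
  "uq_ideal n q = Idl\<^bsub>free_alg (uq_gens n)\<^esub> (uq_rels n q)"

definition Uq :: "nat \<Rightarrow> real \<Rightarrow> (complex, uq) module" where
  "Uq n q = quot_alg (free_alg (uq_gens n)) (uq_ideal n q)"

definition uq_cls :: "nat \<Rightarrow> real \<Rightarrow> uq_gen falg \<Rightarrow> uq" where
  "uq_cls n q p = uq_ideal n q +>\<^bsub>free_alg (uq_gens n)\<^esub> p"

section \<open>The quantum coordinate algebra\<close>

text \<open>
  A representation on $\mathbb C^d$ is of type 1 if $\mathbb C^d$ is the direct sum of joint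
  eigenspaces of the \<open>K\<^sub>i\<close>, all eigenvalues being integral powers of \<open>q\<close>.
\<close>

definition type1_rep :: "nat \<Rightarrow> real \<Rightarrow> nat \<Rightarrow> (uq \<Rightarrow> complex mat) \<Rightarrow> bool" where
  "type1_rep n q d \<rho> \<longleftrightarrow>
     \<rho> \<in> Ring.ring_hom (Uq n q) (ring_mat TYPE(complex) d ()) \<and>
     (\<forall>c. \<forall>X\<in>carrier (Uq n q). \<rho> (c \<odot>\<^bsub>Uq n q\<^esub> X) = c \<cdot>\<^sub>m \<rho> X) \<and>
     (\<exists>P Q D. \<forall>i\<in>{1..n}.
        similar_mat_wit (\<rho> (uq_cls n q (gen (Kgen i)))) (D i) P Q \<and> diagonal_mat (D i) \<and>
        (\<forall>k<d. \<exists>m::int. D i $$ (k, k) = of_real q powi m))"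

text \<open>
  Elements of $\mathcal O_q(\mathrm{SU}_{n+1})$ are linear functionals on \<open>U\<^sub>q\<close>, extended by zero
  outside the carrier of \<open>U\<^sub>q\<close>; the pairing $\langle X, x\rangle$ is the value \<open>x X\<close>.  Only the
  unital coalgebra underlying the Hopf algebra is needed: its counit is evaluation at
  $1 \in U_q$, its coproduct is dual to the product of \<open>U\<^sub>q\<close>, and its unit is the counit
  of \<open>U\<^sub>q\<close>.
\<close>

type_synonym uq_functional = "uq \<Rightarrow> complex"

definition matrix_coeffs :: "nat \<Rightarrow> real \<Rightarrow> uq_functional set" where
  "matrix_coeffs n q = {\<lambda>X. if X \<in> carrier (Uq n q) then \<rho> X $$ (a, b) else 0 | d \<rho> a b.
     type1_rep n q d \<rho> \<and> a < d \<and> b < d}"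

definition Oq :: "nat \<Rightarrow> real \<Rightarrow> uq_functional set" where
  "Oq n q = {\<lambda>X. \<Sum>k<m. c k * x k X | (m::nat) c x. \<forall>k<m. x k \<in> matrix_coeffs n q}"

text \<open>
  The functional on \<open>U\<^sub>q\<close> induced by the linear extension of a function \<open>f\<close> on words, provided that
  this extension vanishes on the defining ideal.
\<close>

definition uq_functional :: "nat \<Rightarrow> real \<Rightarrow> (uq_gen list \<Rightarrow> complex) \<Rightarrow> uq_functional" where
  "uq_functional n q f = (\<lambda>X. if X \<in> carrier (Uq n q)
     then the_elem ((\<lambda>p. \<Sum>w\<in>Poly_Mapping.keys p. Poly_Mapping.lookup p w * f (letters w)) ` X)
     else 0)"

fun counit_gen :: "uq_gen \<Rightarrow> complex" where
  "counit_gen (Egen i) = 0"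
| "counit_gen (Fgen i) = 0"
| "counit_gen (Kgen i) = 1"
| "counit_gen (Kinv i) = 1"

definition Oq_one :: "nat \<Rightarrow> real \<Rightarrow> uq_functional" where
  "Oq_one n q = uq_functional n q (\<lambda>w. prod_list (map counit_gen w))"

definition Oq_counit :: "nat \<Rightarrow> real \<Rightarrow> uq_functional \<Rightarrow> complex" where
  "Oq_counit n q x = x \<one>\<^bsub>Uq n q\<^esub>"

text \<open>The pairings of the generators of \<open>U\<^sub>q\<close> with the generators $u_{ab}$, $1 \le a, b \le n + 1$.\<close>

fun u_gen :: "real \<Rightarrow> uq_gen \<Rightarrow> nat \<Rightarrow> nat \<Rightarrow> complex" where
  "u_gen q (Egen i) a b = (if a = i + 1 \<and> b = i then 1 else 0)"
| "u_gen q (Fgen i) a b = (if a = i \<and> b = i + 1 then 1 else 0)"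
| "u_gen q (Kgen i) a b =
     (if a = b then of_real q powi (of_bool (i + 1 = a) - of_bool (i = a)) else 0)"
| "u_gen q (Kinv i) a b =
     (if a = b then of_real q powi (- (of_bool (i + 1 = a) - of_bool (i = a))) else 0)"

text \<open>Extension to words by $\Delta(u_{ab}) = \sum_c u_{ac} \otimes u_{cb}$.\<close>

primrec u_word :: "nat \<Rightarrow> real \<Rightarrow> uq_gen list \<Rightarrow> nat \<Rightarrow> nat \<Rightarrow> complex" where
  "u_word n q [] a b = of_bool (a = b)"
| "u_word n q (g # w) a b = (\<Sum>c\<in>{1..n+1}. u_gen q g a c * u_word n q w c b)"

definition u_coeff :: "nat \<Rightarrow> real \<Rightarrow> nat \<Rightarrow> nat \<Rightarrow> uq_functional" where
  "u_coeff n q a b = uq_functional n q (\<lambda>w. u_word n q w a b)"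

section \<open>The tangent space and the quantum exterior algebra\<close>

text \<open>The pair \<open>(i, j)\<close> stands for the positive root $\alpha_{ij} = \varepsilon_i - \varepsilon_j$.\<close>

definition pos_roots :: "nat \<Rightarrow> (nat \<times> nat) set" where
  "pos_roots n = {(i, j). 1 \<le> i \<and> i < j \<and> j \<le> n + 1}"

definition qcomm :: "complex \<Rightarrow> 'g falg \<Rightarrow> 'g falg \<Rightarrow> 'g falg" where
  "qcomm c a b = a * b - scal c (b * a)"

text \<open>
  \<open>root_vec q j i\<close> is a representative of $E_{ji}$, to be used for \<open>i < j\<close> only.
\<close>

primrec root_vec :: "real \<Rightarrow> nat \<Rightarrow> nat \<Rightarrow> uq_gen falg" where
  "root_vec q 0 i = 0"
| "root_vec q (Suc j) i =
     (if j = i then gen (Egen i) else qcomm (of_real (1 / q)) (gen (Egen j)) (root_vec q j i))"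

definition T01 :: "nat \<Rightarrow> real \<Rightarrow> uq set" where
  "T01 n q = {uq_cls n q (\<Sum>(i, j)\<in>pos_roots n. scal (c i j) (root_vec q j i)) | c. True}"

definition Oq_aug :: "nat \<Rightarrow> real \<Rightarrow> uq_functional set" where
  "Oq_aug n q = {x \<in> Oq n q. Oq_counit n q x = 0}"

definition Oq_plus :: "nat \<Rightarrow> real \<Rightarrow> uq_functional \<Rightarrow> uq_functional" where
  "Oq_plus n q a = (\<lambda>X. a X - Oq_counit n q a * Oq_one n q X)"

definition I01 :: "nat \<Rightarrow> real \<Rightarrow> uq_functional set" where
  "I01 n q = {x \<in> Oq_aug n q. \<forall>X\<in>T01 n q. x X = 0}"

definition form_cls :: "nat \<Rightarrow> real \<Rightarrow> uq_functional \<Rightarrow> uq_functional set" where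
  "form_cls n q x = {\<lambda>X. x X + z X | z. z \<in> I01 n q}"

text \<open>The quotient vector space $A^+/I$; \<open>mult\<close> and \<open>one\<close> carry no meaning.\<close>

definition Lambda1 :: "nat \<Rightarrow> real \<Rightarrow> (complex, uq_functional set) module" where
  "Lambda1 n q = \<lparr>carrier = form_cls n q ` Oq_aug n q, monoid.mult = undefined, one = undefined,
     zero = I01 n q,
     add = (\<lambda>P Q. {\<lambda>X. x X + y X | x y. x \<in> P \<and> y \<in> Q}),
     smult = (\<lambda>c P. \<Union>x\<in>P. form_cls n q (\<lambda>X. c * x X))\<rparr>"

abbreviation Tens1 :: "nat \<Rightarrow> real \<Rightarrow> (complex, uq_functional set falg set) module" where
  "Tens1 n q \<equiv> tensor_alg (Lambda1 n q)"

definition tensor_form :: "nat \<Rightarrow> real \<Rightarrow> uq_functional \<Rightarrow> uq_functional set falg set" where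
  "tensor_form n q x = tensor_cls (Lambda1 n q) (gen (form_cls n q x))"

text \<open>
  $[x_{(1)}^+] \otimes [x_{(2)}^+]$ is formed from any expression of the coproduct of \<open>x\<close> as
  $\sum_k a_k \otimes b_k$.
\<close>

definition I2 :: "nat \<Rightarrow> real \<Rightarrow> uq_functional set falg set set" where
  "I2 n q = {\<Oplus>\<^bsub>Tens1 n q\<^esub>k\<in>{..<m}.
       tensor_form n q (Oq_plus n q (a k)) \<otimes>\<^bsub>Tens1 n q\<^esub> tensor_form n q (Oq_plus n q (b k))
     | x (m::nat) a b. x \<in> I01 n q \<and> (\<forall>k<m. a k \<in> Oq n q \<and> b k \<in> Oq n q) \<and>
         (\<forall>X\<in>carrier (Uq n q). \<forall>Y\<in>carrier (Uq n q).
            x (X \<otimes>\<^bsub>Uq n q\<^esub> Y) = (\<Sum>k<m. a k X * b k Y))}"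

definition Lambda :: "nat \<Rightarrow> real \<Rightarrow> (complex, uq_functional set falg set set) module" where
  "Lambda n q = quot_alg (Tens1 n q) (Idl\<^bsub>Tens1 n q\<^esub> (I2 n q))"

definition Lambda_cls ::
    "nat \<Rightarrow> real \<Rightarrow> uq_functional set falg set \<Rightarrow> uq_functional set falg set set" where
  "Lambda_cls n q t = Idl\<^bsub>Tens1 n q\<^esub> (I2 n q) +>\<^bsub>Tens1 n q\<^esub> t"

definition Lambda_component :: "nat \<Rightarrow> real \<Rightarrow> nat \<Rightarrow> uq_functional set falg set set set" where
  "Lambda_component n q k = Lambda_cls n q ` tensor_component (Lambda1 n q) k"

text \<open>$e_{\alpha_{ij}} = e_{ji} = [u_{ji}]$.\<close>

definition e_root :: "nat \<Rightarrow> real \<Rightarrow> nat \<times> nat \<Rightarrow> uq_functional set falg set set" where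
  "e_root n q = (\<lambda>(i, j). Lambda_cls n q (tensor_form n q (u_coeff n q j i)))"

text \<open>
  \<open>\<iota>\<close> restricts to a linear isomorphism from the component of degree \<open>N\<close> onto the complex numbers
  and vanishes on all other components.
\<close>

definition top_form :: "nat \<Rightarrow> real \<Rightarrow> nat \<Rightarrow> (uq_functional set falg set set \<Rightarrow> complex) \<Rightarrow> bool" where
  "top_form n q N \<iota> \<longleftrightarrow>
     (\<forall>x\<in>carrier (Lambda n q). \<forall>y\<in>carrier (Lambda n q). \<iota> (x \<oplus>\<^bsub>Lambda n q\<^esub> y) = \<iota> x + \<iota> y) \<and>
     (\<forall>c. \<forall>x\<in>carrier (Lambda n q). \<iota> (c \<odot>\<^bsub>Lambda n q\<^esub> x) = c * \<iota> x) \<and>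
     bij_betw \<iota> (Lambda_component n q N) UNIV \<and>
     (\<forall>k. k \<noteq> N \<longrightarrow> (\<forall>x\<in>Lambda_component n q k. \<iota> x = 0))"

definition Lambda_pairing :: "nat \<Rightarrow> real \<Rightarrow> (uq_functional set falg set set \<Rightarrow> complex) \<Rightarrow>
    uq_functional set falg set set \<Rightarrow> uq_functional set falg set set \<Rightarrow> complex" where
  "Lambda_pairing n q \<iota> v w = \<iota> (v \<otimes>\<^bsub>Lambda n q\<^esub> w)"

end

theory Submission
  imports Defs
begin

text \<open>
  Write \<open>e\<^sub>\<gamma>\<close> for \<open>e_root n q \<gamma>\<close> and \<open>N\<close> for the number of positive roots.  The idea is to find enough
  quadratic relations between the \<open>e\<^sub>\<gamma>\<close>, and then to compute with words in these letters.

  \<^bold>\<open>The relations.\<close>  Since the coproduct is dual to the product of $U_q$, an element \<open>x\<close> of \<open>I\<close>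
  contributes the relation $\sum_{\gamma,\beta} \langle E_\gamma E_\beta, x\rangle\, e_\gamma \otimes e_\beta$ to
  $I^{(2)}$ (\<open>quadratic_relation\<close>).  Good choices of \<open>x\<close> are the products $u_{ca} u_{db}$ with
  $b \le a < c$ and $b < d$, which are matrix coefficients of the tensor square of the vector
  representation.  There the root vectors act by an explicit formula (\<open>root_vec_sq\<close>), which yields
  (\<open>sq_coeff_E_E\<close>)
  \[ q^{-[a=b]}\, e_{db} e_{ca} + q^{[c=d]-[a=d]}\, e_{ca} e_{db} + [c<d]\,(q - q^{-1})\, e_{da} e_{cb} = 0. \]
  So each \<open>e\<^sub>\<gamma>\<close> squares to zero, and two letters commute up to a factor $-q^m$ and, if one root is
  nested in the other ($b < a < c < d$), up to a multiple of the product for the crossed pair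
  \<open>(a, d)\<close>, \<open>(b, c)\<close>.

  \<^bold>\<open>Straightening.\<close>  Give every root a height such that passing from a nested to the crossed pair
  lowers the total height.  Modulo words of smaller height, a word then depends, up to a nonzero
  scalar, on the multiset of its letters only (\<open>permute\<close>), and it vanishes if a letter is repeated
  (\<open>repeated_letter\<close>).  In degree \<open>N\<close> a word without repetition contains every root once.  By
  induction, \<open>\<iota>\<close> vanishes on the words of length \<open>N\<close> whose height is smaller than that of the product
  of all the \<open>e\<^sub>\<gamma>\<close> (\<open>form_vanishes\<close>), and as \<open>\<iota>\<close> is not zero, it does not vanish on this product.  Pairing the square-free
  words with complementary ones now gives a triangular matrix, and so nondegeneracy.

  \<^bold>\<open>The automorphism.\<close>  Compare $e_\gamma w$ with $w e_\gamma$ for a square-free word \<open>w\<close> of length \<open>N - 1\<close>.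
  If \<open>w\<close> consists of the roots other than \<open>\<gamma>\<close>, then \<open>e\<^sub>\<gamma>\<close> moves through \<open>w\<close> with factor
  $\prod_\beta (-q^{m(\gamma,\beta)}) = (-1)^{N-1}$, because the exponents cancel in pairs (\<open>sum_comm_exp\<close>).
  Otherwise \<open>w\<close> omits some \<open>\<beta> \<noteq> \<gamma>\<close>, and \<open>\<iota>\<close> vanishes on both products, as a height in which \<open>\<gamma>\<close>
  is not above \<open>\<beta>\<close> shows (\<open>letter_cyclic\<close>).  As the \<open>e\<^sub>\<gamma>\<close> generate the algebra, the identity
  $\iota(e_\gamma y) = (-1)^{N-1} \iota(y e_\gamma)$ determines the Nakayama automorphism (\<open>twisted_trace\<close>).
\<close>

section \<open>Complex algebras, free algebras and quotients\<close>

locale complex_algebra = ring R for R :: "(complex, 'a) module" (structure) +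
  assumes smult_closed [simp, intro]: "x \<in> carrier R \<Longrightarrow> c \<odot> x \<in> carrier R"
    and smult_add_right: "x \<in> carrier R \<Longrightarrow> y \<in> carrier R \<Longrightarrow> c \<odot> (x \<oplus> y) = c \<odot> x \<oplus> c \<odot> y"
    and smult_add_left: "x \<in> carrier R \<Longrightarrow> (c + d) \<odot> x = c \<odot> x \<oplus> d \<odot> x"
    and smult_smult: "x \<in> carrier R \<Longrightarrow> c \<odot> (d \<odot> x) = (c * d) \<odot> x"
    and smult_one: "x \<in> carrier R \<Longrightarrow> 1 \<odot> x = x"
    and smult_mult_left: "x \<in> carrier R \<Longrightarrow> y \<in> carrier R \<Longrightarrow> (c \<odot> x) \<otimes> y = c \<odot> (x \<otimes> y)"
    and smult_mult_right: "x \<in> carrier R \<Longrightarrow> y \<in> carrier R \<Longrightarrow> x \<otimes> (c \<odot> y) = c \<odot> (x \<otimes> y)"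

subsection \<open>Scalars and words\<close>

definition word :: "'g list \<Rightarrow> 'g falg" where
  "word w = Poly_Mapping.single (Mon w) 1"

lemma word_Nil: "word [] = 1"
  by (simp add: word_def zero_fmon_def[symmetric])

lemma word_append: "word (u @ w) = word u * word w"
  by (simp add: word_def mult_single plus_fmon_def)

lemma gen_eq_word: "gen g = word [g]"
  by (simp add: gen_def word_def)

lemma scal_word: "scal c (word w) = Poly_Mapping.single (Mon w) c"
  by (simp add: scal_def word_def mult_single)

lemma scal_add_right: "scal c (p + r) = scal c p + scal c r"
  by (simp add: scal_def distrib_left)

lemma scal_diff_right: "scal c (p - r) = scal c p - scal c r"
  by (simp add: scal_def right_diff_distrib)

lemma scal_add_left: "scal (c + d) p = scal c p + scal d p"
  by (simp add: scal_def single_add distrib_right)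

lemma scal_scal: "scal c (scal d p) = scal (c * d) p"
  by (simp add: scal_def mult_single mult.assoc[symmetric])

lemma scal_one [simp]: "scal 1 p = p"
  by (simp add: scal_def)

lemma scal_zero_left [simp]: "scal 0 p = 0"
  by (simp add: scal_def)

lemma scal_zero_right [simp]: "scal c 0 = 0"
  by (simp add: scal_def)

lemma scal_minus_left: "scal (- c) p = - scal c p"
  by (simp add: scal_def single_uminus)

lemma scal_mult_left: "scal c p * r = scal c (p * r)"
  by (simp add: scal_def mult.assoc)

lemma scal_sum_left: "scal (sum f A) p = (\<Sum>a\<in>A. scal (f a) p)"
  by (induction A rule: infinite_finite_induct) (simp_all add: scal_add_left)

lemma falg_expansion: "p = (\<Sum>w\<in>Poly_Mapping.keys p. scal (Poly_Mapping.lookup p w) (word (letters w)))"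
proof (rule poly_mapping_eqI)
  fix k
  have "Poly_Mapping.lookup (\<Sum>w\<in>Poly_Mapping.keys p. scal (Poly_Mapping.lookup p w) (word (letters w))) k
      = (\<Sum>w\<in>Poly_Mapping.keys p. if w = k then Poly_Mapping.lookup p w else 0)"
    by (simp add: lookup_sum scal_word lookup_single when_def)
  also have "\<dots> = Poly_Mapping.lookup p k"
    by (simp add: in_keys_iff)
  finally show "Poly_Mapping.lookup p k =
    Poly_Mapping.lookup (\<Sum>w\<in>Poly_Mapping.keys p. scal (Poly_Mapping.lookup p w) (word (letters w))) k" ..
qed

lemma falg_induct [case_names zero add]:
  assumes "P 0" and step: "\<And>p c w. P p \<Longrightarrow> P (p + scal c (word w))"
  shows "P p"
proof -
  have "P (\<Sum>w\<in>A. scal (Poly_Mapping.lookup p w) (word (letters w)))" if "finite A" for A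
    using that
  proof (induction A)
    case (insert w A)
    then show ?case
      using step[OF insert.IH] by (simp add: add.commute)
  qed (simp add: assms)
  from this[OF finite_keys, of p] show ?thesis
    using falg_expansion[of p] by simp
qed

text \<open>
  Scalars are central although the free algebra is not commutative: a constant commutes with every
  word, because its only word is the empty one.
\<close>

lemma scal_mult_right: "p * scal c r = scal c (p * r)"
proof (induction p rule: falg_induct)
  case (add p d w)
  have "word w * scal c r = scal c (word w * r)"
    by (simp add: scal_def word_def mult.assoc[symmetric] mult_single)
  with add show ?case
    by (simp add: distrib_right scal_add_right scal_mult_left scal_scal mult.commute)
qed simp

subsection \<open>The free algebra\<close>

lemma free_alg_simps [simp]:
  "monoid.mult (free_alg S) = (*)" "one (free_alg S) = 1" "zero (free_alg S) = 0"
  "add (free_alg S) = (+)" "smult (free_alg S) = scal"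
  by (simp_all add: free_alg_def)

lemma free_alg_add_closed: "p \<in> carrier (free_alg S) \<Longrightarrow> r \<in> carrier (free_alg S) \<Longrightarrow> p + r \<in> carrier (free_alg S)"
  using keys_add[of p r] by (auto simp: free_alg_def)

lemma free_alg_mult_closed: "p \<in> carrier (free_alg S) \<Longrightarrow> r \<in> carrier (free_alg S) \<Longrightarrow> p * r \<in> carrier (free_alg S)"
  using keys_mult[of p r] by (fastforce simp: free_alg_def plus_fmon_def)

lemma free_alg_uminus_closed: "p \<in> carrier (free_alg S) \<Longrightarrow> - p \<in> carrier (free_alg S)"
  by (simp add: free_alg_def in_keys_iff)

lemma free_alg_word [simp]: "word w \<in> carrier (free_alg S) \<longleftrightarrow> set w \<subseteq> S"
  by (simp add: free_alg_def word_def)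

lemma free_alg_gen [simp]: "gen g \<in> carrier (free_alg S) \<longleftrightarrow> g \<in> S"
  by (simp add: gen_eq_word)

lemma free_alg_one [simp]: "1 \<in> carrier (free_alg S)"
  by (simp add: free_alg_def zero_fmon_def)

lemma free_alg_zero [simp]: "0 \<in> carrier (free_alg S)"
  by (simp add: free_alg_def)

lemma free_alg_scal_closed: "p \<in> carrier (free_alg S) \<Longrightarrow> scal c p \<in> carrier (free_alg S)"
  unfolding scal_def
  by (rule free_alg_mult_closed) (auto simp: free_alg_def zero_fmon_def)

lemma free_alg_diff_closed: "p \<in> carrier (free_alg S) \<Longrightarrow> r \<in> carrier (free_alg S) \<Longrightarrow> p - r \<in> carrier (free_alg S)"
  using free_alg_add_closed[OF _ free_alg_uminus_closed, of p S r] by simp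

lemma free_alg_sum_closed:
  "(\<And>a. a \<in> A \<Longrightarrow> f a \<in> carrier (free_alg S)) \<Longrightarrow> sum f A \<in> carrier (free_alg S)"
  by (induction A rule: infinite_finite_induct) (auto simp: free_alg_add_closed)

lemmas free_alg_closed = free_alg_add_closed free_alg_mult_closed free_alg_uminus_closed
  free_alg_scal_closed free_alg_diff_closed free_alg_sum_closed

text \<open>
  Every element is a sum of monomials, so that properties compatible with addition need to be
  checked on multiples of words only.
\<close>

lemma free_alg_induct [consumes 1, case_names zero add]:
  assumes "p \<in> carrier (free_alg S)" and "P 0"
    and step: "\<And>p c w. p \<in> carrier (free_alg S) \<Longrightarrow> set w \<subseteq> S \<Longrightarrow> P p \<Longrightarrow> P (p + scal c (word w))"
  shows "P p"
proof -
  have *: "(\<Sum>w\<in>A. scal (Poly_Mapping.lookup p w) (word (letters w))) \<in> carrier (free_alg S) \<and>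
      P (\<Sum>w\<in>A. scal (Poly_Mapping.lookup p w) (word (letters w)))"
    if "finite A" "A \<subseteq> Poly_Mapping.keys p" for A
    using that
  proof (induction A)
    case (insert w A)
    then have "set (letters w) \<subseteq> S"
      using assms(1) by (auto simp: free_alg_def)
    with insert show ?case
      by (auto simp: add.commute[of "scal _ _"] intro!: step free_alg_closed)
  qed (simp add: assms)
  from *[OF finite_keys, of p] show ?thesis
    using falg_expansion[of p] by simp
qed

lemma complex_algebra_free_alg: "complex_algebra (free_alg S)"
proof -
  have "ring (free_alg S)"
  proof (rule ringI)
    show "abelian_group (free_alg S)"
    proof (rule abelian_groupI)
      fix x assume "x \<in> carrier (free_alg S)"
      then show "\<exists>y\<in>carrier (free_alg S). y \<oplus>\<^bsub>free_alg S\<^esub> x = \<zero>\<^bsub>free_alg S\<^esub>"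
        by (intro bexI[of _ "- x"]) (auto simp: free_alg_closed)
    qed (auto simp: free_alg_closed add.assoc add.commute)
    show "Group.monoid (free_alg S)"
      by (rule Group.monoidI) (auto simp: free_alg_closed mult.assoc)
  qed (auto simp: distrib_left distrib_right)
  then show ?thesis
    unfolding complex_algebra_def complex_algebra_axioms_def
    by (simp add: free_alg_closed scal_add_right scal_add_left scal_scal scal_mult_left scal_mult_right)
qed

lemma free_alg_a_minus:
  assumes "p \<in> carrier (free_alg S)" "r \<in> carrier (free_alg S)"
  shows "p \<ominus>\<^bsub>free_alg S\<^esub> r = p - r"
proof -
  interpret complex_algebra "free_alg S" by (rule complex_algebra_free_alg)
  have "\<ominus>\<^bsub>free_alg S\<^esub> r = - r"
    by (rule minus_equality) (use assms in \<open>auto simp: free_alg_closed\<close>)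
  then show ?thesis by (simp add: a_minus_def)
qed

subsection \<open>Quotient algebras\<close>

context complex_algebra
begin

lemma smult_zero_left: "x \<in> carrier R \<Longrightarrow> 0 \<odot> x = \<zero>"
  using smult_add_left[of x 0 0] by (metis add.l_cancel_one' add_0 smult_closed)

lemma smult_zero_right: "c \<odot> \<zero> = \<zero>"
  using smult_add_right[of \<zero> \<zero> c] by (metis add.l_cancel_one' l_zero smult_closed zero_closed)

lemma smult_minus_one: "x \<in> carrier R \<Longrightarrow> (- 1) \<odot> x = \<ominus> x"
proof -
  assume x: "x \<in> carrier R"
  have "(- 1) \<odot> x \<oplus> x = \<zero>"
    using smult_add_left[OF x, of "-1" 1] x by (simp add: smult_zero_left smult_one)
  then show ?thesis using x by (simp add: minus_equality)
qed

text \<open>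
  A two-sided ideal is a subspace, because $c x = (c 1) x$.
\<close>

lemma smult_ideal:
  assumes "ideal J R" and "x \<in> J"
  shows "c \<odot> x \<in> J"
proof -
  interpret J: ideal J R by fact
  have x: "x \<in> carrier R" using assms(2) by (rule J.a_Hcarr)
  have "c \<odot> x = (c \<odot> \<one>) \<otimes> x"
    using x by (simp add: smult_mult_left)
  then show ?thesis using assms(2) by (simp add: J.I_l_closed)
qed

end

lemma quot_alg_simps:
  "carrier (quot_alg R J) = a_r_coset R J ` carrier R" "zero (quot_alg R J) = J"
  "one (quot_alg R J) = J +>\<^bsub>R\<^esub> \<one>\<^bsub>R\<^esub>"
  by (auto simp: quot_alg_def FactRing_def A_RCOSETS_def' a_r_coset_def' RCOSETS_def)

locale quotient_algebra = complex_algebra R + J: ideal J R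
  for R :: "(complex, 'a) module" (structure) and J
begin

abbreviation cls where "cls x \<equiv> J +> x"

lemma cls_mult: "x \<in> carrier R \<Longrightarrow> y \<in> carrier R \<Longrightarrow> cls x \<otimes>\<^bsub>quot_alg R J\<^esub> cls y = cls (x \<otimes> y)"
  by (simp add: quot_alg_def FactRing_def J.rcoset_mult_add)

lemma cls_add: "x \<in> carrier R \<Longrightarrow> y \<in> carrier R \<Longrightarrow> cls x \<oplus>\<^bsub>quot_alg R J\<^esub> cls y = cls (x \<oplus> y)"
  by (simp add: quot_alg_def FactRing_def J.a_rcos_sum)

lemma cls_eq_iff: "x \<in> carrier R \<Longrightarrow> y \<in> carrier R \<Longrightarrow> cls x = cls y \<longleftrightarrow> x \<ominus> y \<in> J"
  using quotient_eq_iff_same_a_r_cos[OF J.is_ideal] by auto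

text \<open>
  The scalar multiple of a coset is defined as a union over all its representatives; these all
  give the same coset.
\<close>

lemma cls_smult: "x \<in> carrier R \<Longrightarrow> c \<odot>\<^bsub>quot_alg R J\<^esub> cls x = cls (c \<odot> x)"
proof -
  assume x: "x \<in> carrier R"
  have *: "cls (c \<odot> y) = cls (c \<odot> x)" if y: "y \<in> cls x" for y
  proof -
    obtain h where h: "h \<in> J" "y = h \<oplus> x"
      using y by (auto simp: a_r_coset_def r_coset_def)
    have hc: "h \<in> carrier R" using h(1) by (rule J.a_Hcarr)
    have "c \<odot> y \<ominus> c \<odot> x = c \<odot> h"
      using hc x by (simp add: h(2) smult_add_right a_minus_def a_assoc r_neg)
    then show ?thesis
      using h hc x smult_ideal[OF J.is_ideal h(1)] by (subst cls_eq_iff) auto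
  qed
  have "(\<Union>y\<in>cls x. cls (c \<odot> y)) = (\<Union>y\<in>cls x. cls (c \<odot> x))"
    by (rule SUP_cong) (simp_all only: *)
  also have "\<dots> = cls (c \<odot> x)"
    using J.a_rcos_self[OF x] by blast
  finally show ?thesis
    by (simp add: quot_alg_def)
qed

lemma cls_self: "x \<in> carrier R \<Longrightarrow> x \<in> cls x"
  by (rule J.a_rcos_self)

lemma cls_carrier: "x \<in> carrier R \<Longrightarrow> cls x \<in> carrier (quot_alg R J)"
  by (simp add: quot_alg_simps)

lemma cls_eq_zero_iff: "x \<in> carrier R \<Longrightarrow> cls x = \<zero>\<^bsub>quot_alg R J\<^esub> \<longleftrightarrow> x \<in> J"
  using cls_eq_iff[of x \<zero>] a_rcos_zero[OF J.is_ideal J.zero_closed]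
  by (simp add: quot_alg_simps a_minus_def)

lemma complex_algebra_quot: "complex_algebra (quot_alg R J)"
proof -
  have zero: "\<zero>\<^bsub>quot_alg R J\<^esub> = cls \<zero>"
    using a_rcos_zero[OF J.is_ideal J.zero_closed] by (simp add: quot_alg_simps)
  note simps = quot_alg_simps(1,3) zero cls_mult cls_add cls_smult
  have "ring (quot_alg R J)"
  proof (rule ringI)
    show "abelian_group (quot_alg R J)"
    proof (rule abelian_groupI)
      fix X assume "X \<in> carrier (quot_alg R J)"
      then obtain x where "x \<in> carrier R" "X = cls x" by (auto simp: simps)
      then show "\<exists>Y\<in>carrier (quot_alg R J). Y \<oplus>\<^bsub>quot_alg R J\<^esub> X = \<zero>\<^bsub>quot_alg R J\<^esub>"
        by (intro bexI[of _ "cls (\<ominus> x)"]) (auto simp: simps l_neg)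
    qed (auto simp: simps a_ac)
    show "Group.monoid (quot_alg R J)"
      by (rule Group.monoidI) (auto simp: simps m_assoc)
  qed (auto simp: simps l_distr r_distr)
  then show ?thesis
    unfolding complex_algebra_def complex_algebra_axioms_def
    by (auto simp: simps smult_add_right smult_add_left
        smult_smult smult_one smult_mult_left smult_mult_right)
qed

end


section \<open>Straightening in quadratic algebras of quantum exterior type\<close>

subsection \<open>Convex heights\<close>

text \<open>
  A nested pair of intervals has larger total height than the crossed pair with the same four
  end points.  Any strictly convex function of the length is an example.
\<close>

definition convex_height :: "nat \<Rightarrow> (nat \<times> nat \<Rightarrow> nat) \<Rightarrow> bool" where
  "convex_height n h \<longleftrightarrow>
     (\<forall>b a c d. 1 \<le> b \<and> b < a \<and> a < c \<and> c < d \<and> d \<le> n + 1 \<longrightarrow> h (a, d) + h (b, c) < h (b, d) + h (a, c))"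

definition height :: "(nat \<times> nat \<Rightarrow> nat) \<Rightarrow> (nat \<times> nat) list \<Rightarrow> nat" where
  "height h w = sum_list (map h w)"

lemma height_simps [simp]: "height h [] = 0" "height h (\<gamma> # w) = h \<gamma> + height h w"
  "height h (u @ w) = height h u + height h w"
  by (simp_all add: height_def)

lemma height_distinct: "distinct w \<Longrightarrow> height h w = sum h (set w)"
  by (simp add: height_def sum_list_distinct_conv_sum_set)

text \<open>
  Adding a function of the left end and a function of the right end changes nested and crossed
  pairs by the same amount.  This freedom is what allows heights to tell two given roots apart.
\<close>

lemma convex_height_squares: "convex_height n (\<lambda>(i, j). (j - i)\<^sup>2 + (f i + g j))"
  unfolding convex_height_def
proof (intro allI impI)
  fix b a c d :: nat
  assume "1 \<le> b \<and> b < a \<and> a < c \<and> c < d \<and> d \<le> n + 1"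
  then obtain x y z where "a = b + x" "c = b + x + y" "d = b + x + y + z" and "x > 0" "z > 0"
    by (metis less_imp_add_positive)
  moreover have "(y + z)\<^sup>2 + (x + y)\<^sup>2 < (x + y + z)\<^sup>2 + y\<^sup>2"
    using \<open>x > 0\<close> \<open>z > 0\<close> by (simp add: power2_eq_square algebra_simps)
  ultimately show "(case (a, d) of (i, j) \<Rightarrow> (j - i)\<^sup>2 + (f i + g j)) + (case (b, c) of (i, j) \<Rightarrow> (j - i)\<^sup>2 + (f i + g j))
      < (case (b, d) of (i, j) \<Rightarrow> (j - i)\<^sup>2 + (f i + g j)) + (case (a, c) of (i, j) \<Rightarrow> (j - i)\<^sup>2 + (f i + g j))"
    by (simp add: add.assoc[symmetric])
qed

lemma convex_height_exists: "\<exists>h. convex_height n h"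
  using convex_height_squares[of n "\<lambda>_. 0" "\<lambda>_. 0"] by blast

text \<open>
  The root \<open>\<beta>\<close> gets a bonus for each of its end points; a different root shares at most one
  of them, and one bonus is at least as large as any squared length.
\<close>

lemma convex_height_separating:
  assumes "\<beta> \<in> pos_roots n" "\<gamma> \<in> pos_roots n" "\<beta> \<noteq> \<gamma>"
  obtains h where "convex_height n h" and "h \<gamma> \<le> h \<beta>"
proof -
  obtain i0 j0 i j where eq: "\<beta> = (i0, j0)" "\<gamma> = (i, j)" by fastforce
  \<comment> \<open>an upper bound for all squared lengths\<close>
  define M where "M = (n + 1)\<^sup>2"
  define h where "h = (\<lambda>(i, j). (j - i)\<^sup>2 + ((if i = i0 then M else 0) + (if j = j0 then M else 0)))"
  have "convex_height n h"
    unfolding h_def by (rule convex_height_squares)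
  moreover have "(j - i)\<^sup>2 \<le> M"
    unfolding M_def using assms(2) by (intro power_mono) (auto simp: eq pos_roots_def)
  then have "h \<gamma> \<le> h \<beta>"
    using assms(3) by (auto simp: h_def eq)
  ultimately show ?thesis by (rule that)
qed

subsection \<open>The exponents of the commutation relations\<close>

text \<open>
  Exponent \<open>m\<close> in $e_\alpha e_\beta = -q^m e_\beta e_\alpha + \cdots$ for \<open>\<alpha> = (i, j)\<close> and \<open>\<beta> = (k, l)\<close>.
\<close>

fun comm_exp :: "nat \<times> nat \<Rightarrow> nat \<times> nat \<Rightarrow> int" where
  "comm_exp (i, j) (k, l) =
     (if i = k then sgn (int l - int j) else 0) + (if j = l then sgn (int k - int i) else 0)
     + of_bool (l = i) - of_bool (k = j)"

lemma pos_roots_eq_Sigma: "pos_roots n = (SIGMA k:{1..n+1}. {k<..n+1})"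
  by (auto simp: pos_roots_def)

lemma finite_pos_roots [simp]: "finite (pos_roots n)"
  by (simp add: pos_roots_eq_Sigma)

lemma comm_exp_self: "\<gamma> \<in> pos_roots n \<Longrightarrow> comm_exp \<gamma> \<gamma> = 0"
  by (auto simp: pos_roots_def)

text \<open>
  Let \<open>\<gamma> = (i, j)\<close>.  Apart from \<open>\<gamma>\<close>, whose exponent is \<open>0\<close>, only roots that share exactly one end point
  with \<open>\<gamma>\<close> contribute.  Grouping them by their other end point \<open>t\<close>, there are two roots for each \<open>t\<close> outside \<open>{i, j}\<close>, and their exponents are \<open>1\<close>
  and \<open>-1\<close>.
\<close>

lemma sum_comm_exp:
  assumes "\<gamma> \<in> pos_roots n"
  shows "(\<Sum>\<beta>\<in>pos_roots n. comm_exp \<gamma> \<beta>) = 0"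
proof -
  obtain i j where eq: "\<gamma> = (i, j)" by fastforce
  have ij: "1 \<le> i" "i < j" "j \<le> n + 1" using assms by (auto simp: eq pos_roots_def)
  let ?A = "{1..n+1}"
  have pos: "pos_roots n = {\<beta> \<in> ?A \<times> ?A. fst \<beta> < snd \<beta>}"
    by (auto simp: pos_roots_def)
  have "(\<Sum>\<beta>\<in>pos_roots n. comm_exp \<gamma> \<beta>)
      = (\<Sum>\<beta>\<in>?A \<times> ?A. if fst \<beta> < snd \<beta> then comm_exp \<gamma> \<beta> else 0)"
    unfolding pos by (rule sum.inter_filter) simp
  also have "\<dots> = (\<Sum>k\<in>?A. \<Sum>l\<in>?A. if k < l then comm_exp \<gamma> (k, l) else 0)"
    by (simp only: sum.cartesian_product case_prod_unfold prod.collapse fst_conv snd_conv)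
  also have "\<dots> = (\<Sum>k\<in>?A. \<Sum>l\<in>?A. (if k = i then if i < l then sgn (int l - int j) else 0 else 0)
        + (if l = j then if k < j then sgn (int k - int i) else 0 else 0)
        + (if l = i then of_bool (k < i) else 0) - (if k = j then of_bool (j < l) else 0))"
    by (intro sum.cong refl) (auto simp: eq)
  also have "\<dots> = (\<Sum>l\<in>?A. if i < l then sgn (int l - int j) else 0)
        + (\<Sum>k\<in>?A. if k < j then sgn (int k - int i) else 0)
        + (\<Sum>k\<in>?A. of_bool (k < i)) - (\<Sum>l\<in>?A. of_bool (j < l))"
  proof -
    have swap: "(\<Sum>k\<in>?A. \<Sum>l\<in>?A. if k = c then f l else (0::int)) = (\<Sum>l\<in>?A. f l)" if "c \<in> ?A" for c f
      by (subst sum.swap) (use that in \<open>simp add: sum.delta\<close>)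
    have nswap: "(\<Sum>k\<in>?A. \<Sum>l\<in>?A. if l = c then f k else (0::int)) = (\<Sum>k\<in>?A. f k)" if "c \<in> ?A" for c f
      using that by (simp add: sum.delta)
    have "i \<in> ?A" "j \<in> ?A" using ij by auto
    then show ?thesis
      by (simp only: sum.distrib sum_subtractf swap nswap)
  qed
  also have "\<dots> = (\<Sum>t\<in>?A. (if i < t then sgn (int t - int j) else 0)
        + (if t < j then sgn (int t - int i) else 0) + of_bool (t < i) - of_bool (j < t))"
    by (simp only: sum.distrib sum_subtractf)
  also have "\<dots> = 0"
    using ij by (intro sum.neutral ballI) (auto simp: sgn_if)
  finally show ?thesis .
qed

subsection \<open>Reordering words\<close>

text \<open>
  An ideal \<open>J\<close> of the free algebra on \<open>S\<close> such that the quotient is generated by the classes of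
  the letters \<open>v \<gamma>\<close> and satisfies the relations of the quantum exterior algebra.  The letter \<open>v (i, j)\<close>
  stands for $e_{ji}$.  The alphabet \<open>S\<close> may be larger than the set of these letters, as it is for
  the tensor algebra, whose alphabet consists of all vectors.
\<close>

locale quantum_exterior =
  fixes n :: nat and q :: complex and S :: "'v set" and v :: "nat \<times> nat \<Rightarrow> 'v" and J :: "'v falg set"
  assumes q_nonzero: "q \<noteq> 0" and q_square: "q\<^sup>2 \<noteq> - 1"
    and v_mem: "\<gamma> \<in> pos_roots n \<Longrightarrow> v \<gamma> \<in> S"
    and J_ideal: "ideal J (free_alg S)"
    and letters_span: "s \<in> S \<Longrightarrow> \<exists>c. gen s - (\<Sum>\<gamma>\<in>pos_roots n. scal (c \<gamma>) (gen (v \<gamma>))) \<in> J"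
    and relation: "1 \<le> b \<Longrightarrow> b \<le> a \<Longrightarrow> a < c \<Longrightarrow> b < d \<Longrightarrow> c \<le> n + 1 \<Longrightarrow> d \<le> n + 1 \<Longrightarrow>
      scal (if a = b then inverse q else 1) (gen (v (b, d)) * gen (v (a, c)))
      + scal (if c = d then q else if a = d then inverse q else 1) (gen (v (a, c)) * gen (v (b, d)))
      + scal (if c < d then q - inverse q else 0) (gen (v (a, d)) * gen (v (b, c))) \<in> J"
begin

abbreviation "C \<equiv> carrier (free_alg S)"

definition mon :: "(nat \<times> nat) list \<Rightarrow> 'v falg" where
  "mon w = word (map v w)"

lemma mon_append: "mon (u @ w) = mon u * mon w"
  by (simp add: mon_def word_append)

lemma mon_Cons: "mon (\<gamma> # w) = gen (v \<gamma>) * mon w"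
  using mon_append[of "[\<gamma>]" w] by (simp add: mon_def gen_eq_word)

lemma mon_Nil: "mon [] = 1"
  by (simp add: mon_def word_Nil)

lemma mon_closed: "set w \<subseteq> pos_roots n \<Longrightarrow> mon w \<in> C"
  using v_mem by (auto simp: mon_def)

sublocale J: ideal J "free_alg S" by (rule J_ideal)

lemma J_closed: "p \<in> J \<Longrightarrow> p \<in> C"
  by (rule J.a_Hcarr)

lemma J_zero: "0 \<in> J"
  using additive_subgroup.zero_closed[OF ideal.axioms(1)[OF J_ideal]] by simp

lemma J_add: "p \<in> J \<Longrightarrow> r \<in> J \<Longrightarrow> p + r \<in> J"
  using additive_subgroup.a_closed[OF ideal.axioms(1)[OF J_ideal]] by simp

lemma J_mult_left: "p \<in> C \<Longrightarrow> r \<in> J \<Longrightarrow> p * r \<in> J"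
  using J.I_l_closed by simp

lemma J_mult_right: "p \<in> C \<Longrightarrow> r \<in> J \<Longrightarrow> r * p \<in> J"
  using J.I_r_closed by simp

lemma J_scal: "p \<in> J \<Longrightarrow> scal c p \<in> J"
  using complex_algebra.smult_ideal[OF complex_algebra_free_alg J_ideal] by simp

text \<open>
  The linear span of \<open>J\<close> and of the words in \<open>W\<close>.
\<close>

inductive_set span_mod :: "(nat \<times> nat) list set \<Rightarrow> 'v falg set" for W where
  span_base: "p \<in> J \<Longrightarrow> p \<in> span_mod W"
| span_step: "p \<in> span_mod W \<Longrightarrow> w \<in> W \<Longrightarrow> p + scal c (mon w) \<in> span_mod W"

lemma span_zero: "0 \<in> span_mod W"
  by (rule span_base, rule J_zero)

lemma span_mon: "w \<in> W \<Longrightarrow> mon w \<in> span_mod W"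
  using span_step[OF span_zero, of w W 1] by simp

lemma span_add: "r \<in> span_mod W \<Longrightarrow> p \<in> span_mod W \<Longrightarrow> p + r \<in> span_mod W"
proof (induction r rule: span_mod.induct)
  case (span_base r)
  from span_base(2,1) show ?case
  proof (induction p rule: span_mod.induct)
    case (span_base p)
    then show ?case by (auto intro: span_mod.span_base J_add)
  next
    case (span_step p w c)
    then show ?case
      using span_mod.span_step[of "p + r" W w c] by (simp add: algebra_simps)
  qed
next
  case (span_step r w c)
  then show ?case
    using span_mod.span_step[of "p + r" W w c] by (simp add: algebra_simps)
qed

lemma span_scal: "p \<in> span_mod W \<Longrightarrow> scal c p \<in> span_mod W"
proof (induction p rule: span_mod.induct)
  case (span_base p)
  then show ?case by (auto intro: span_mod.span_base J_scal)
next
  case (span_step p w d)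
  then show ?case
    using span_mod.span_step[of "scal c p" W w "c * d"] by (simp add: scal_add_right scal_scal)
qed

lemma span_uminus: "p \<in> span_mod W \<Longrightarrow> - p \<in> span_mod W"
  using span_scal[of p W "-1"] by (simp add: scal_minus_left)

lemma span_diff: "p \<in> span_mod W \<Longrightarrow> r \<in> span_mod W \<Longrightarrow> p - r \<in> span_mod W"
  using span_add[OF span_uminus, of r W p] by simp

lemma span_sum: "(\<And>a. a \<in> A \<Longrightarrow> f a \<in> span_mod W) \<Longrightarrow> sum f A \<in> span_mod W"
  by (induction A rule: infinite_finite_induct) (auto simp: span_zero intro: span_add)

lemma span_trans: "p \<in> span_mod W \<Longrightarrow> (\<And>w. w \<in> W \<Longrightarrow> mon w \<in> span_mod W') \<Longrightarrow> p \<in> span_mod W'"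
  by (induction p rule: span_mod.induct) (auto intro: span_base span_add span_scal)

lemma span_mono: "p \<in> span_mod W \<Longrightarrow> W \<subseteq> W' \<Longrightarrow> p \<in> span_mod W'"
  by (erule span_trans) (auto intro: span_mon)

lemma span_mult:
  assumes "p \<in> span_mod W" "r \<in> span_mod W'"
    and "\<And>w. w \<in> W \<Longrightarrow> set w \<subseteq> pos_roots n" "\<And>w. w \<in> W' \<Longrightarrow> set w \<subseteq> pos_roots n"
  shows "p * r \<in> span_mod {u @ w | u w. u \<in> W \<and> w \<in> W'}"
proof -
  have *: "r \<in> C" using assms(2)
    by (induction rule: span_mod.induct) (auto intro: free_alg_closed J_closed mon_closed[OF assms(4)])
  from assms(1) show ?thesis
  proof (induction p rule: span_mod.induct)
    case (span_base p)
    then show ?case using * by (auto intro: span_mod.span_base J_mult_right)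
  next
    case (span_step p u c)
    have "mon u * r \<in> span_mod {u @ w | u w. u \<in> W \<and> w \<in> W'}"
      using assms(2)
    proof (induction r rule: span_mod.induct)
      case (span_base r)
      then show ?case
        using assms(3)[OF span_step(2)] by (auto intro: span_mod.span_base J_mult_left mon_closed)
    next
      case (span_step r w d)
      have "mon u * (r + scal d (mon w)) = mon u * r + scal d (mon (u @ w))"
        by (simp add: distrib_left scal_mult_right mon_append)
      also have "\<dots> \<in> span_mod {u @ w | u w. u \<in> W \<and> w \<in> W'}"
        using span_step \<open>u \<in> W\<close> by (intro span_mod.span_step) auto
      finally show ?case .
    qed
    then show ?case
      using span_step(3) by (simp add: distrib_right scal_mult_left span_add span_scal)
  qed
qed

definition lower_words :: "(nat \<times> nat \<Rightarrow> nat) \<Rightarrow> nat \<Rightarrow> nat \<Rightarrow> (nat \<times> nat) list set" where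
  "lower_words h k t = {w. set w \<subseteq> pos_roots n \<and> length w = k \<and> height h w < t}"

lemma span_low_context:
  assumes "p \<in> span_mod (lower_words h k t)" "set x \<subseteq> pos_roots n" "set y \<subseteq> pos_roots n"
  shows "mon x * p * mon y \<in> span_mod (lower_words h (length x + k + length y) (height h x + t + height h y))"
proof -
  have "mon x * p * mon y \<in> span_mod {u @ w | u w. u \<in> {u @ w | u w. u \<in> {x} \<and> w \<in> lower_words h k t} \<and> w \<in> {y}}"
    using assms by (intro span_mult span_mon) (auto simp: lower_words_def)
  then show ?thesis
    by (rule span_mono) (use assms in \<open>auto simp: lower_words_def\<close>)
qed

lemma span_low_Cons:
  assumes "p \<in> span_mod (lower_words h k t)" "\<gamma> \<in> pos_roots n"
  shows "gen (v \<gamma>) * p \<in> span_mod (lower_words h (Suc k) (h \<gamma> + t))"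
  using span_low_context[OF assms(1), of "[\<gamma>]" "[]"] assms(2) by (simp add: mon_Cons mon_Nil)

lemma square_mem:
  assumes "\<gamma> \<in> pos_roots n"
  shows "mon [\<gamma>, \<gamma>] \<in> J"
proof -
  obtain i j where "\<gamma> = (i, j)" by fastforce
  with assms have "scal (inverse q) (mon [\<gamma>, \<gamma>]) + scal q (mon [\<gamma>, \<gamma>]) \<in> J"
    using relation[of i i j j] by (simp add: pos_roots_def mon_Cons mon_Nil)
  then have "scal (inverse q + q) (mon [\<gamma>, \<gamma>]) \<in> J"
    by (simp add: scal_add_left)
  from J_scal[OF this, of "inverse (inverse q + q)"]
  have "scal (inverse (inverse q + q) * (inverse q + q)) (mon [\<gamma>, \<gamma>]) \<in> J"
    by (simp only: scal_scal)
  moreover have "inverse q + q \<noteq> 0"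
  proof
    assume "inverse q + q = 0"
    then have "q * (inverse q + q) = 0" by simp
    then show False
      using q_nonzero q_square by (simp add: distrib_left power2_eq_square add_eq_0_iff)
  qed
  ultimately show ?thesis by simp
qed

text \<open>
  This is a defining relation in which \<open>b\<close> is the smaller one of the left ends.  If both left ends agree, the third
  term of the relation is itself a multiple of $e_\beta e_\alpha$ and turns $q^{-1}$ into \<open>q\<close>;
  otherwise it is present for nested pairs only, and of smaller height.
\<close>

lemma swap_two:
  assumes "convex_height n h" "\<alpha> \<in> pos_roots n" "\<beta> \<in> pos_roots n" "\<alpha> \<noteq> \<beta>"
  shows "mon [\<alpha>, \<beta>] + scal (q powi comm_exp \<alpha> \<beta>) (mon [\<beta>, \<alpha>]) \<in> span_mod (lower_words h 2 (h \<alpha> + h \<beta>))"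
proof -
  obtain i j k l where eq: "\<alpha> = (i, j)" "\<beta> = (k, l)" by fastforce
  have bounds: "1 \<le> i" "i < j" "j \<le> n + 1" "1 \<le> k" "k < l" "l \<le> n + 1"
    using assms by (auto simp: eq pos_roots_def)
  let ?L = "span_mod (lower_words h 2 (h \<alpha> + h \<beta>))"
  have nested: "mon [(a, d), (b, c)] \<in> span_mod (lower_words h 2 (h (b, d) + h (a, c)))"
    if "1 \<le> b" "b < a" "a < c" "c < d" "d \<le> n + 1" for a b c d
    using that assms(1) unfolding convex_height_def
    by (intro span_mon) (auto simp: lower_words_def pos_roots_def)
  consider "k < i" | "k = i" "j < l" | "k = i" "l < j" | "i < k"
    using assms(4) unfolding eq by fastforce
  then show ?thesis
  proof cases
    case 1
    define r where "r = (if j = l then q else if i = l then inverse q else 1)"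
    have "mon [\<beta>, \<alpha>] + scal r (mon [\<alpha>, \<beta>]) + scal (if j < l then q - inverse q else 0) (mon [(i, l), (k, j)]) \<in> J"
      using relation[of k i j l] 1 bounds by (simp add: eq mon_Cons mon_Nil r_def)
    then have "mon [\<beta>, \<alpha>] + scal r (mon [\<alpha>, \<beta>]) + scal (if j < l then q - inverse q else 0) (mon [(i, l), (k, j)]) \<in> ?L"
      by (rule span_base)
    moreover have "scal (if j < l then q - inverse q else 0) (mon [(i, l), (k, j)]) \<in> ?L"
      using nested[of k i j l] 1 bounds by (auto simp: eq span_zero add.commute intro!: span_scal)
    ultimately have "mon [\<beta>, \<alpha>] + scal r (mon [\<alpha>, \<beta>]) \<in> ?L"
      using span_diff by fastforce
    then have "scal (inverse r) (mon [\<beta>, \<alpha>] + scal r (mon [\<alpha>, \<beta>])) \<in> ?L"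
      by (rule span_scal)
    moreover have "q powi comm_exp \<alpha> \<beta> = inverse r" "r \<noteq> 0"
      using 1 bounds q_nonzero by (auto simp: eq r_def power_int_minus)
    ultimately show ?thesis
      by (simp add: scal_add_right scal_scal add.commute)
  next
    case 2
    have "scal (inverse q) (mon [\<beta>, \<alpha>]) + mon [\<alpha>, \<beta>] + scal (q - inverse q) (mon [\<beta>, \<alpha>]) \<in> J"
      using relation[of k i j l] 2 bounds by (simp add: eq mon_Cons mon_Nil)
    moreover have "scal (inverse q) (mon [\<beta>, \<alpha>]) + mon [\<alpha>, \<beta>] + scal (q - inverse q) (mon [\<beta>, \<alpha>])
        = mon [\<alpha>, \<beta>] + scal (inverse q + (q - inverse q)) (mon [\<beta>, \<alpha>])"
      by (simp only: scal_add_left) (simp add: algebra_simps)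
    moreover have "q powi comm_exp \<alpha> \<beta> = q"
      using 2 bounds by (simp add: eq)
    ultimately show ?thesis by (simp add: span_base)
  next
    case 3
    then have "scal (inverse q) (mon [\<beta>, \<alpha>]) + mon [\<alpha>, \<beta>] \<in> J"
      using relation[of k i j l] bounds by (simp add: eq mon_Cons mon_Nil)
    moreover have "q powi comm_exp \<alpha> \<beta> = inverse q"
      using 3 bounds by (simp add: eq power_int_minus)
    ultimately show ?thesis by (simp add: span_base add.commute)
  next
    case 4
    define r where "r = (if l = j then q else if k = j then inverse q else 1)"
    have "mon [\<alpha>, \<beta>] + scal r (mon [\<beta>, \<alpha>]) + scal (if l < j then q - inverse q else 0) (mon [(k, j), (i, l)]) \<in> J"
      using relation[of i k l j] 4 bounds by (simp add: eq mon_Cons mon_Nil r_def)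
    then have "mon [\<alpha>, \<beta>] + scal r (mon [\<beta>, \<alpha>]) + scal (if l < j then q - inverse q else 0) (mon [(k, j), (i, l)]) \<in> ?L"
      by (rule span_base)
    moreover have "scal (if l < j then q - inverse q else 0) (mon [(k, j), (i, l)]) \<in> ?L"
      using nested[of i k l j] 4 bounds by (auto simp: eq span_zero intro!: span_scal)
    ultimately have "mon [\<alpha>, \<beta>] + scal r (mon [\<beta>, \<alpha>]) \<in> ?L"
      using span_diff by fastforce
    moreover have "q powi comm_exp \<alpha> \<beta> = r"
      using 4 bounds by (auto simp: eq r_def power_int_minus)
    ultimately show ?thesis by simp
  qed
qed

lemma swap_head:
  assumes "convex_height n h" "\<alpha> \<in> pos_roots n" "\<beta> \<in> pos_roots n" "\<alpha> \<noteq> \<beta>" "set y \<subseteq> pos_roots n"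
  shows "mon (\<alpha> # \<beta> # y) + scal (q powi comm_exp \<alpha> \<beta>) (mon (\<beta> # \<alpha> # y))
    \<in> span_mod (lower_words h (length (\<alpha> # \<beta> # y)) (height h (\<alpha> # \<beta> # y)))"
  using span_low_context[OF swap_two[OF assms(1-4)], of "[]" y] assms(5)
  by (simp add: mon_Nil distrib_right scal_mult_left add.assoc mon_append[symmetric])

lemma move_to_end:
  assumes h: "convex_height n h"
  shows "\<gamma> \<in> pos_roots n \<Longrightarrow> set y \<subseteq> pos_roots n \<Longrightarrow> \<gamma> \<notin> set y \<Longrightarrow>
    mon (\<gamma> # y) - scal (prod_list (map (\<lambda>\<beta>. - (q powi comm_exp \<gamma> \<beta>)) y)) (mon (y @ [\<gamma>]))
    \<in> span_mod (lower_words h (length (\<gamma> # y)) (height h (\<gamma> # y)))"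
proof (induction y)
  case Nil
  then show ?case by (simp add: span_zero)
next
  case (Cons \<beta> y)
  let ?L = "span_mod (lower_words h (length (\<gamma> # \<beta> # y)) (height h (\<gamma> # \<beta> # y)))"
  let ?c = "prod_list (map (\<lambda>\<beta>. - (q powi comm_exp \<gamma> \<beta>)) y)" and ?d = "q powi comm_exp \<gamma> \<beta>"
  have "gen (v \<beta>) * (mon (\<gamma> # y) - scal ?c (mon (y @ [\<gamma>]))) \<in> ?L"
    using span_low_Cons[OF Cons.IH, of \<beta>] Cons.prems by (simp add: add.left_commute)
  then have "mon (\<beta> # \<gamma> # y) - scal ?c (mon (\<beta> # y @ [\<gamma>])) \<in> ?L"
    by (simp add: right_diff_distrib scal_mult_right mon_Cons)
  from span_scal[OF this, of ?d]
  have 1: "scal ?d (mon (\<beta> # \<gamma> # y)) - scal (?d * ?c) (mon (\<beta> # y @ [\<gamma>])) \<in> ?L"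
    by (simp add: scal_diff_right scal_scal)
  have "mon (\<gamma> # \<beta> # y) + scal ?d (mon (\<beta> # \<gamma> # y)) \<in> ?L"
    using Cons.prems by (intro swap_head h) auto
  from span_diff[OF this 1] show ?case
    by (simp add: scal_minus_left)
qed

lemma bring_to_front:
  assumes h: "convex_height n h"
  shows "\<alpha> \<in> pos_roots n \<Longrightarrow> set x \<subseteq> pos_roots n \<Longrightarrow> set y \<subseteq> pos_roots n \<Longrightarrow>
    \<exists>c. c \<noteq> 0 \<and> mon (x @ \<alpha> # y) - scal c (mon (\<alpha> # x @ y))
      \<in> span_mod (lower_words h (length (\<alpha> # x @ y)) (height h (\<alpha> # x @ y)))"
proof (induction x)
  case Nil
  then show ?case by (intro exI[of _ 1]) (simp add: span_zero)
next
  case (Cons \<beta> x)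
  let ?L = "span_mod (lower_words h (length (\<alpha> # (\<beta> # x) @ y)) (height h (\<alpha> # (\<beta> # x) @ y)))"
  from Cons obtain c where c: "c \<noteq> 0" "mon (x @ \<alpha> # y) - scal c (mon (\<alpha> # x @ y))
      \<in> span_mod (lower_words h (length (\<alpha> # x @ y)) (height h (\<alpha> # x @ y)))"
    by auto
  have "gen (v \<beta>) * (mon (x @ \<alpha> # y) - scal c (mon (\<alpha> # x @ y))) \<in> ?L"
    using span_low_Cons[OF c(2), of \<beta>] Cons.prems by (simp add: add.left_commute)
  then have 1: "mon (\<beta> # x @ \<alpha> # y) - scal c (mon (\<beta> # \<alpha> # x @ y)) \<in> ?L"
    by (simp add: right_diff_distrib scal_mult_right mon_Cons)
  show ?case
  proof (cases "\<alpha> = \<beta>")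
    case True
    with 1 c(1) show ?thesis by auto
  next
    case False
    let ?d = "q powi comm_exp \<beta> \<alpha>"
    have "mon (\<beta> # \<alpha> # x @ y) + scal ?d (mon (\<alpha> # \<beta> # x @ y)) \<in> ?L"
      using swap_head[OF h, of \<beta> \<alpha> "x @ y"] Cons.prems False by (simp add: add.left_commute)
    from span_add[OF 1 span_scal[OF this, of c]]
    have "mon (\<beta> # x @ \<alpha> # y) - scal (- (c * ?d)) (mon (\<alpha> # \<beta> # x @ y)) \<in> ?L"
      by (simp add: scal_add_right scal_scal scal_minus_left algebra_simps)
    moreover have "- (c * ?d) \<noteq> 0"
      using c(1) q_nonzero by simp
    ultimately show ?thesis by (metis append_Cons)
  qed
qed

text \<open>
  Induction on the first word: its first letter is moved to the front of the second word.
\<close>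

lemma permute:
  assumes h: "convex_height n h"
  shows "set u \<subseteq> pos_roots n \<Longrightarrow> mset u = mset w \<Longrightarrow>
    \<exists>c. c \<noteq> 0 \<and> mon w - scal c (mon u) \<in> span_mod (lower_words h (length w) (height h w))"
proof (induction u arbitrary: w)
  case Nil
  then show ?case by (intro exI[of _ 1]) (simp add: span_zero)
next
  case (Cons \<alpha> u)
  let ?L = "span_mod (lower_words h (length w) (height h w))"
  have "\<alpha> \<in> set w" using Cons.prems(2) by (metis list.set_intros(1) mset_eq_setD)
  then obtain x y where w: "w = x @ \<alpha> # y" by (meson split_list)
  have set_w: "set w \<subseteq> pos_roots n" using Cons.prems by (metis mset_eq_setD)
  obtain c where c: "c \<noteq> 0" "mon w - scal c (mon (\<alpha> # x @ y)) \<in> ?L"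
    using bring_to_front[OF h, of \<alpha> x y] set_w by (auto simp: w add.left_commute)
  have "mset u = mset (x @ y)" using Cons.prems(2) by (simp add: w)
  with Cons obtain d where d: "d \<noteq> 0"
      "mon (x @ y) - scal d (mon u) \<in> span_mod (lower_words h (length (x @ y)) (height h (x @ y)))"
    by (metis set_subset_Cons subset_trans)
  have "gen (v \<alpha>) * (mon (x @ y) - scal d (mon u)) \<in> ?L"
    using span_low_Cons[OF d(2), of \<alpha>] set_w by (simp add: w add.left_commute)
  then have "mon (\<alpha> # x @ y) - scal d (mon (\<alpha> # u)) \<in> ?L"
    by (simp add: right_diff_distrib scal_mult_right mon_Cons)
  from span_add[OF c(2) span_scal[OF this, of c]]
  have "mon w - scal (c * d) (mon (\<alpha> # u)) \<in> ?L"
    by (simp add: scal_diff_right scal_scal)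
  then show ?case using c(1) d(1) by (metis no_zero_divisors)
qed

text \<open>
  Bring two equal letters next to each other; their product is zero.
\<close>

lemma repeated_letter:
  assumes h: "convex_height n h" and "set w \<subseteq> pos_roots n" "\<not> distinct w"
  shows "mon w \<in> span_mod (lower_words h (length w) (height h w))"
proof -
  obtain x y z \<gamma> where w: "w = x @ [\<gamma>] @ y @ [\<gamma>] @ z"
    using assms(3) not_distinct_decomp by blast
  \<comment> \<open>the same letters, with the repeated ones in front\<close>
  let ?u = "[\<gamma>, \<gamma>] @ x @ y @ z"
  have u: "set ?u \<subseteq> pos_roots n" "mset ?u = mset w"
    using assms(2) by (auto simp: w)
  obtain c where "mon w - scal c (mon ?u) \<in> span_mod (lower_words h (length w) (height h w))"
    using permute[OF h u] by blast
  moreover have "mon ?u \<in> J"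
    unfolding mon_append[of "[\<gamma>, \<gamma>]"]
    using u(1) by (intro J_mult_right square_mem mon_closed) auto
  then have "scal c (mon ?u) \<in> span_mod (lower_words h (length w) (height h w))"
    by (intro span_scal span_base)
  ultimately show ?thesis
    using span_add by fastforce
qed

text \<open>
  An arbitrary arrangement of a set of roots: by \<open>permute\<close> no particular order is distinguished.
\<close>

definition std :: "(nat \<times> nat) set \<Rightarrow> (nat \<times> nat) list" where
  "std T = (SOME w. distinct w \<and> set w = T)"

lemma std: "T \<subseteq> pos_roots n \<Longrightarrow> distinct (std T) \<and> set (std T) = T"
  unfolding std_def by (rule someI_ex) (metis finite_distinct_list finite_pos_roots finite_subset)

definition basis :: "(nat \<times> nat) list set" where
  "basis = std ` Pow (pos_roots n)"

lemma finite_basis: "finite basis"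
  by (simp add: basis_def)

lemma basis_props: "w \<in> basis \<Longrightarrow> distinct w \<and> set w \<subseteq> pos_roots n"
  using std by (auto simp: basis_def)

lemma basis_eqI: "u \<in> basis \<Longrightarrow> w \<in> basis \<Longrightarrow> set u = set w \<Longrightarrow> u = w"
  using std by (auto simp: basis_def)

text \<open>
  Induction on the height: rearranging a word into its standard arrangement, or recognising a
  repetition, costs words of smaller height only.
\<close>

lemma mon_span_basis: "set w \<subseteq> pos_roots n \<Longrightarrow> mon w \<in> span_mod basis"
proof -
  obtain h where h: "convex_height n h" using convex_height_exists by blast
  show "set w \<subseteq> pos_roots n \<Longrightarrow> mon w \<in> span_mod basis"
  proof (induction "height h w" arbitrary: w rule: less_induct)
    case less
    have low: "p \<in> span_mod basis" if "p \<in> span_mod (lower_words h (length w) (height h w))" for p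
      using that by (rule span_trans) (use less.hyps in \<open>auto simp: lower_words_def\<close>)
    show ?case
    proof (cases "distinct w")
      case True
      have s: "distinct (std (set w))" "set (std (set w)) = set w"
        using std[OF less.prems] by auto
      then have "mset (std (set w)) = mset w"
        using True by (metis set_eq_iff_mset_eq_distinct)
      then obtain c where "mon w - scal c (mon (std (set w))) \<in> span_mod basis"
        using permute[OF h, of "std (set w)" w] s less.prems low by auto
      moreover have "scal c (mon (std (set w))) \<in> span_mod basis"
        using less.prems by (intro span_scal span_mon) (auto simp: basis_def)
      ultimately show ?thesis
        using span_add by fastforce
    next
      case False
      then show ?thesis
        using repeated_letter[OF h less.prems] low by blast
    qed
  qed
qed

lemma carrier_span_basis:
  assumes "p \<in> C"
  shows "p \<in> span_mod basis"
proof -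
  let ?W = "{w. set w \<subseteq> pos_roots n}"
  have word: "word w \<in> span_mod ?W" if "set w \<subseteq> S" for w
    using that
  proof (induction w)
    case Nil
    then show ?case using span_mon[of "[]" ?W] by (simp add: mon_Nil word_Nil)
  next
    case (Cons s w)
    obtain c where "gen s - (\<Sum>\<gamma>\<in>pos_roots n. scal (c \<gamma>) (gen (v \<gamma>))) \<in> J"
      using letters_span Cons.prems by fastforce
    then have "gen s - (\<Sum>\<gamma>\<in>pos_roots n. scal (c \<gamma>) (mon [\<gamma>])) \<in> span_mod ?W"
      by (simp add: mon_Cons mon_Nil span_base)
    moreover have "(\<Sum>\<gamma>\<in>pos_roots n. scal (c \<gamma>) (mon [\<gamma>])) \<in> span_mod ?W"
      by (intro span_sum span_scal span_mon) auto
    ultimately have "gen s \<in> span_mod ?W"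
      using span_add by fastforce
    moreover have "word w \<in> span_mod ?W" using Cons by simp
    ultimately have "gen s * word w \<in> span_mod {u @ w | u w. u \<in> ?W \<and> w \<in> ?W}"
      by (rule span_mult) auto
    then have "gen s * word w \<in> span_mod ?W"
      by (rule span_mono) auto
    then show ?case
      using word_append[of "[s]" w] by (simp add: gen_eq_word)
  qed
  have "p \<in> span_mod ?W" using assms
    by (induction p rule: free_alg_induct) (auto intro: span_zero span_add span_scal word)
  then show ?thesis
    by (rule span_trans) (auto intro: mon_span_basis)
qed

lemma span_coefficients:
  assumes "p \<in> span_mod W" "finite W"
  shows "\<exists>c. p - (\<Sum>w\<in>W. scal (c w) (mon w)) \<in> J"
  using assms(1)
proof (induction p rule: span_mod.induct)
  case (span_base p)
  then show ?case by (intro exI[of _ "\<lambda>_. 0"]) simp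
next
  case (span_step p u d)
  then obtain c where c: "p - (\<Sum>w\<in>W. scal (c w) (mon w)) \<in> J" by blast
  have "(\<Sum>w\<in>W. scal (c w + (if w = u then d else 0)) (mon w))
      = (\<Sum>w\<in>W. scal (c w) (mon w)) + (\<Sum>w\<in>W. if w = u then scal d (mon w) else 0)"
    by (simp only: scal_add_left sum.distrib) (auto intro!: sum.cong)
  also have "\<dots> = (\<Sum>w\<in>W. scal (c w) (mon w)) + scal d (mon u)"
    using assms(2) span_step(2) by (simp add: sum.delta)
  finally show ?case
    using c by (intro exI[of _ "\<lambda>w. c w + (if w = u then d else 0)"]) (simp add: algebra_simps)
qed

end


subsection \<open>Functionals concentrated in top degree\<close>

text \<open>
  A linear functional on the quotient by \<open>J\<close> that is concentrated in the degree in which the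
  square-free words contain every root once.
\<close>

locale quantum_exterior_form = quantum_exterior n q S v J
  for n :: nat and q :: complex and S :: "'v set" and v :: "nat \<times> nat \<Rightarrow> 'v" and J :: "'v falg set" +
  fixes \<phi> :: "'v falg \<Rightarrow> complex"
  assumes form_add: "p \<in> carrier (free_alg S) \<Longrightarrow> r \<in> carrier (free_alg S) \<Longrightarrow> \<phi> (p + r) = \<phi> p + \<phi> r"
    and form_scal: "p \<in> carrier (free_alg S) \<Longrightarrow> \<phi> (scal c p) = c * \<phi> p"
    and form_ideal: "p \<in> J \<Longrightarrow> \<phi> p = 0"
    and form_degree: "set w \<subseteq> S \<Longrightarrow> length w \<noteq> card (pos_roots n) \<Longrightarrow> \<phi> (word w) = 0"
    and form_nonzero: "\<exists>p\<in>carrier (free_alg S). \<phi> p \<noteq> 0"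
begin

abbreviation "N \<equiv> card (pos_roots n)"
abbreviation "top_height h \<equiv> sum h (pos_roots n)"

lemma form_zero: "\<phi> 0 = 0"
  using form_ideal[OF J_zero] .

lemma form_sum: "(\<And>a. a \<in> A \<Longrightarrow> f a \<in> C) \<Longrightarrow> \<phi> (sum f A) = (\<Sum>a\<in>A. \<phi> (f a))"
  by (induction A rule: infinite_finite_induct) (auto simp: form_zero form_add free_alg_sum_closed)

lemma form_diff: "p \<in> C \<Longrightarrow> r \<in> C \<Longrightarrow> \<phi> (p - r) = \<phi> p - \<phi> r"
  using form_add[of p "scal (-1) r"] form_scal[of r "-1"]
  by (simp add: free_alg_scal_closed scal_minus_left free_alg_uminus_closed)

lemma span_closed:
  assumes "p \<in> span_mod W" "\<And>w. w \<in> W \<Longrightarrow> set w \<subseteq> pos_roots n"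
  shows "p \<in> C"
  using assms(1)
  by (induction rule: span_mod.induct) (auto intro: free_alg_closed J_closed mon_closed[OF assms(2)])

lemma form_degree_mon: "set w \<subseteq> pos_roots n \<Longrightarrow> length w \<noteq> N \<Longrightarrow> \<phi> (mon w) = 0"
  unfolding mon_def using v_mem by (intro form_degree) auto

lemma form_span_zero:
  assumes "p \<in> span_mod W" "\<And>w. w \<in> W \<Longrightarrow> set w \<subseteq> pos_roots n" "\<And>w. w \<in> W \<Longrightarrow> \<phi> (mon w) = 0"
  shows "\<phi> p = 0"
  using assms(1)
proof (induction rule: span_mod.induct)
  case (span_base p)
  then show ?case by (rule form_ideal)
next
  case (span_step p w c)
  have "mon w \<in> C" "p \<in> C"
    using span_step assms(2) by (auto intro: mon_closed span_closed[OF _ assms(2)])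
  then show ?case
    using span_step assms(3) by (simp add: form_add form_scal free_alg_scal_closed)
qed

lemma set_eq_pos_roots: "set w \<subseteq> pos_roots n \<Longrightarrow> distinct w \<Longrightarrow> length w = N \<Longrightarrow> set w = pos_roots n"
  by (intro card_subset_eq) (auto simp: distinct_card)

text \<open>
  Induction on the height.  Words of length \<open>N\<close> and height below that of the set of all roots again
  have a repeated letter, so that straightening never leaves the range of the induction.
\<close>

lemma form_vanishes:
  assumes h: "convex_height n h"
  shows "set w \<subseteq> pos_roots n \<Longrightarrow> \<not> distinct w \<Longrightarrow> height h w \<le> top_height h \<Longrightarrow> \<phi> (mon w) = 0"
proof (induction "height h w" arbitrary: w rule: less_induct)
  case less
  show ?case
  proof (cases "length w = N")
    case False
    with less.prems show ?thesis by (intro form_degree_mon)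
  next
    case True
    have "\<phi> (mon u) = 0" if "u \<in> lower_words h (length w) (height h w)" for u
    proof -
      have u: "set u \<subseteq> pos_roots n" "length u = N" "height h u < height h w"
        using that True by (auto simp: lower_words_def)
      have "\<not> distinct u"
        using set_eq_pos_roots[OF u(1) _ u(2)] height_distinct[of u h] u(3) less.prems(3) by auto
      with less.hyps[OF u(3) u(1)] u(3) less.prems(3) show ?thesis by linarith
    qed
    then show ?thesis
      using repeated_letter[OF h less.prems(1,2)] by (rule form_span_zero[rotated 2]) (auto simp: lower_words_def)
  qed
qed

lemma form_low_zero:
  assumes h: "convex_height n h" and "p \<in> span_mod (lower_words h N t)" "t \<le> top_height h"
  shows "\<phi> p = 0"
  using assms(2)
proof (rule form_span_zero)
  fix w assume "w \<in> lower_words h N t"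
  then have w: "set w \<subseteq> pos_roots n" "length w = N" "height h w < top_height h"
    using assms(3) by (auto simp: lower_words_def)
  have "\<not> distinct w"
    using set_eq_pos_roots[OF w(1) _ w(2)] height_distinct[of w h] w(3) by auto
  then show "\<phi> (mon w) = 0"
    using w by (intro form_vanishes[OF h]) auto
qed (auto simp: lower_words_def)

text \<open>
  Otherwise the functional would vanish on all square-free words, and so everywhere.
\<close>

lemma form_top_nonzero:
  assumes "distinct w" "set w = pos_roots n"
  shows "\<phi> (mon w) \<noteq> 0"
proof
  assume zero: "\<phi> (mon w) = 0"
  obtain h where h: "convex_height n h" using convex_height_exists by blast
  have "\<phi> (mon u) = 0" if "u \<in> basis" for u
  proof (cases "set u = pos_roots n")
    case False
    have u: "distinct u" "set u \<subseteq> pos_roots n" using basis_props[OF that] by auto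
    then show ?thesis
      using set_eq_pos_roots[of u] False by (intro form_degree_mon) auto
  next
    case True
    have u: "distinct u" "set u \<subseteq> pos_roots n" using basis_props[OF that] by auto
    have "mset w = mset u" using u assms True by (metis set_eq_iff_mset_eq_distinct)
    then obtain c where c: "mon u - scal c (mon w) \<in> span_mod (lower_words h (length u) (height h u))"
      using permute[OF h, of w u] assms(2) by auto
    have "length u = N" using u True by (metis distinct_card)
    moreover have "height h u = top_height h" using u True height_distinct by metis
    ultimately have "\<phi> (mon u - scal c (mon w)) = 0"
      using form_low_zero[OF h] c by simp
    then show ?thesis
      using zero u assms by (simp add: form_diff form_scal mon_closed free_alg_scal_closed)
  qed
  then have "\<phi> p = 0" if "p \<in> C" for p
    by (intro form_span_zero[OF carrier_span_basis[OF that]]) (auto dest: basis_props)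
  then show False using form_nonzero by blast
qed

text \<open>
  If \<open>u\<close> and \<open>w\<close> have different lengths, the product of \<open>u\<close> with the complement of \<open>w\<close> has the wrong
  degree.  Otherwise it repeats a letter, as \<open>u\<close> is not contained in \<open>w\<close>, and its height is not too large.
\<close>

lemma complement_pairing:
  assumes h: "convex_height n h" and w: "w \<in> basis" and u: "u \<in> basis" "u \<noteq> w"
    and le: "height h u \<le> height h w"
  shows "\<phi> (mon (u @ std (pos_roots n - set w))) = 0" "\<phi> (mon (std (pos_roots n - set w) @ u)) = 0"
proof -
  let ?r = "std (pos_roots n - set w)"
  note wp = basis_props[OF w] and up = basis_props[OF u(1)]
  have r: "distinct ?r" "set ?r = pos_roots n - set w" using std by auto
  have "height h w + height h ?r = top_height h"
    using wp r by (simp add: height_distinct sum.subset_diff[of "set w" "pos_roots n"] add.commute)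
  then have ht: "height h (u @ ?r) \<le> top_height h" using le by simp
  have "length u = N - length ?r \<Longrightarrow> set u \<inter> set ?r \<noteq> {}"
  proof
    assume len: "length u = N - length ?r" and disj: "set u \<inter> set ?r = {}"
    have "length w = N - length ?r"
    proof -
      have "length ?r = N - length w"
        using wp r by (metis card_Diff_subset distinct_card finite_set)
      moreover have "length w \<le> N"
        using wp by (metis card_mono distinct_card finite_pos_roots)
      ultimately show ?thesis by simp
    qed
    then have "card (set u) = card (set w)"
      using len wp up by (metis distinct_card)
    moreover have "set u \<subseteq> set w" using disj up r by auto
    ultimately have "set u = set w" by (simp add: card_subset_eq)
    then show False using basis_eqI u w by blast
  qed
  then have *: "\<not> distinct (u @ ?r) \<or> length (u @ ?r) \<noteq> N"
    using distinct_append by (metis add_diff_cancel_right' length_append)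
  show "\<phi> (mon (u @ ?r)) = 0"
    using * form_degree_mon[of "u @ ?r"] form_vanishes[OF h, of "u @ ?r"] ht up r by auto
  show "\<phi> (mon (?r @ u)) = 0"
    using * form_degree_mon[of "?r @ u"] form_vanishes[OF h, of "?r @ u"] ht up r by auto
qed

lemma complement_pairing_nonzero:
  assumes w: "w \<in> basis"
  shows "\<phi> (mon (w @ std (pos_roots n - set w))) \<noteq> 0" "\<phi> (mon (std (pos_roots n - set w) @ w)) \<noteq> 0"
proof -
  have "distinct (std (pos_roots n - set w))" "set (std (pos_roots n - set w)) = pos_roots n - set w"
    using std by auto
  with basis_props[OF w] show "\<phi> (mon (w @ std (pos_roots n - set w))) \<noteq> 0"
      "\<phi> (mon (std (pos_roots n - set w) @ w)) \<noteq> 0"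
    by (intro form_top_nonzero; auto)+
qed

text \<open>
  The pairing of square-free words with complements is triangular with respect to the height, with
  nonzero diagonal entries.  So a combination of square-free words in its kernel has no term of
  maximal height.
\<close>

lemma nondegenerate_aux:
  assumes "p \<in> C"
    and zero: "\<And>c w. w \<in> basis \<Longrightarrow> (\<Sum>u\<in>basis. c u * B u w) = 0 \<or> p - (\<Sum>u\<in>basis. scal (c u) (mon u)) \<notin> J"
    and h: "convex_height n h"
    and tri: "\<And>u w. u \<in> basis \<Longrightarrow> w \<in> basis \<Longrightarrow> u \<noteq> w \<Longrightarrow> height h u \<le> height h w \<Longrightarrow> B u w = 0"
    and diag: "\<And>w. w \<in> basis \<Longrightarrow> B w w \<noteq> (0 :: complex)"
  shows "p \<in> J"
proof -
  obtain c where c: "p - (\<Sum>u\<in>basis. scal (c u) (mon u)) \<in> J"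
    using span_coefficients[OF carrier_span_basis[OF assms(1)] finite_basis] by blast
  let ?A = "{u \<in> basis. c u \<noteq> 0}"
  have "?A = {}"
  proof (rule ccontr)
    assume ne: "?A \<noteq> {}"
    have fin: "finite ?A" using finite_basis by simp
    \<comment> \<open>a word of maximal height among those with a nonzero coefficient\<close>
    define w where "w = arg_min_on (\<lambda>u. - int (height h u)) ?A"
    have w: "w \<in> ?A" "\<And>u. u \<in> ?A \<Longrightarrow> height h u \<le> height h w"
      using arg_min_if_finite(1)[OF fin ne, of "\<lambda>u. - int (height h u)"]
        arg_min_least[OF fin ne, of _ "\<lambda>u. - int (height h u)"] unfolding w_def by auto
    have "(\<Sum>u\<in>basis. c u * B u w) = (\<Sum>u\<in>basis. if u = w then c u * B u w else 0)"
      using tri w by (intro sum.cong refl) auto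
    also have "\<dots> = c w * B w w"
      using finite_basis w(1) by simp
    finally show False
      using zero[of w c] c w(1) diag[of w] by auto
  qed
  then have "(\<Sum>u\<in>basis. scal (c u) (mon u)) = 0"
    by (intro sum.neutral) auto
  with c show ?thesis by simp
qed

lemma nondegenerate_left:
  assumes "p \<in> C" and "\<And>r. r \<in> C \<Longrightarrow> \<phi> (p * r) = 0"
  shows "p \<in> J"
proof -
  obtain h where h: "convex_height n h" using convex_height_exists by blast
  let ?r = "\<lambda>w. std (pos_roots n - set w)"
  have r: "set (?r w) \<subseteq> pos_roots n" for w using std[of "pos_roots n - set w"] by auto
  show ?thesis
  proof (rule nondegenerate_aux[OF assms(1) _ h, where B = "\<lambda>u w. \<phi> (mon (u @ ?r w))"])
    fix c and w :: "(nat \<times> nat) list"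
    have mem: "mon (?r w) \<in> C" "\<And>u. u \<in> basis \<Longrightarrow> mon u \<in> C"
      using r by (auto intro!: mon_closed dest: basis_props)
    {
      let ?s = "\<Sum>u\<in>basis. scal (c u) (mon u)"
      have s: "?s \<in> C" using mem by (auto intro!: free_alg_closed)
      assume "p - ?s \<in> J"
      then have "(p - ?s) * mon (?r w) \<in> J"
        using mem by (intro J_mult_right)
      then have "\<phi> (p * mon (?r w)) - \<phi> (?s * mon (?r w)) = 0"
        using form_ideal mem s assms(1) form_diff[of "p * mon (?r w)" "?s * mon (?r w)"]
        by (simp add: left_diff_distrib free_alg_mult_closed)
      then have "\<phi> (?s * mon (?r w)) = 0" using assms(2)[OF mem(1)] by simp
      moreover have "?s * mon (?r w) = (\<Sum>u\<in>basis. scal (c u) (mon (u @ ?r w)))"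
        by (simp add: sum_distrib_right scal_mult_left mon_append)
      moreover have "\<phi> (\<Sum>u\<in>basis. scal (c u) (mon (u @ ?r w))) = (\<Sum>u\<in>basis. c u * \<phi> (mon (u @ ?r w)))"
        using mem by (subst form_sum) (auto intro!: sum.cong free_alg_closed form_scal simp: mon_append)
      ultimately have "(\<Sum>u\<in>basis. c u * \<phi> (mon (u @ ?r w))) = 0" by simp
    }
    then show "(\<Sum>u\<in>basis. c u * \<phi> (mon (u @ ?r w))) = 0 \<or> p - (\<Sum>u\<in>basis. scal (c u) (mon u)) \<notin> J"
      by blast
  qed (rule complement_pairing(1)[OF h] complement_pairing_nonzero(1); assumption)+
qed

lemma nondegenerate_right:
  assumes "p \<in> C" and "\<And>r. r \<in> C \<Longrightarrow> \<phi> (r * p) = 0"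
  shows "p \<in> J"
proof -
  obtain h where h: "convex_height n h" using convex_height_exists by blast
  let ?r = "\<lambda>w. std (pos_roots n - set w)"
  have r: "set (?r w) \<subseteq> pos_roots n" for w using std[of "pos_roots n - set w"] by auto
  show ?thesis
  proof (rule nondegenerate_aux[OF assms(1) _ h, where B = "\<lambda>u w. \<phi> (mon (?r w @ u))"])
    fix c and w :: "(nat \<times> nat) list"
    have mem: "mon (?r w) \<in> C" "\<And>u. u \<in> basis \<Longrightarrow> mon u \<in> C"
      using r by (auto intro!: mon_closed dest: basis_props)
    {
      let ?s = "\<Sum>u\<in>basis. scal (c u) (mon u)"
      have s: "?s \<in> C" using mem by (auto intro!: free_alg_closed)
      assume "p - ?s \<in> J"
      then have "mon (?r w) * (p - ?s) \<in> J"
        using mem by (intro J_mult_left)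
      then have "\<phi> (mon (?r w) * p) - \<phi> (mon (?r w) * ?s) = 0"
        using form_ideal mem s assms(1) form_diff[of "mon (?r w) * p" "mon (?r w) * ?s"]
        by (simp add: right_diff_distrib free_alg_mult_closed)
      then have "\<phi> (mon (?r w) * ?s) = 0" using assms(2)[OF mem(1)] by simp
      moreover have "mon (?r w) * ?s = (\<Sum>u\<in>basis. scal (c u) (mon (?r w @ u)))"
        by (simp add: sum_distrib_left scal_mult_right mon_append)
      moreover have "\<phi> (\<Sum>u\<in>basis. scal (c u) (mon (?r w @ u))) = (\<Sum>u\<in>basis. c u * \<phi> (mon (?r w @ u)))"
        using mem by (subst form_sum) (auto intro!: sum.cong free_alg_closed form_scal simp: mon_append)
      ultimately have "(\<Sum>u\<in>basis. c u * \<phi> (mon (?r w @ u))) = 0" by simp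
    }
    then show "(\<Sum>u\<in>basis. c u * \<phi> (mon (?r w @ u))) = 0 \<or> p - (\<Sum>u\<in>basis. scal (c u) (mon u)) \<notin> J"
      by blast
  qed (rule complement_pairing(2)[OF h] complement_pairing_nonzero(2); assumption)+
qed

lemma prod_comm_exp:
  "distinct y \<Longrightarrow> prod_list (map (\<lambda>\<beta>. - (q powi comm_exp \<gamma> \<beta>)) y)
     = (- 1) ^ length y * q powi (\<Sum>\<beta>\<in>set y. comm_exp \<gamma> \<beta>)"
  by (induction y) (simp_all add: power_int_add q_nonzero)

text \<open>
  Three cases: wrong total length, the letter \<open>\<gamma>\<close> missing from \<open>w\<close>, and a different letter \<open>\<beta>\<close>
  missing from \<open>w\<close>.  In the last case \<open>\<gamma>\<close> is repeated, and the height is chosen so that exchanging \<open>\<beta>\<close>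
  for \<open>\<gamma>\<close> does not increase it.
\<close>

lemma letter_cyclic_mon:
  assumes \<gamma>: "\<gamma> \<in> pos_roots n" and w: "distinct w" "set w \<subseteq> pos_roots n"
  shows "\<phi> (mon (\<gamma> # w)) = (- 1) ^ (N - 1) * \<phi> (mon (w @ [\<gamma>]))"
proof (cases "length (\<gamma> # w) = N")
  case False
  then show ?thesis
    using assms form_degree_mon[of "\<gamma> # w"] form_degree_mon[of "w @ [\<gamma>]"] by simp
next
  case len: True
  show ?thesis
  proof (cases "\<gamma> \<in> set w")
    case False
    obtain h where h: "convex_height n h" using convex_height_exists by blast
    have dist: "distinct (\<gamma> # w)" "set (\<gamma> # w) \<subseteq> pos_roots n" using w False \<gamma> by auto
    have set: "set (\<gamma> # w) = pos_roots n"
      using set_eq_pos_roots dist len by blast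
    have ht: "height h (\<gamma> # w) = top_height h"
      using height_distinct[OF dist(1)] by (simp only: set)
    let ?c = "prod_list (map (\<lambda>\<beta>. - (q powi comm_exp \<gamma> \<beta>)) w)"
    have "mon (\<gamma> # w) - scal ?c (mon (w @ [\<gamma>])) \<in> span_mod (lower_words h (length (\<gamma> # w)) (height h (\<gamma> # w)))"
      using \<gamma> w False by (intro move_to_end h)
    then have "\<phi> (mon (\<gamma> # w) - scal ?c (mon (w @ [\<gamma>]))) = 0"
      unfolding len ht by (rule form_low_zero[OF h]) simp
    then have 1: "\<phi> (mon (\<gamma> # w)) = ?c * \<phi> (mon (w @ [\<gamma>]))"
      using \<gamma> w by (simp add: form_diff form_scal free_alg_scal_closed mon_closed)
    have "(\<Sum>\<beta>\<in>set w. comm_exp \<gamma> \<beta>) = (\<Sum>\<beta>\<in>set (\<gamma> # w). comm_exp \<gamma> \<beta>)"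
      using False comm_exp_self[OF \<gamma>] by simp
    also have "\<dots> = 0" unfolding set by (rule sum_comm_exp[OF \<gamma>])
    finally have "?c = (- 1) ^ (N - 1)"
      using len w by (simp add: prod_comm_exp flip: len)
    with 1 show ?thesis by simp
  next
    case True
    have "set w \<noteq> pos_roots n" using w len by (metis distinct_card length_Cons n_not_Suc_n)
    then obtain \<beta> where \<beta>: "\<beta> \<in> pos_roots n" "\<beta> \<notin> set w" using w by blast
    then obtain h where h: "convex_height n h" "h \<gamma> \<le> h \<beta>"
      using convex_height_separating[OF \<beta>(1) \<gamma>] True by metis
    have dist: "distinct (\<beta> # w)" using \<beta> w by simp
    have set: "set (\<beta> # w) = pos_roots n"
      using \<beta> w len by (intro set_eq_pos_roots dist) auto
    have "height h (\<beta> # w) = top_height h"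
      unfolding height_distinct[OF dist] set ..
    then have ht: "height h (\<gamma> # w) \<le> top_height h" using h(2) by simp
    have "\<phi> (mon (\<gamma> # w)) = 0" "\<phi> (mon (w @ [\<gamma>])) = 0"
      using \<gamma> w True ht by (auto intro!: form_vanishes[OF h(1)])
    then show ?thesis by simp
  qed
qed

lemma letter_cyclic:
  assumes \<gamma>: "\<gamma> \<in> pos_roots n" and "r \<in> C"
  shows "\<phi> (gen (v \<gamma>) * r) = (- 1) ^ (N - 1) * \<phi> (r * gen (v \<gamma>))"
  using carrier_span_basis[OF assms(2)]
proof (induction rule: span_mod.induct)
  case (span_base p)
  have "gen (v \<gamma>) \<in> C" using v_mem[OF \<gamma>] by simp
  then show ?case
    using span_base by (simp add: form_ideal J_mult_left J_mult_right)
next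
  case (span_step p w c)
  have g: "gen (v \<gamma>) \<in> C" using v_mem[OF \<gamma>] by simp
  have w: "mon w \<in> C" "distinct w" "set w \<subseteq> pos_roots n"
    using basis_props[OF span_step(2)] by (auto intro: mon_closed)
  have p: "p \<in> C" using span_step(1) by (rule span_closed) (auto dest: basis_props)
  have "mon (w @ [\<gamma>]) = mon w * gen (v \<gamma>)"
    by (simp add: mon_append mon_Cons mon_Nil)
  then show ?case
    using span_step(3) g w p letter_cyclic_mon[OF \<gamma> w(2,3)]
    by (simp add: distrib_left distrib_right scal_mult_left scal_mult_right form_add form_scal
        free_alg_closed mon_Cons)
qed

end


section \<open>Matrix coefficients of representations of $U_q(\mathfrak{sl}_{n+1})$\<close>

subsection \<open>Linear extension of functions on words\<close>

definition lin_ext :: "('g list \<Rightarrow> complex) \<Rightarrow> 'g falg \<Rightarrow> complex" where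
  "lin_ext f p = (\<Sum>w\<in>Poly_Mapping.keys p. Poly_Mapping.lookup p w * f (letters w))"

lemma lin_ext_superset:
  "finite A \<Longrightarrow> Poly_Mapping.keys p \<subseteq> A \<Longrightarrow> lin_ext f p = (\<Sum>w\<in>A. Poly_Mapping.lookup p w * f (letters w))"
  unfolding lin_ext_def by (rule sum.mono_neutral_left) (auto simp: in_keys_iff)

lemma lin_ext_zero [simp]: "lin_ext f 0 = 0"
  by (simp add: lin_ext_def)

lemma lin_ext_add: "lin_ext f (p + r) = lin_ext f p + lin_ext f r"
proof -
  let ?A = "Poly_Mapping.keys p \<union> Poly_Mapping.keys r"
  have "lin_ext f s = (\<Sum>w\<in>?A. Poly_Mapping.lookup s w * f (letters w))"
    if "s \<in> {p, r, p + r}" for s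
    using that keys_add[of p r] by (intro lin_ext_superset) auto
  then show ?thesis
    by (simp add: lookup_add distrib_right sum.distrib)
qed

lemma lin_ext_scal_word: "lin_ext f (scal c (word w)) = c * f w"
  by (simp add: scal_word lin_ext_def)

lemma lin_ext_word: "lin_ext f (word w) = f w"
  using lin_ext_scal_word[of f 1 w] by simp

lemma lin_ext_scal: "lin_ext f (scal c p) = c * lin_ext f p"
  by (induction p rule: falg_induct)
    (simp_all add: scal_add_right lin_ext_add scal_scal lin_ext_scal_word distrib_left)

lemma lin_ext_uminus: "lin_ext f (- p) = - lin_ext f p"
  using lin_ext_scal[of f "-1" p] by (simp add: scal_minus_left)

lemma lin_ext_diff: "lin_ext f (p - r) = lin_ext f p - lin_ext f r"
  using lin_ext_add[of f p "- r"] by (simp add: lin_ext_uminus)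

lemma lin_ext_sum: "lin_ext f (sum g A) = (\<Sum>a\<in>A. lin_ext f (g a))"
  by (induction A rule: infinite_finite_induct) (simp_all add: lin_ext_add)

subsection \<open>The algebra $U_q(\mathfrak{sl}_{n+1})$\<close>

lemma uq_gens_simps [simp]:
  "Egen i \<in> uq_gens n \<longleftrightarrow> i \<in> {1..n}" "Fgen i \<in> uq_gens n \<longleftrightarrow> i \<in> {1..n}"
  "Kgen i \<in> uq_gens n \<longleftrightarrow> i \<in> {1..n}" "Kinv i \<in> uq_gens n \<longleftrightarrow> i \<in> {1..n}"
  by (auto simp: uq_gens_def)

lemma uq_rels_cases:
  assumes "r \<in> uq_rels n q"
  obtains i where "i \<in> {1..n}" "r = gen (Kgen i) * gen (Kinv i) - 1"
  | i where "i \<in> {1..n}" "r = gen (Kinv i) * gen (Kgen i) - 1"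
  | i j where "i \<in> {1..n}" "j \<in> {1..n}" "r = gen (Kgen i) * gen (Kgen j) - gen (Kgen j) * gen (Kgen i)"
  | i j where "i \<in> {1..n}" "j \<in> {1..n}"
      "r = gen (Kgen i) * gen (Egen j) - scal (of_real q powi cartan i j) (gen (Egen j) * gen (Kgen i))"
  | i j where "i \<in> {1..n}" "j \<in> {1..n}"
      "r = gen (Kgen i) * gen (Fgen j) - scal (of_real q powi (- cartan i j)) (gen (Fgen j) * gen (Kgen i))"
  | i j where "i \<in> {1..n}" "j \<in> {1..n}" "r = gen (Egen i) * gen (Fgen j) - gen (Fgen j) * gen (Egen i)
      - (if i = j then scal (of_real (1 / (q - 1 / q))) (gen (Kgen i) - gen (Kinv i)) else 0)"
  | i j where "i \<in> {1..n}" "j \<in> {1..n}" "i \<noteq> j" "r = serre q Egen i j"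
  | i j where "i \<in> {1..n}" "j \<in> {1..n}" "i \<noteq> j" "r = serre q Fgen i j"
  using assms unfolding uq_rels_def
proof (elim UN_E UnE, goal_cases)
  case (1 i)
  then have "i \<in> {1..n}" by blast
  with 1 show ?case
    by (elim insertE emptyE that(1,2))
next
  case (2 i j)
  then have ij: "i \<in> {1..n}" "j \<in> {1..n}" by blast+
  from 2 show ?case
    by (elim insertE emptyE that(3-6)[OF ij])
next
  case (3 i j)
  then have ij: "i \<in> {1..n}" "j \<in> {1..n}" by blast+
  moreover have "i \<noteq> j" using 3 by (metis empty_iff)
  ultimately have ij: "i \<in> {1..n}" "j \<in> {1..n}" "i \<noteq> j" by blast+
  with 3 have "r \<in> {serre q Egen i j, serre q Fgen i j}" by simp
  then show ?case
    by (elim insertE emptyE that(7,8)[OF ij])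
qed

lemma uq_rels_closed: "uq_rels n q \<subseteq> carrier (free_alg (uq_gens n))"
proof
  fix r assume "r \<in> uq_rels n q"
  then show "r \<in> carrier (free_alg (uq_gens n))"
    by (cases rule: uq_rels_cases) (auto simp: serre_def Let_def intro!: free_alg_closed)
qed

lemma quotient_algebra_uq: "quotient_algebra (free_alg (uq_gens n)) (uq_ideal n q)"
proof -
  interpret complex_algebra "free_alg (uq_gens n)" by (rule complex_algebra_free_alg)
  show ?thesis
    unfolding quotient_algebra_def uq_ideal_def
    using complex_algebra_free_alg genideal_ideal[OF uq_rels_closed] by blast
qed

lemmas uq_cls_mult = quotient_algebra.cls_mult[OF quotient_algebra_uq, folded uq_cls_def Uq_def]
  and uq_cls_add = quotient_algebra.cls_add[OF quotient_algebra_uq, folded uq_cls_def Uq_def]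
  and uq_cls_smult = quotient_algebra.cls_smult[OF quotient_algebra_uq, folded uq_cls_def Uq_def]

lemma Uq_carrier: "carrier (Uq n q) = uq_cls n q ` carrier (free_alg (uq_gens n))"
  unfolding Uq_def quot_alg_simps by (simp add: uq_cls_def)

lemma Uq_one: "\<one>\<^bsub>Uq n q\<^esub> = uq_cls n q 1"
  unfolding Uq_def quot_alg_simps by (simp add: uq_cls_def)

text \<open>
  A linear functional that vanishes on the ideal is constant on cosets, so that the image of a
  coset under it is a singleton.
\<close>

lemma uq_functional_cls:
  assumes "\<And>r. r \<in> uq_ideal n q \<Longrightarrow> lin_ext f r = 0" and "p \<in> carrier (free_alg (uq_gens n))"
  shows "uq_functional n q f (uq_cls n q p) = lin_ext f p"
proof -
  have "lin_ext f ` uq_cls n q p = {lin_ext f p}"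
    using assms(1) quotient_algebra.cls_self[OF quotient_algebra_uq assms(2)]
    by (auto simp: uq_cls_def a_r_coset_def r_coset_def lin_ext_add image_iff)
  then show ?thesis
    using assms(2) by (simp add: uq_functional_def Uq_carrier lin_ext_def)
qed

lemma uq_functional_outside: "X \<notin> carrier (Uq n q) \<Longrightarrow> uq_functional n q f X = 0"
  by (simp add: uq_functional_def)

subsection \<open>Actions on functions\<close>

definition delta :: "'j \<Rightarrow> 'j \<Rightarrow> complex" where
  "delta b a = of_bool (a = b)"

text \<open>
  Representations are described as actions on functions \<open>\<psi>\<close>, given by explicit formulas for each
  generator.  The value \<open>\<psi> a\<close> is the coordinate at \<open>a\<close>, and the entry of a matrix in row \<open>a\<close> and
  column \<open>b\<close> is obtained by applying the action to \<open>delta b\<close> and evaluating at \<open>a\<close>.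
\<close>

definition poly_act :: "('g \<Rightarrow> ('j \<Rightarrow> complex) \<Rightarrow> 'j \<Rightarrow> complex) \<Rightarrow> 'g falg \<Rightarrow> ('j \<Rightarrow> complex) \<Rightarrow> 'j \<Rightarrow> complex" where
  "poly_act act p \<psi> a = lin_ext (\<lambda>w. foldr act w \<psi> a) p"

locale linear_action =
  fixes act :: "'g \<Rightarrow> ('j \<Rightarrow> complex) \<Rightarrow> 'j \<Rightarrow> complex"
  assumes act_add: "act g (\<lambda>a. \<psi> a + \<chi> a) = (\<lambda>a. act g \<psi> a + act g \<chi> a)"
    and act_scal: "act g (\<lambda>a. c * \<psi> a) = (\<lambda>a. c * act g \<psi> a)"
begin

lemma poly_act_simps [simp]:
  "poly_act act 0 \<psi> a = 0"
  "poly_act act 1 \<psi> a = \<psi> a"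
  "poly_act act (gen g) \<psi> a = act g \<psi> a"
  "poly_act act (p + r) \<psi> a = poly_act act p \<psi> a + poly_act act r \<psi> a"
  "poly_act act (p - r) \<psi> a = poly_act act p \<psi> a - poly_act act r \<psi> a"
  "poly_act act (- p) \<psi> a = - poly_act act p \<psi> a"
  "poly_act act (scal c p) \<psi> a = c * poly_act act p \<psi> a"
  "poly_act act (word w) \<psi> a = foldr act w \<psi> a"
  "poly_act act (sum h A) \<psi> a = (\<Sum>x\<in>A. poly_act act (h x) \<psi> a)"
  by (simp_all add: poly_act_def lin_ext_add lin_ext_scal lin_ext_diff lin_ext_uminus lin_ext_word
      gen_eq_word lin_ext_sum flip: word_Nil)

lemma foldr_act_add: "foldr act w (\<lambda>a. \<psi> a + \<chi> a) = (\<lambda>a. foldr act w \<psi> a + foldr act w \<chi> a)"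
  by (induction w) (simp_all add: act_add)

lemma foldr_act_scal: "foldr act w (\<lambda>a. c * \<psi> a) = (\<lambda>a. c * foldr act w \<psi> a)"
  by (induction w) (simp_all add: act_scal)

lemma poly_act_add: "poly_act act p (\<lambda>a. \<psi> a + \<chi> a) = (\<lambda>a. poly_act act p \<psi> a + poly_act act p \<chi> a)"
  by (rule ext) (simp add: poly_act_def foldr_act_add lin_ext_def distrib_left sum.distrib)

lemma poly_act_scal: "poly_act act p (\<lambda>a. c * \<psi> a) = (\<lambda>a. c * poly_act act p \<psi> a)"
  by (rule ext) (simp add: poly_act_def foldr_act_scal lin_ext_def sum_distrib_left mult.left_commute)

lemma poly_act_zero: "poly_act act p (\<lambda>a. 0) = (\<lambda>a. 0)"
  using poly_act_scal[of p 0 "\<lambda>_. 0"] by simp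

lemma poly_act_sum: "poly_act act p (\<lambda>a. \<Sum>x\<in>A. f x a) = (\<lambda>a. \<Sum>x\<in>A. poly_act act p (f x) a)"
  by (induction A rule: infinite_finite_induct) (simp_all add: poly_act_zero poly_act_add)

lemma poly_act_mult [simp]: "poly_act act (p * r) \<psi> a = poly_act act p (poly_act act r \<psi>) a"
proof (induction p rule: falg_induct)
  case (add p c w)
  have "poly_act act (word w * r) \<psi> a = foldr act w (poly_act act r \<psi>) a"
  proof (induction r rule: falg_induct)
    case zero
    have "foldr act w (\<lambda>a. 0) = (\<lambda>a. 0)" using foldr_act_scal[of w 0 "\<lambda>_. 0"] by simp
    then show ?case by (simp add: poly_act_simps(1)[abs_def] fun_eq_iff)
  next
    case (add r d u)
    have "poly_act act (r + scal d (word u)) \<psi> = (\<lambda>a. poly_act act r \<psi> a + d * foldr act u \<psi> a)"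
      by (rule ext) simp
    then show ?case using add
      by (simp add: distrib_left scal_mult_right foldr_act_add foldr_act_scal
          word_append[symmetric])
  qed
  with add show ?case
    by (simp add: distrib_right scal_mult_left)
qed simp

lemma poly_act_comp:
  "poly_act act (p * r) \<psi> = poly_act act p (poly_act act r \<psi>)" "poly_act act (gen g) \<psi> = act g \<psi>"
  by (rule ext, simp)+

end

text \<open>
  The vector space is spanned by \<open>X\<close>, but functions are defined on the whole type; the generators
  preserve the functions supported in \<open>X\<close>.
\<close>

locale uq_action = linear_action act
  for n :: nat and q :: real and X :: "'j set" and act :: "uq_gen \<Rightarrow> ('j \<Rightarrow> complex) \<Rightarrow> 'j \<Rightarrow> complex" +
  fixes wt :: "nat \<Rightarrow> 'j \<Rightarrow> int"
  assumes finite_X: "finite X"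
    and act_support: "g \<in> uq_gens n \<Longrightarrow> (\<And>a. a \<notin> X \<Longrightarrow> \<psi> a = 0) \<Longrightarrow> a \<notin> X \<Longrightarrow> act g \<psi> a = 0"
    and act_rels: "r \<in> uq_rels n q \<Longrightarrow> poly_act act r \<psi> a = 0"
    and act_K: "i \<in> {1..n} \<Longrightarrow> act (Kgen i) \<psi> a = of_real q powi wt i a * \<psi> a"
begin

definition coeff :: "'j \<Rightarrow> 'j \<Rightarrow> uq_functional" where
  "coeff a b = uq_functional n q (\<lambda>w. foldr act w (delta b) a)"

lemma act_ideal:
  assumes "r \<in> uq_ideal n q"
  shows "poly_act act r \<psi> a = 0"
proof -
  let ?F = "free_alg (uq_gens n)"
  interpret F: complex_algebra ?F by (rule complex_algebra_free_alg)
  let ?I = "{p \<in> carrier ?F. \<forall>\<psi>. poly_act act p \<psi> = (\<lambda>a. 0)}"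
  have "ideal ?I ?F"
  proof (rule idealI)
    show "subgroup ?I (add_monoid ?F)"
    proof (rule subgroup.intro)
      fix x assume x: "x \<in> ?I"
      have "inv\<^bsub>add_monoid ?F\<^esub> x = \<ominus>\<^bsub>?F\<^esub> x" by (simp add: a_inv_def)
      also have "\<dots> = - x"
        using x free_alg_a_minus[of 0 "uq_gens n" x] by (simp add: a_minus_def)
      finally show "inv\<^bsub>add_monoid ?F\<^esub> x \<in> ?I"
        using x by (auto simp: free_alg_closed fun_eq_iff)
    qed (auto simp: free_alg_closed fun_eq_iff)
  next
    fix p x assume "p \<in> ?I" "x \<in> carrier ?F"
    then show "x \<otimes>\<^bsub>?F\<^esub> p \<in> ?I" "p \<otimes>\<^bsub>?F\<^esub> x \<in> ?I"
      by (auto simp: free_alg_closed poly_act_zero intro!: ext)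
  qed (rule F.ring_axioms)
  moreover have "uq_rels n q \<subseteq> ?I"
    using uq_rels_closed act_rels by (auto simp: fun_eq_iff)
  ultimately have "uq_ideal n q \<subseteq> ?I"
    unfolding uq_ideal_def by (rule F.genideal_minimal)
  then show ?thesis using assms by auto
qed

lemma coeff_cls:
  assumes "p \<in> carrier (free_alg (uq_gens n))"
  shows "coeff a b (uq_cls n q p) = poly_act act p (delta b) a"
  unfolding coeff_def poly_act_def
  by (rule uq_functional_cls[OF _ assms]) (use act_ideal in \<open>simp add: poly_act_def\<close>)

lemma poly_act_support:
  assumes "p \<in> carrier (free_alg (uq_gens n))" "\<And>a. a \<notin> X \<Longrightarrow> \<psi> a = 0" "a \<notin> X"
  shows "poly_act act p \<psi> a = 0"
proof -
  have word: "foldr act w \<psi> a = 0" if "set w \<subseteq> uq_gens n" "a \<notin> X" for w a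
    using that
  proof (induction w arbitrary: a)
    case (Cons g w)
    then show ?case using act_support[of g "foldr act w \<psi>" a] by auto
  qed (simp add: assms)
  from assms(1) show ?thesis
    by (induction rule: free_alg_induct) (auto simp: word assms)
qed

lemma poly_act_delta_expansion:
  assumes "\<And>a. a \<notin> X \<Longrightarrow> \<psi> a = 0"
  shows "poly_act act p \<psi> a = (\<Sum>c\<in>X. poly_act act p (delta c) a * \<psi> c)"
proof -
  have "\<psi> = (\<lambda>a. \<Sum>c\<in>X. \<psi> c * delta c a)"
  proof
    fix a
    have "(\<Sum>c\<in>X. \<psi> c * delta c a) = (\<Sum>c\<in>X. if c = a then \<psi> c else 0)"
      by (intro sum.cong) (auto simp: delta_def)
    then show "\<psi> a = (\<Sum>c\<in>X. \<psi> c * delta c a)"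
      using assms finite_X by simp
  qed
  then have "poly_act act p \<psi> a = poly_act act p (\<lambda>a. \<Sum>c\<in>X. \<psi> c * delta c a) a" by simp
  then show ?thesis
    by (simp add: poly_act_sum poly_act_scal mult.commute)
qed

text \<open>
  Dual to the product of matrices: the coproduct of a matrix coefficient.
\<close>

lemma coeff_mult:
  assumes "b \<in> X" "P \<in> carrier (Uq n q)" "Q \<in> carrier (Uq n q)"
  shows "coeff a b (P \<otimes>\<^bsub>Uq n q\<^esub> Q) = (\<Sum>c\<in>X. coeff a c P * coeff c b Q)"
proof -
  obtain p r where pr: "p \<in> carrier (free_alg (uq_gens n))" "r \<in> carrier (free_alg (uq_gens n))"
      "P = uq_cls n q p" "Q = uq_cls n q r"
    using assms by (auto simp: Uq_carrier)
  have "\<And>a. a \<notin> X \<Longrightarrow> poly_act act r (delta b) a = 0"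
    using pr assms(1) by (intro poly_act_support) (auto simp: delta_def)
  from poly_act_delta_expansion[OF this, where p = p and a = a] show ?thesis
    using pr by (simp add: uq_cls_mult coeff_cls free_alg_closed)
qed

text \<open>
  Enumerating \<open>X\<close> turns the action into a representation by matrices, in which the \<open>K\<^sub>i\<close> are
  already diagonal.
\<close>

lemma coeff_matrix_coeffs:
  assumes a: "a \<in> X" and b: "b \<in> X"
  shows "coeff a b \<in> matrix_coeffs n q"
proof -
  define d where "d = card X"
  obtain h where h: "bij_betw h {..<d} X"
    using ex_bij_betw_nat_finite[OF finite_X] by (auto simp: d_def atLeast0LessThan)
  then have hX: "h k \<in> X" if "k < d" for k
    using that by (auto simp: bij_betw_def)
  have inj: "h k = h l \<longleftrightarrow> k = l" if "k < d" "l < d" for k l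
    using h that by (auto simp: bij_betw_def inj_on_def)
  define \<rho> where "\<rho> P = mat d d (\<lambda>(k, l). coeff (h k) (h l) P)" for P
  have "\<rho> \<in> Ring.ring_hom (Uq n q) (ring_mat TYPE(complex) d ())"
  proof (rule ring_hom_memI)
    fix P assume "P \<in> carrier (Uq n q)"
    then show "\<rho> P \<in> carrier (ring_mat TYPE(complex) d ())"
      by (simp add: \<rho>_def ring_mat_simps)
  next
    fix P Q assume PQ: "P \<in> carrier (Uq n q)" "Q \<in> carrier (Uq n q)"
    show "\<rho> (P \<otimes>\<^bsub>Uq n q\<^esub> Q) = \<rho> P \<otimes>\<^bsub>ring_mat TYPE(complex) d ()\<^esub> \<rho> Q"
      unfolding ring_mat_simps
    proof (rule eq_matI)
      fix k l assume "k < dim_row (\<rho> P * \<rho> Q)" "l < dim_col (\<rho> P * \<rho> Q)"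
      then have kl: "k < d" "l < d" by (auto simp: \<rho>_def)
      have "(\<Sum>c\<in>X. coeff (h k) c P * coeff c (h l) Q)
          = (\<Sum>m<d. coeff (h k) (h m) P * coeff (h m) (h l) Q)"
        using sum.reindex_bij_betw[OF h, of "\<lambda>c. coeff (h k) c P * coeff c (h l) Q"] by simp
      then show "\<rho> (P \<otimes>\<^bsub>Uq n q\<^esub> Q) $$ (k, l) = (\<rho> P * \<rho> Q) $$ (k, l)"
        using kl PQ hX by (simp add: \<rho>_def coeff_mult scalar_prod_def atLeast0LessThan)
    qed (auto simp: \<rho>_def)
    obtain p r where pr: "p \<in> carrier (free_alg (uq_gens n))" "r \<in> carrier (free_alg (uq_gens n))"
        "P = uq_cls n q p" "Q = uq_cls n q r"
      using PQ by (auto simp: Uq_carrier)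
    show "\<rho> (P \<oplus>\<^bsub>Uq n q\<^esub> Q) = \<rho> P \<oplus>\<^bsub>ring_mat TYPE(complex) d ()\<^esub> \<rho> Q"
      unfolding ring_mat_simps
      by (rule eq_matI) (use pr in \<open>auto simp: \<rho>_def uq_cls_add coeff_cls free_alg_closed\<close>)
  next
    show "\<rho> \<one>\<^bsub>Uq n q\<^esub> = \<one>\<^bsub>ring_mat TYPE(complex) d ()\<^esub>"
      unfolding ring_mat_simps
      by (rule eq_matI) (auto simp: \<rho>_def Uq_one coeff_cls delta_def inj)
  qed
  moreover have "\<rho> (c \<odot>\<^bsub>Uq n q\<^esub> P) = c \<cdot>\<^sub>m \<rho> P" if "P \<in> carrier (Uq n q)" for c P
  proof -
    obtain p where "p \<in> carrier (free_alg (uq_gens n))" "P = uq_cls n q p"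
      using \<open>P \<in> carrier (Uq n q)\<close> by (auto simp: Uq_carrier)
    then show ?thesis
      by (intro eq_matI) (auto simp: \<rho>_def uq_cls_smult coeff_cls free_alg_closed)
  qed
  moreover have "similar_mat_wit (\<rho> (uq_cls n q (gen (Kgen i)))) (\<rho> (uq_cls n q (gen (Kgen i)))) (1\<^sub>m d) (1\<^sub>m d)
      \<and> diagonal_mat (\<rho> (uq_cls n q (gen (Kgen i))))
      \<and> (\<forall>k<d. \<exists>m::int. \<rho> (uq_cls n q (gen (Kgen i))) $$ (k, k) = of_real q powi m)"
    if i: "i \<in> {1..n}" for i
  proof -
    have "coeff (h k) (h l) (uq_cls n q (gen (Kgen i))) = of_real q powi wt i (h k) * delta (h l) (h k)" for k l
      using i by (simp add: coeff_cls act_K)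
    then show ?thesis
      by (auto simp: similar_mat_wit_def Let_def diagonal_mat_def \<rho>_def delta_def inj)
  qed
  ultimately have rep: "type1_rep n q d \<rho>"
    unfolding type1_rep_def
    by (intro conjI exI[of _ "1\<^sub>m d"] exI[of _ "\<lambda>i. \<rho> (uq_cls n q (gen (Kgen i)))"]) blast+
  obtain k l where kl: "k < d" "l < d" "h k = a" "h l = b"
    using h a b by (auto simp: bij_betw_def)
  have "coeff a b = (\<lambda>P. if P \<in> carrier (Uq n q) then \<rho> P $$ (k, l) else 0)"
    using kl by (auto simp: \<rho>_def fun_eq_iff coeff_def uq_functional_outside)
  then show ?thesis
    unfolding matrix_coeffs_def using rep kl by blast
qed

lemma coeff_Oq: "a \<in> X \<Longrightarrow> b \<in> X \<Longrightarrow> coeff a b \<in> Oq n q"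
  unfolding Oq_def
  by (rule CollectI, rule exI[of _ 1], rule exI[of _ "\<lambda>_. 1"], rule exI[of _ "\<lambda>_. coeff a b"])
    (simp add: coeff_matrix_coeffs)

end


section \<open>The vector representation and its tensor square\<close>

definition wt :: "nat \<Rightarrow> nat \<Rightarrow> int" where
  "wt i a = of_bool (i + 1 = a) - of_bool (i = a)"

lemma powi_wt: "x powi wt i a = (if a = Suc i then x else if a = i then inverse x else (1 :: complex))"
  by (simp add: wt_def)

lemma powi_minus_wt: "x powi (- wt i a) = (if a = Suc i then inverse x else if a = i then x else (1 :: complex))"
  by (simp add: wt_def)

fun act_triv :: "uq_gen \<Rightarrow> (unit \<Rightarrow> complex) \<Rightarrow> unit \<Rightarrow> complex" where
  "act_triv g \<psi> a = counit_gen g * \<psi> a"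

fun act_vec :: "real \<Rightarrow> uq_gen \<Rightarrow> (nat \<Rightarrow> complex) \<Rightarrow> nat \<Rightarrow> complex" where
  "act_vec q (Egen i) \<psi> a = (if a = Suc i then \<psi> i else 0)"
| "act_vec q (Fgen i) \<psi> a = (if a = i then \<psi> (Suc i) else 0)"
| "act_vec q (Kgen i) \<psi> a = of_real q powi wt i a * \<psi> a"
| "act_vec q (Kinv i) \<psi> a = of_real q powi (- wt i a) * \<psi> a"

text \<open>
  The action on the tensor square of the vector representation through the coproduct
  $\Delta(E_i) = E_i \otimes K_i + 1 \otimes E_i$, $\Delta(F_i) = F_i \otimes 1 + K_i^{-1} \otimes F_i$.
\<close>

fun act_sq :: "real \<Rightarrow> uq_gen \<Rightarrow> (nat \<times> nat \<Rightarrow> complex) \<Rightarrow> nat \<times> nat \<Rightarrow> complex" where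
  "act_sq q (Egen i) \<psi> (a, b) =
     (if a = Suc i then of_real q powi wt i b * \<psi> (i, b) else 0) + (if b = Suc i then \<psi> (a, i) else 0)"
| "act_sq q (Fgen i) \<psi> (a, b) =
     (if a = i then \<psi> (Suc i, b) else 0) + (if b = i then of_real q powi (- wt i a) * \<psi> (a, Suc i) else 0)"
| "act_sq q (Kgen i) \<psi> (a, b) = of_real q powi wt i a * of_real q powi wt i b * \<psi> (a, b)"
| "act_sq q (Kinv i) \<psi> (a, b) = of_real q powi (- wt i a) * of_real q powi (- wt i b) * \<psi> (a, b)"

lemma q_minus_inverse_nonzero:
  assumes "q \<noteq> 0" "q \<noteq> 1" "q \<noteq> - 1"
  shows "complex_of_real q - 1 / complex_of_real q \<noteq> 0"
proof
  assume "complex_of_real q - 1 / complex_of_real q = 0"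
  then have "complex_of_real (q * q) = complex_of_real 1"
    using assms by (simp add: field_simps)
  then have "q * q = 1" by (simp only: of_real_eq_iff)
  then show False using assms by (metis power2_eq_1_iff power2_eq_square)
qed

lemma uq_action_triv: "uq_action n q UNIV act_triv (\<lambda>_ _. 0)"
proof -
  interpret linear_action act_triv
    by unfold_locales (simp_all add: fun_eq_iff distrib_left mult.left_commute)
  show ?thesis
  proof unfold_locales
    fix r \<psi> a assume "r \<in> uq_rels n q"
    then show "poly_act act_triv r \<psi> a = 0"
      by (cases rule: uq_rels_cases) (auto simp: serre_def Let_def)
  qed simp_all
qed

lemma uq_action_vec:
  assumes "q \<noteq> 0" "q \<noteq> 1" "q \<noteq> - 1"
  shows "uq_action n q {1..n+1} (act_vec q) wt"
proof -
  interpret linear_action "act_vec q"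
  proof
    fix g \<psi> \<chi> show "act_vec q g (\<lambda>a. \<psi> a + \<chi> a) = (\<lambda>a. act_vec q g \<psi> a + act_vec q g \<chi> a)"
      by (cases g) (auto simp: distrib_left)
  next
    fix g \<psi> c show "act_vec q g (\<lambda>a. c * \<psi> a) = (\<lambda>a. c * act_vec q g \<psi> a)"
      by (cases g) auto
  qed
  note q = q_minus_inverse_nonzero[OF assms]
  show ?thesis
  proof unfold_locales
    fix r \<psi> a assume "r \<in> uq_rels n q"
    then show "poly_act (act_vec q) r \<psi> a = 0"
    proof (cases rule: uq_rels_cases)
      case (4 i j)
      show ?thesis
        using 4(1-2) assms unfolding 4(3) by (auto simp: powi_wt cartan_def power2_eq_square power_int_minus)
    next
      case (5 i j)
      show ?thesis
        using 5(1-2) assms unfolding 5(3) by (auto simp: powi_wt cartan_def power2_eq_square power_int_minus)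
    next
      case (6 i j)
      show ?thesis
        using 6(1-2) assms q unfolding 6(3) by (auto simp: powi_wt powi_minus_wt divide_simps) (auto simp: algebra_simps)
    qed (use assms in \<open>auto simp: serre_def Let_def powi_wt powi_minus_wt\<close>)
  next
    fix g and \<psi> :: "nat \<Rightarrow> complex" and a :: nat
    assume "g \<in> uq_gens n" "\<And>a. a \<notin> {1..n+1} \<Longrightarrow> \<psi> a = 0" "a \<notin> {1..n+1}"
    then show "act_vec q g \<psi> a = 0" by (cases g) auto
  qed simp_all
qed

text \<open>
  In the vector representation $E_i^2 = 0$, so that only $E_i \otimes E_i$ survives in the square.  This
  keeps the verification of the Serre relations short.
\<close>

lemma act_sq_E_twice:
  "q \<noteq> 0 \<Longrightarrow> act_sq q (Egen i) (act_sq q (Egen i) \<psi>) (a, b)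
    = (if a = Suc i \<and> b = Suc i then (of_real q + inverse (of_real q)) * \<psi> (i, i) else 0)"
  by (auto simp: powi_wt algebra_simps)

lemma act_sq_F_twice:
  "q \<noteq> 0 \<Longrightarrow> act_sq q (Fgen i) (act_sq q (Fgen i) \<psi>) (a, b)
    = (if a = i \<and> b = i then (of_real q + inverse (of_real q)) * \<psi> (Suc i, Suc i) else 0)"
  by (auto simp: powi_minus_wt algebra_simps)

lemma act_sq_serre_E:
  assumes "q \<noteq> 0" "j = Suc i \<or> i = Suc j"
  shows "act_sq q (Egen i) (act_sq q (Egen i) (act_sq q (Egen j) \<psi>)) (a, b)
      + act_sq q (Egen j) (act_sq q (Egen i) (act_sq q (Egen i) \<psi>)) (a, b)
    = (of_real q + inverse (of_real q)) * act_sq q (Egen i) (act_sq q (Egen j) (act_sq q (Egen i) \<psi>)) (a, b)"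
  using assms(2)
proof (elim disjE; hypsubst)
  show "act_sq q (Egen i) (act_sq q (Egen i) (act_sq q (Egen (Suc i)) \<psi>)) (a, b)
      + act_sq q (Egen (Suc i)) (act_sq q (Egen i) (act_sq q (Egen i) \<psi>)) (a, b)
    = (of_real q + inverse (of_real q)) * act_sq q (Egen i) (act_sq q (Egen (Suc i)) (act_sq q (Egen i) \<psi>)) (a, b)"
    unfolding act_sq_E_twice[OF assms(1)]
    by (cases "a = Suc i"; cases "b = Suc i"; cases "a = Suc (Suc i)"; cases "b = Suc (Suc i)")
      (simp_all add: powi_wt assms algebra_simps)
  show "act_sq q (Egen (Suc j)) (act_sq q (Egen (Suc j)) (act_sq q (Egen j) \<psi>)) (a, b)
      + act_sq q (Egen j) (act_sq q (Egen (Suc j)) (act_sq q (Egen (Suc j)) \<psi>)) (a, b)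
    = (of_real q + inverse (of_real q)) * act_sq q (Egen (Suc j)) (act_sq q (Egen j) (act_sq q (Egen (Suc j)) \<psi>)) (a, b)"
    unfolding act_sq_E_twice[OF assms(1)]
    by (cases "a = Suc j"; cases "b = Suc j"; cases "a = Suc (Suc j)"; cases "b = Suc (Suc j)")
      (simp_all add: powi_wt assms algebra_simps)
qed

lemma act_sq_serre_F:
  assumes "q \<noteq> 0" "j = Suc i \<or> i = Suc j"
  shows "act_sq q (Fgen i) (act_sq q (Fgen i) (act_sq q (Fgen j) \<psi>)) (a, b)
      + act_sq q (Fgen j) (act_sq q (Fgen i) (act_sq q (Fgen i) \<psi>)) (a, b)
    = (of_real q + inverse (of_real q)) * act_sq q (Fgen i) (act_sq q (Fgen j) (act_sq q (Fgen i) \<psi>)) (a, b)"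
  using assms(2)
proof (elim disjE; hypsubst)
  show "act_sq q (Fgen i) (act_sq q (Fgen i) (act_sq q (Fgen (Suc i)) \<psi>)) (a, b)
      + act_sq q (Fgen (Suc i)) (act_sq q (Fgen i) (act_sq q (Fgen i) \<psi>)) (a, b)
    = (of_real q + inverse (of_real q)) * act_sq q (Fgen i) (act_sq q (Fgen (Suc i)) (act_sq q (Fgen i) \<psi>)) (a, b)"
    unfolding act_sq_F_twice[OF assms(1)]
    by (cases "a = i"; cases "b = i"; cases "a = Suc i"; cases "b = Suc i")
      (simp_all add: powi_minus_wt assms algebra_simps)
  show "act_sq q (Fgen (Suc j)) (act_sq q (Fgen (Suc j)) (act_sq q (Fgen j) \<psi>)) (a, b)
      + act_sq q (Fgen j) (act_sq q (Fgen (Suc j)) (act_sq q (Fgen (Suc j)) \<psi>)) (a, b)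
    = (of_real q + inverse (of_real q)) * act_sq q (Fgen (Suc j)) (act_sq q (Fgen j) (act_sq q (Fgen (Suc j)) \<psi>)) (a, b)"
    unfolding act_sq_F_twice[OF assms(1)]
    by (cases "a = j"; cases "b = j"; cases "a = Suc j"; cases "b = Suc j")
      (simp_all add: powi_minus_wt assms algebra_simps)
qed

lemma uq_action_sq:
  assumes "q \<noteq> 0" "q \<noteq> 1" "q \<noteq> - 1"
  shows "uq_action n q ({1..n+1} \<times> {1..n+1}) (act_sq q) (\<lambda>i (a, b). wt i a + wt i b)"
proof -
  interpret linear_action "act_sq q"
  proof
    fix g \<psi> \<chi> show "act_sq q g (\<lambda>a. \<psi> a + \<chi> a) = (\<lambda>a. act_sq q g \<psi> a + act_sq q g \<chi> a)"
      by (cases g) (auto simp: distrib_left)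
  next
    fix g \<psi> c show "act_sq q g (\<lambda>a. c * \<psi> a) = (\<lambda>a. c * act_sq q g \<psi> a)"
      by (cases g) (auto simp: distrib_left)
  qed
  note q = q_minus_inverse_nonzero[OF assms]
  show ?thesis
  proof unfold_locales
    fix r \<psi> and x :: "nat \<times> nat" assume "r \<in> uq_rels n q"
    obtain a b where x: "x = (a, b)" by fastforce
    from \<open>r \<in> uq_rels n q\<close> show "poly_act (act_sq q) r \<psi> x = 0"
    proof (cases rule: uq_rels_cases)
      case (1 i)
      show ?thesis
        using assms unfolding 1(2) x by (auto simp: powi_wt powi_minus_wt field_simps)
    next
      case (2 i)
      show ?thesis
        using assms unfolding 2(2) x by (auto simp: powi_wt powi_minus_wt field_simps)
    next
      case (3 i j)
      show ?thesis
        unfolding 3(3) x by (simp add: mult_ac)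
    next
      case (4 i j)
      show ?thesis
        using 4(1-2) assms unfolding 4(3) x by (auto simp: powi_wt cartan_def power2_eq_square power_int_minus field_simps)
    next
      case (5 i j)
      show ?thesis
        using 5(1-2) assms unfolding 5(3) x by (auto simp: powi_wt powi_minus_wt cartan_def power2_eq_square power_int_minus field_simps)
    next
      case (6 i j)
      show ?thesis
        using assms q unfolding 6(3) x
        by (cases "i = j"; cases "a = i"; cases "a = Suc i"; cases "b = i"; cases "b = Suc i")
          (simp_all add: powi_wt powi_minus_wt field_simps)
    next
      case (7 i j)
      show ?thesis
      proof (cases "j = i + 1 \<or> i = j + 1")
        case True
        then show ?thesis
          using act_sq_serre_E[of q j i \<psi> a b] assms unfolding 7(4) x serre_def Let_def
          by (simp add: poly_act_comp inverse_eq_divide algebra_simps del: act_sq.simps)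
      next
        case False
        then show ?thesis
          using 7(3) unfolding 7(4) x serre_def Let_def by (auto simp: powi_wt powi_minus_wt)
      qed
    next
      case (8 i j)
      show ?thesis
      proof (cases "j = i + 1 \<or> i = j + 1")
        case True
        then show ?thesis
          using act_sq_serre_F[of q j i \<psi> a b] assms unfolding 8(4) x serre_def Let_def
          by (simp add: poly_act_comp inverse_eq_divide algebra_simps del: act_sq.simps)
      next
        case False
        then show ?thesis
          using 8(3) unfolding 8(4) x serre_def Let_def by (auto simp: powi_wt powi_minus_wt)
      qed
    qed
  next
    fix g and \<psi> :: "nat \<times> nat \<Rightarrow> complex" and x :: "nat \<times> nat"
    assume "g \<in> uq_gens n" "\<And>a. a \<notin> {1..n+1} \<times> {1..n+1} \<Longrightarrow> \<psi> a = 0" "x \<notin> {1..n+1} \<times> {1..n+1}"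
    then show "act_sq q g \<psi> x = 0" by (cases g; cases x) auto
  next
    fix i and \<psi> :: "nat \<times> nat \<Rightarrow> complex" and x :: "nat \<times> nat"
    show "act_sq q (Kgen i) \<psi> x = of_real q powi (case x of (a, b) \<Rightarrow> wt i a + wt i b) * \<psi> x"
      using assms by (cases x) (simp add: power_int_add)
  qed simp_all
qed


subsection \<open>Root vectors\<close>

lemma root_vec_closed:
  "1 \<le> i \<Longrightarrow> i < j \<Longrightarrow> j \<le> n + 1 \<Longrightarrow> root_vec q j i \<in> carrier (free_alg (uq_gens n))"
  by (induction j) (auto simp: qcomm_def less_Suc_eq intro!: free_alg_closed)

lemma root_vec_closed': "(i, j) \<in> pos_roots n \<Longrightarrow> root_vec q j i \<in> carrier (free_alg (uq_gens n))"
  by (simp add: pos_roots_def root_vec_closed)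

lemma root_vec_triv:
  assumes "i < j"
  shows "poly_act act_triv (root_vec q j i) \<psi> a = 0"
proof -
  interpret uq_action 0 q UNIV act_triv "\<lambda>_ _. 0" by (rule uq_action_triv)
  from assms show ?thesis
    by (induction j arbitrary: \<psi> a) (auto simp: qcomm_def less_Suc_eq)
qed

lemma root_vec_vec:
  assumes q: "q \<noteq> 0" "q \<noteq> 1" "q \<noteq> - 1" and "i < j"
  shows "poly_act (act_vec q) (root_vec q j i) \<psi> a = (if a = j then \<psi> i else 0)"
proof -
  interpret uq_action 0 q "{1..0+1}" "act_vec q" wt by (rule uq_action_vec[OF q])
  from assms(4) show ?thesis
    by (induction j arbitrary: \<psi> a) (auto simp: qcomm_def less_Suc_eq)
qed

text \<open>
  The first two terms are $E_{ji} \otimes K_i \cdots K_{j-1}$ and $1 \otimes E_{ji}$.  The third one comes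
  from the summands $(1 - q^{-2}) E_{ai} \otimes E_{ja} K_i \cdots K_{a-1}$, \<open>i < a < j\<close>, of the coproduct of
  $E_{ji}$: each of them maps $v_i \otimes v_a$ to a multiple of $v_a \otimes v_j$.
\<close>

lemma root_vec_sq:
  assumes q: "q \<noteq> 0" "q \<noteq> 1" "q \<noteq> - 1" and "i < j"
  shows "poly_act (act_sq q) (root_vec q j i) \<psi> (a, b) =
     (if a = j then (if b = j then of_real q else if b = i then inverse (of_real q) else 1) * \<psi> (i, b) else 0)
     + (if b = j then \<psi> (a, i) else 0)
     + (if b = j \<and> i < a \<and> a < j then (of_real q - inverse (of_real q)) * \<psi> (i, a) else 0)"
proof -
  interpret uq_action 0 q "{1..0+1} \<times> {1..0+1}" "act_sq q" "\<lambda>i (a, b). wt i a + wt i b"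
    by (rule uq_action_sq[OF q])
  let ?q = "complex_of_real q"
  have qq: "inverse ?q * (?q * x) = x" "?q * (inverse ?q * x) = x" for x using q by simp_all
  from assms(4) show ?thesis
  proof (induction j arbitrary: \<psi> a b)
    case (Suc j)
    show ?case
    proof (cases "j = i")
      case True
      then show ?thesis by (auto simp: powi_wt)
    next
      case False
      with Suc.prems have ij: "i < j" by simp
      have E: "act_sq q (Egen j) \<chi> (a, b) =
        (if a = Suc j then (if b = Suc j then ?q else if b = j then inverse ?q else 1) * \<chi> (j, b) else 0) + (if b = Suc j then \<chi> (a, j) else 0)" for \<chi> a b
        by (simp add: powi_wt)
      have lhs: "poly_act (act_sq q) (root_vec q (Suc j) i) \<psi> (a, b)
        = act_sq q (Egen j) (poly_act (act_sq q) (root_vec q j i) \<psi>) (a, b)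
         - inverse ?q * poly_act (act_sq q) (root_vec q j i) (act_sq q (Egen j) \<psi>) (a, b)"
        using False by (simp add: qcomm_def poly_act_comp inverse_eq_divide del: act_sq.simps)
      consider "a = Suc j" | "a = j" | "a \<noteq> Suc j" "a \<noteq> j" by blast
      then show ?thesis
      proof cases
        case 1
        then show ?thesis
          using ij q unfolding lhs E Suc.IH[OF ij]
          by (cases "b = Suc j"; cases "b = j"; cases "b = i") (simp_all add: qq distrib_left)
      next
        case 2
        then show ?thesis
          using ij q unfolding lhs E Suc.IH[OF ij]
          by (cases "b = Suc j"; cases "b = j") (simp_all add: qq left_diff_distrib)
      next
        case 3
        then show ?thesis
          using ij q unfolding lhs E Suc.IH[OF ij]
          by (cases "b = Suc j"; cases "b = j") (simp_all add: qq)
      qed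
    qed
  qed simp
qed

section \<open>The quantum coordinate algebra and the cotangent space\<close>

lemma lin_ext_cong:
  "p \<in> carrier (free_alg S) \<Longrightarrow> (\<And>w. set w \<subseteq> S \<Longrightarrow> f w = g w) \<Longrightarrow> lin_ext f p = lin_ext g p"
  unfolding lin_ext_def by (rule sum.cong) (auto simp: free_alg_def)

lemma uq_ideal_closed: "r \<in> uq_ideal n q \<Longrightarrow> r \<in> carrier (free_alg (uq_gens n))"
  using quotient_algebra_uq[of n q] unfolding quotient_algebra_def
  by (meson additive_subgroup.a_Hcarr ideal.axioms(1))

subsection \<open>Elements of $\mathcal O_q$ are linear functionals\<close>

lemma Oq_scal: "x \<in> Oq n q \<Longrightarrow> (\<lambda>P. c * x P) \<in> Oq n q"
proof -
  assume "x \<in> Oq n q"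
  then obtain m d y where "x = (\<lambda>P. \<Sum>k<m. d k * y k P)" "\<forall>k<(m::nat). y k \<in> matrix_coeffs n q"
    unfolding Oq_def by blast
  then show ?thesis
    unfolding Oq_def
    by (intro CollectI exI[of _ m] exI[of _ "\<lambda>k. c * d k"] exI[of _ y]) (simp add: sum_distrib_left mult.assoc)
qed

lemma Oq_add: "x \<in> Oq n q \<Longrightarrow> y \<in> Oq n q \<Longrightarrow> (\<lambda>P. x P + y P) \<in> Oq n q"
proof -
  assume "x \<in> Oq n q" "y \<in> Oq n q"
  then obtain m c f m' c' f' where
    x: "x = (\<lambda>P. \<Sum>k<m. c k * f k P)" "\<forall>k<(m::nat). f k \<in> matrix_coeffs n q" and
    y: "y = (\<lambda>P. \<Sum>k<m'. c' k * f' k P)" "\<forall>k<(m'::nat). f' k \<in> matrix_coeffs n q"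
    unfolding Oq_def by blast
  define C where "C k = (if k < m then c k else c' (k - m))" for k
  define F where "F k = (if k < m then f k else f' (k - m))" for k
  have "(\<Sum>k<m + m'. C k * F k P) = (\<Sum>k<m. c k * f k P) + (\<Sum>k<m'. c' k * f' k P)" for P
  proof -
    have "(\<Sum>k<m + m'. C k * F k P) = (\<Sum>k<m. C k * F k P) + (\<Sum>k<m'. C (k + m) * F (k + m) P)"
      by (induction m') (simp_all add: add.commute add.left_commute add.assoc)
    then show ?thesis by (simp add: C_def F_def)
  qed
  moreover have "\<forall>k<m + m'. F k \<in> matrix_coeffs n q"
    using x(2) y(2) by (auto simp: F_def)
  ultimately show ?thesis
    unfolding Oq_def x(1) y(1) by (intro CollectI exI[of _ "m + m'"] exI[of _ C] exI[of _ F]) simp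
qed

lemma Oq_zero: "(\<lambda>_. 0) \<in> Oq n q"
  unfolding Oq_def by (intro CollectI exI[of _ 0]) simp

lemma Oq_diff: "x \<in> Oq n q \<Longrightarrow> y \<in> Oq n q \<Longrightarrow> (\<lambda>P. x P - y P) \<in> Oq n q"
  using Oq_add[of x n q "\<lambda>P. (-1) * y P"] Oq_scal[of y n q "-1"] by simp

lemma Oq_sum: "(\<And>a. a \<in> A \<Longrightarrow> f a \<in> Oq n q) \<Longrightarrow> (\<lambda>P. \<Sum>a\<in>A. f a P) \<in> Oq n q"
  by (induction A rule: infinite_finite_induct) (simp_all add: Oq_zero Oq_add)

lemma matrix_coeff_linear:
  assumes "x \<in> matrix_coeffs n q" "p \<in> carrier (free_alg (uq_gens n))" "r \<in> carrier (free_alg (uq_gens n))"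
  shows "x (uq_cls n q (p + r)) = x (uq_cls n q p) + x (uq_cls n q r)"
    and "x (uq_cls n q (scal c p)) = c * x (uq_cls n q p)"
proof -
  obtain d \<rho> a b where rep: "type1_rep n q d \<rho>" "a < d" "b < d"
    and x: "x = (\<lambda>P. if P \<in> carrier (Uq n q) then \<rho> P $$ (a, b) else 0)"
    using assms(1) unfolding matrix_coeffs_def by blast
  have hom: "\<rho> \<in> Ring.ring_hom (Uq n q) (ring_mat TYPE(complex) d ())"
    and lin: "\<And>c P. P \<in> carrier (Uq n q) \<Longrightarrow> \<rho> (c \<odot>\<^bsub>Uq n q\<^esub> P) = c \<cdot>\<^sub>m \<rho> P"
    using rep unfolding type1_rep_def by blast+
  have mem: "uq_cls n q s \<in> carrier (Uq n q)" if "s \<in> carrier (free_alg (uq_gens n))" for s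
    using that by (simp add: Uq_carrier)
  have dim: "\<rho> (uq_cls n q s) \<in> carrier_mat d d" if "s \<in> carrier (free_alg (uq_gens n))" for s
    using ring_hom_closed[OF hom mem[OF that]] by (simp add: ring_mat_simps)
  have "\<rho> (uq_cls n q (p + r)) = \<rho> (uq_cls n q p) + \<rho> (uq_cls n q r)"
    using ring_hom_add[OF hom mem mem] assms(2,3) by (simp add: uq_cls_add ring_mat_simps)
  then show "x (uq_cls n q (p + r)) = x (uq_cls n q p) + x (uq_cls n q r)"
    using assms(2,3) dim[OF assms(2)] dim[OF assms(3)] rep by (simp add: x mem free_alg_closed)
  have "\<rho> (uq_cls n q (scal c p)) = c \<cdot>\<^sub>m \<rho> (uq_cls n q p)"
    using lin[OF mem[OF assms(2)], of c] assms(2) by (simp add: uq_cls_smult)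
  then show "x (uq_cls n q (scal c p)) = c * x (uq_cls n q p)"
    using assms(2) dim[OF assms(2)] rep by (simp add: x mem free_alg_closed)
qed

lemma Oq_linear:
  assumes "x \<in> Oq n q" "p \<in> carrier (free_alg (uq_gens n))"
  shows "r \<in> carrier (free_alg (uq_gens n)) \<Longrightarrow>
      x (uq_cls n q (p + r)) = x (uq_cls n q p) + x (uq_cls n q r)"
    and "x (uq_cls n q (scal c p)) = c * x (uq_cls n q p)"
proof -
  obtain m c' f where x: "x = (\<lambda>P. \<Sum>k<m. c' k * f k P)" "\<forall>k<(m::nat). f k \<in> matrix_coeffs n q"
    using assms(1) unfolding Oq_def by blast
  show "x (uq_cls n q (p + r)) = x (uq_cls n q p) + x (uq_cls n q r)"
    if "r \<in> carrier (free_alg (uq_gens n))"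
    unfolding x(1) sum.distrib[symmetric] distrib_left[symmetric]
    by (rule sum.cong) (use x(2) matrix_coeff_linear(1)[OF _ assms(2) that] in auto)
  have "f k (uq_cls n q (scal c p)) = c * f k (uq_cls n q p)" if "k < m" for k
    using x(2) matrix_coeff_linear(2)[OF _ assms(2,2)] that by blast
  then show "x (uq_cls n q (scal c p)) = c * x (uq_cls n q p)"
    unfolding x(1) sum_distrib_left by (intro sum.cong) (simp_all add: mult_ac)
qed

definition E_cls :: "nat \<Rightarrow> real \<Rightarrow> nat \<times> nat \<Rightarrow> uq" where
  "E_cls n q = (\<lambda>(i, j). uq_cls n q (root_vec q j i))"

lemma E_cls_closed: "\<gamma> \<in> pos_roots n \<Longrightarrow> E_cls n q \<gamma> \<in> carrier (Uq n q)"
  by (cases \<gamma>) (simp add: E_cls_def Uq_carrier root_vec_closed')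

lemma vanish_on_T01_iff:
  assumes "x \<in> Oq n q"
  shows "(\<forall>P\<in>T01 n q. x P = 0) \<longleftrightarrow> (\<forall>\<gamma>\<in>pos_roots n. x (E_cls n q \<gamma>) = 0)"
proof -
  let ?r = "\<lambda>\<gamma>. root_vec q (snd \<gamma>) (fst \<gamma>)"
  let ?F = "carrier (free_alg (uq_gens n))"
  have r: "?r \<gamma> \<in> ?F" if "\<gamma> \<in> pos_roots n" for \<gamma>
    using that by (cases \<gamma>) (simp add: root_vec_closed')
  have zero: "x (uq_cls n q 0) = 0"
    using Oq_linear(2)[OF assms free_alg_zero, of 0] by simp
  have sum: "x (uq_cls n q (\<Sum>\<gamma>\<in>A. scal (c \<gamma>) (?r \<gamma>))) = (\<Sum>\<gamma>\<in>A. c \<gamma> * x (uq_cls n q (?r \<gamma>)))"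
    if "A \<subseteq> pos_roots n" for A c
    using finite_subset[OF that finite_pos_roots] that
  proof (induction A)
    case (insert \<gamma> A)
    have "scal (c \<gamma>) (?r \<gamma>) \<in> ?F" "(\<Sum>\<gamma>\<in>A. scal (c \<gamma>) (?r \<gamma>)) \<in> ?F"
      using insert by (auto intro!: free_alg_closed r)
    then show ?case
      using insert r by (simp add: Oq_linear[OF assms])
  qed (simp add: zero)
  have T: "T01 n q = range (\<lambda>c. uq_cls n q (\<Sum>\<gamma>\<in>pos_roots n. scal (c \<gamma>) (?r \<gamma>)))"
  proof -
    have 1: "(\<Sum>(i, j)\<in>pos_roots n. scal (c i j) (root_vec q j i))
        = (\<Sum>\<gamma>\<in>pos_roots n. scal (case_prod c \<gamma>) (?r \<gamma>))" for c
      by (simp add: case_prod_unfold)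
    have 2: "(\<Sum>\<gamma>\<in>pos_roots n. scal (c \<gamma>) (?r \<gamma>))
        = (\<Sum>(i, j)\<in>pos_roots n. scal (c (i, j)) (root_vec q j i))" for c
      by (simp add: case_prod_unfold)
    show ?thesis
      unfolding T01_def
    proof (intro subset_antisym subsetI)
      fix P assume "P \<in> range (\<lambda>c. uq_cls n q (\<Sum>\<gamma>\<in>pos_roots n. scal (c \<gamma>) (?r \<gamma>)))"
      then obtain c where "P = uq_cls n q (\<Sum>(i, j)\<in>pos_roots n. scal (c (i, j)) (root_vec q j i))"
        unfolding 2 by blast
      then show "P \<in> {uq_cls n q (\<Sum>(i, j)\<in>pos_roots n. scal (c i j) (root_vec q j i)) | c. True}"
        by (intro CollectI exI[of _ "\<lambda>i j. c (i, j)"]) simp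
    qed (auto simp only: 1)
  qed
  have E: "E_cls n q \<gamma> = uq_cls n q (?r \<gamma>)" for \<gamma>
    by (simp add: E_cls_def case_prod_unfold)
  show ?thesis
  proof
    assume *: "\<forall>P\<in>T01 n q. x P = 0"
    show "\<forall>\<gamma>\<in>pos_roots n. x (E_cls n q \<gamma>) = 0"
    proof
      fix \<gamma> assume \<gamma>: "\<gamma> \<in> pos_roots n"
      have "(\<Sum>\<beta>\<in>pos_roots n. scal (of_bool (\<beta> = \<gamma>)) (?r \<beta>)) = (\<Sum>\<beta>\<in>pos_roots n. if \<beta> = \<gamma> then ?r \<beta> else 0)"
        by (intro sum.cong) auto
      also have "\<dots> = ?r \<gamma>" using \<gamma> by simp
      finally have eq: "(\<Sum>\<beta>\<in>pos_roots n. scal (of_bool (\<beta> = \<gamma>)) (?r \<beta>)) = ?r \<gamma>" .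
      have "uq_cls n q (?r \<gamma>) \<in> T01 n q"
        unfolding T by (rule range_eqI[of _ _ "\<lambda>\<beta>. of_bool (\<beta> = \<gamma>)"]) (simp only: eq)
      with * show "x (E_cls n q \<gamma>) = 0" by (simp add: E)
    qed
  next
    assume "\<forall>\<gamma>\<in>pos_roots n. x (E_cls n q \<gamma>) = 0"
    then show "\<forall>P\<in>T01 n q. x P = 0"
      by (auto simp: T E sum)
  qed
qed

subsection \<open>Matrix coefficients of the vector representation and its square\<close>

locale quantum_sl =
  fixes n :: nat and q :: real
  assumes q: "q \<noteq> 0" "q \<noteq> 1" "q \<noteq> - 1"
begin

sublocale triv: uq_action n q UNIV act_triv "\<lambda>_ _. 0" by (rule uq_action_triv)
sublocale vec: uq_action n q "{1..n+1}" "act_vec q" wt by (rule uq_action_vec[OF q])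
sublocale sq: uq_action n q "{1..n+1} \<times> {1..n+1}" "act_sq q" "\<lambda>i (a, b). wt i a + wt i b"
  by (rule uq_action_sq[OF q])

lemma Oq_one_eq: "Oq_one n q = triv.coeff () ()"
proof -
  have "foldr act_triv w (delta ()) () = prod_list (map counit_gen w)" for w
    by (induction w) (simp_all add: delta_def)
  then show ?thesis by (simp add: Oq_one_def triv.coeff_def)
qed

lemma Oq_one_Oq: "Oq_one n q \<in> Oq n q"
  unfolding Oq_one_eq by (rule triv.coeff_Oq) auto

lemma Oq_one_E: "\<gamma> \<in> pos_roots n \<Longrightarrow> Oq_one n q (E_cls n q \<gamma>) = 0"
  by (cases \<gamma>) (auto simp: Oq_one_eq E_cls_def triv.coeff_cls root_vec_closed' root_vec_triv pos_roots_def
      intro!: root_vec_triv)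

lemma Oq_one_counit: "Oq_counit n q (Oq_one n q) = 1"
  by (simp add: Oq_counit_def Oq_one_eq Uq_one triv.coeff_cls delta_def)

text \<open>
  The two descriptions of $u_{ab}$ agree on all words in the generators of $U_q$, which suffices
  because all representatives of elements of $U_q$ are combinations of such words.
\<close>

lemma u_coeff_eq:
  assumes a: "a \<in> {1..n+1}" and b: "b \<in> {1..n+1}"
  shows "u_coeff n q a b = vec.coeff a b"
proof -
  have u_gen: "(\<Sum>c\<in>{1..n+1}. u_gen q g a c * \<psi> c) = act_vec q g \<psi> a"
    if "g \<in> uq_gens n" "a \<in> {1..n+1}" for g a \<psi>
  proof (cases g)
    case (Egen i)
    have "(\<Sum>c\<in>{1..n+1}. u_gen q g a c * \<psi> c) = (\<Sum>c\<in>{1..n+1}. if c = i then of_bool (a = Suc i) * \<psi> c else 0)"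
      by (intro sum.cong) (auto simp: Egen)
    then show ?thesis using that Egen by (simp del: sum.cl_ivl_Suc)
  next
    case (Fgen i)
    have "(\<Sum>c\<in>{1..n+1}. u_gen q g a c * \<psi> c) = (\<Sum>c\<in>{1..n+1}. if c = Suc i then of_bool (a = i) * \<psi> c else 0)"
      by (intro sum.cong) (auto simp: Fgen)
    then show ?thesis using that Fgen by (simp del: sum.cl_ivl_Suc)
  next
    case (Kgen i)
    have "(\<Sum>c\<in>{1..n+1}. u_gen q g a c * \<psi> c)
        = (\<Sum>c\<in>{1..n+1}. if c = a then of_real q powi wt i a * \<psi> c else 0)"
      by (intro sum.cong) (auto simp: Kgen wt_def)
    then show ?thesis using that Kgen by (simp del: sum.cl_ivl_Suc)
  next
    case (Kinv i)
    have "(\<Sum>c\<in>{1..n+1}. u_gen q g a c * \<psi> c)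
        = (\<Sum>c\<in>{1..n+1}. if c = a then of_real q powi (- wt i a) * \<psi> c else 0)"
      by (intro sum.cong) (auto simp: Kinv wt_def)
    then show ?thesis using that Kinv by (simp del: sum.cl_ivl_Suc)
  qed
  have word: "u_word n q w a b = foldr (act_vec q) w (delta b) a" if "set w \<subseteq> uq_gens n" "a \<in> {1..n+1}" for w a
    using that
  proof (induction w arbitrary: a)
    case (Cons g w)
    have "u_word n q (g # w) a b = (\<Sum>c\<in>{1..n+1}. u_gen q g a c * foldr (act_vec q) w (delta b) c)"
      using Cons by (simp del: sum.cl_ivl_Suc cong: sum.cong_simp)
    also have "\<dots> = act_vec q g (foldr (act_vec q) w (delta b)) a"
      using Cons.prems by (intro u_gen) auto
    finally show ?case by simp
  qed (simp add: delta_def)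
  have ext: "lin_ext (\<lambda>w. u_word n q w a b) p = poly_act (act_vec q) p (delta b) a"
    if "p \<in> carrier (free_alg (uq_gens n))" for p
    unfolding poly_act_def by (rule lin_ext_cong[OF that]) (use word a in auto)
  show ?thesis
  proof
    fix P show "u_coeff n q a b P = vec.coeff a b P"
    proof (cases "P \<in> carrier (Uq n q)")
      case True
      then obtain p where p: "p \<in> carrier (free_alg (uq_gens n))" "P = uq_cls n q p"
        by (auto simp: Uq_carrier)
      have "u_coeff n q a b P = lin_ext (\<lambda>w. u_word n q w a b) p"
        unfolding u_coeff_def p(2)
        by (rule uq_functional_cls[OF _ p(1)]) (use ext uq_ideal_closed vec.act_ideal in force)
      also have "\<dots> = vec.coeff a b P"
        using p by (simp add: ext vec.coeff_cls)
      finally show ?thesis .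
    qed (simp add: u_coeff_def vec.coeff_def uq_functional_outside)
  qed
qed

definition u :: "nat \<times> nat \<Rightarrow> uq_functional" where
  "u = (\<lambda>(i, j). u_coeff n q j i)"

lemma u_aug: "\<gamma> \<in> pos_roots n \<Longrightarrow> u \<gamma> \<in> Oq_aug n q"
  by (cases \<gamma>) (auto simp: u_def pos_roots_def u_coeff_eq Oq_aug_def Oq_counit_def Uq_one
      vec.coeff_cls delta_def intro!: vec.coeff_Oq)

lemma u_E:
  assumes "\<gamma> \<in> pos_roots n" "\<beta> \<in> pos_roots n"
  shows "u \<gamma> (E_cls n q \<beta>) = of_bool (\<gamma> = \<beta>)"
proof -
  obtain i j k l where eq: "\<gamma> = (i, j)" "\<beta> = (k, l)" by fastforce
  have "poly_act (act_vec q) (root_vec q l k) (delta i) j = of_bool (i = k \<and> j = l)"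
    using assms by (auto simp: eq root_vec_vec[OF q] delta_def pos_roots_def)
  then show ?thesis
    using assms root_vec_closed'[of k l n q]
    by (simp add: eq u_def u_coeff_eq E_cls_def vec.coeff_cls pos_roots_def)
qed

text \<open>
  This is $u_{ca} u_{db}$.  Evaluated on a root vector, the first two terms of \<open>root_vec_sq\<close> move only
  one tensor factor, whereas \<open>a \<noteq> c\<close> and \<open>b \<noteq> d\<close>; the third one requires \<open>a < b\<close>.
\<close>

lemma sq_coeff_I01:
  assumes "1 \<le> b" "b \<le> a" "a < c" "b < d" "c \<le> n + 1" "d \<le> n + 1"
  shows "sq.coeff (c, d) (a, b) \<in> I01 n q"
proof -
  have Oq: "sq.coeff (c, d) (a, b) \<in> Oq n q"
    using assms by (intro sq.coeff_Oq) auto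
  have "sq.coeff (c, d) (a, b) (E_cls n q \<gamma>) = 0" if "\<gamma> \<in> pos_roots n" for \<gamma>
  proof -
    obtain i j where eq: "\<gamma> = (i, j)" by fastforce
    then show ?thesis
      using that assms root_vec_closed'[of i j n q]
      by (auto simp: eq E_cls_def sq.coeff_cls root_vec_sq[OF q] delta_def pos_roots_def)
  qed
  moreover have "Oq_counit n q (sq.coeff (c, d) (a, b)) = 0"
    using assms by (simp add: Oq_counit_def Uq_one sq.coeff_cls delta_def)
  ultimately show ?thesis
    using Oq vanish_on_T01_iff[OF Oq] by (simp add: I01_def Oq_aug_def)
qed

text \<open>
  The paths from \<open>(a, b)\<close> to \<open>(c, d)\<close> in two steps: either one factor moves after the other,
  or \<open>b\<close> first moves to \<open>c\<close>, after which the third term of \<open>root_vec_sq\<close> maps \<open>(a, c)\<close> to \<open>(c, d)\<close>.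
\<close>

lemma sq_coeff_E_E:
  assumes "1 \<le> b" "b \<le> a" "a < c" "b < d" "c \<le> n + 1" "d \<le> n + 1"
    and "\<gamma> \<in> pos_roots n" "\<beta> \<in> pos_roots n"
  shows "sq.coeff (c, d) (a, b) (E_cls n q \<gamma> \<otimes>\<^bsub>Uq n q\<^esub> E_cls n q \<beta>) =
     (if \<gamma> = (a, c) \<and> \<beta> = (b, d) then if c = d then of_real q else if a = d then inverse (of_real q) else 1 else 0)
   + (if \<gamma> = (b, d) \<and> \<beta> = (a, c) then if a = b then inverse (of_real q) else 1 else 0)
   + (if \<gamma> = (a, d) \<and> \<beta> = (b, c) then if c < d then of_real q - inverse (of_real q) else 0 else 0)"
proof -
  obtain i j k l where eq: "\<gamma> = (i, j)" "\<beta> = (k, l)" by fastforce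
  have ij: "1 \<le> i" "i < j" "j \<le> n + 1" and kl: "1 \<le> k" "k < l" "l \<le> n + 1"
    using assms by (auto simp: eq pos_roots_def)
  have "sq.coeff (c, d) (a, b) (E_cls n q \<gamma> \<otimes>\<^bsub>Uq n q\<^esub> E_cls n q \<beta>)
      = poly_act (act_sq q) (root_vec q j i) (poly_act (act_sq q) (root_vec q l k) (delta (a, b))) (c, d)"
    using root_vec_closed[OF ij] root_vec_closed[OF kl]
    by (simp add: eq E_cls_def uq_cls_mult sq.coeff_cls free_alg_closed)
  also have "\<dots> = (if i = a \<and> j = c \<and> k = b \<and> l = d then if c = d then of_real q else if a = d then inverse (of_real q) else 1 else 0)
   + (if i = b \<and> j = d \<and> k = a \<and> l = c then if a = b then inverse (of_real q) else 1 else 0)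
   + (if i = a \<and> j = d \<and> k = b \<and> l = c then if c < d then of_real q - inverse (of_real q) else 0 else 0)"
  proof -
    let ?\<psi> = "poly_act (act_sq q) (root_vec q l k) (delta (a, b))"
    have "delta (a, b) (k, d) = 0" "k < i \<Longrightarrow> delta (a, b) (k, i) = 0"
      using assms(2,4) by (auto simp: delta_def)
    then have 1: "?\<psi> (i, d) = (if d = l then delta (a, b) (i, k) else 0)"
      unfolding root_vec_sq[OF q kl(2)] by (cases "k < i") simp_all
    have "delta (a, b) (c, k) = 0"
      using assms(3) by (auto simp: delta_def)
    moreover have "delta (a, b) (k, c) = 0"
      using assms(2,3) by (auto simp: delta_def)
    ultimately have 2: "?\<psi> (c, i) = (if c = l then (if i = l then of_real q else if i = k then inverse (of_real q) else 1) * delta (a, b) (k, i) else 0)"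
      unfolding root_vec_sq[OF q kl(2)] by simp
    have 3: "?\<psi> (i, c) = (if c = l then delta (a, b) (i, k) else 0)"
    proof -
      have "delta (a, b) (k, c) = 0" "k < i \<Longrightarrow> delta (a, b) (k, i) = 0"
        using assms(2,3) by (auto simp: delta_def)
      then show ?thesis
        unfolding root_vec_sq[OF q kl(2)] by (cases "k < i") simp_all
    qed
    show ?thesis
      unfolding root_vec_sq[OF q ij(2)] 1 2 3
      by (intro arg_cong2[where f = "(+)"]) (use assms(2,3) in \<open>auto simp: delta_def\<close>)
  qed
  finally show ?thesis by (simp add: eq)
qed

end


subsection \<open>The cotangent space\<close>

context quantum_sl
begin

lemma Oq_aug_add: "x \<in> Oq_aug n q \<Longrightarrow> y \<in> Oq_aug n q \<Longrightarrow> (\<lambda>P. x P + y P) \<in> Oq_aug n q"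
  by (simp add: Oq_aug_def Oq_counit_def Oq_add)

lemma Oq_aug_scal: "x \<in> Oq_aug n q \<Longrightarrow> (\<lambda>P. c * x P) \<in> Oq_aug n q"
  by (simp add: Oq_aug_def Oq_counit_def Oq_scal)

lemma Oq_aug_zero: "(\<lambda>_. 0) \<in> Oq_aug n q"
  by (simp add: Oq_aug_def Oq_counit_def Oq_zero)

lemma Oq_aug_diff: "x \<in> Oq_aug n q \<Longrightarrow> y \<in> Oq_aug n q \<Longrightarrow> (\<lambda>P. x P - y P) \<in> Oq_aug n q"
  by (simp add: Oq_aug_def Oq_counit_def Oq_diff)

lemma Oq_aug_sum: "(\<And>a. a \<in> A \<Longrightarrow> f a \<in> Oq_aug n q) \<Longrightarrow> (\<lambda>P. \<Sum>a\<in>A. f a P) \<in> Oq_aug n q"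
  by (simp add: Oq_aug_def Oq_counit_def Oq_sum)

lemma Oq_plus_aug: "x \<in> Oq n q \<Longrightarrow> Oq_plus n q x \<in> Oq_aug n q"
  using Oq_diff[OF _ Oq_scal[OF Oq_one_Oq], of x "Oq_counit n q x"] Oq_one_counit
  by (simp add: Oq_aug_def Oq_plus_def Oq_counit_def)

lemma Oq_plus_E: "\<gamma> \<in> pos_roots n \<Longrightarrow> Oq_plus n q x (E_cls n q \<gamma>) = x (E_cls n q \<gamma>)"
  by (simp add: Oq_plus_def Oq_one_E)

lemma I01_iff: "x \<in> I01 n q \<longleftrightarrow> x \<in> Oq_aug n q \<and> (\<forall>\<gamma>\<in>pos_roots n. x (E_cls n q \<gamma>) = 0)"
  unfolding I01_def using vanish_on_T01_iff[of x n q] by (auto simp: Oq_aug_def)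

lemma form_cls_eqI:
  assumes "x \<in> Oq_aug n q" "y \<in> Oq_aug n q" "\<And>\<gamma>. \<gamma> \<in> pos_roots n \<Longrightarrow> x (E_cls n q \<gamma>) = y (E_cls n q \<gamma>)"
  shows "form_cls n q x = form_cls n q y"
proof -
  have "form_cls n q x \<subseteq> form_cls n q y"
    if "x \<in> Oq_aug n q" "y \<in> Oq_aug n q" "\<And>\<gamma>. \<gamma> \<in> pos_roots n \<Longrightarrow> x (E_cls n q \<gamma>) = y (E_cls n q \<gamma>)" for x y
  proof
    fix w assume "w \<in> form_cls n q x"
    then obtain z where z: "z \<in> I01 n q" "w = (\<lambda>P. x P + z P)" by (auto simp: form_cls_def)
    have "(\<lambda>P. (x P - y P) + z P) \<in> I01 n q"
      using that z(1) by (simp add: I01_iff Oq_aug_add Oq_aug_diff)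
    then show "w \<in> form_cls n q y"
      unfolding form_cls_def z(2) by (intro CollectI exI[of _ "\<lambda>P. (x P - y P) + z P"]) simp
  qed
  with assms show ?thesis by (simp add: subset_antisym)
qed

lemma form_cls_closed:
  assumes "x \<in> Oq_aug n q" "y \<in> form_cls n q x"
  shows "y \<in> Oq_aug n q"
  using assms by (auto simp: form_cls_def I01_iff intro: Oq_aug_add)

lemma form_cls_self: "x \<in> form_cls n q x"
  unfolding form_cls_def by (intro CollectI exI[of _ "\<lambda>_. 0"]) (simp add: I01_iff Oq_aug_zero)

lemma Lambda1_carrier: "carrier (Lambda1 n q) = form_cls n q ` Oq_aug n q"
  by (simp add: Lambda1_def)

lemma Lambda1_add:
  assumes "x \<in> Oq_aug n q" "y \<in> Oq_aug n q"
  shows "form_cls n q x \<oplus>\<^bsub>Lambda1 n q\<^esub> form_cls n q y = form_cls n q (\<lambda>P. x P + y P)"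
proof -
  have "{\<lambda>P. x' P + y' P | x' y'. x' \<in> form_cls n q x \<and> y' \<in> form_cls n q y} = form_cls n q (\<lambda>P. x P + y P)"
  proof (intro subset_antisym subsetI)
    fix w assume "w \<in> {\<lambda>P. x' P + y' P | x' y'. x' \<in> form_cls n q x \<and> y' \<in> form_cls n q y}"
    then obtain z z' where z: "z \<in> I01 n q" "z' \<in> I01 n q" "w = (\<lambda>P. (x P + z P) + (y P + z' P))"
      by (auto simp: form_cls_def)
    then show "w \<in> form_cls n q (\<lambda>P. x P + y P)"
      unfolding form_cls_def
      by (intro CollectI exI[of _ "\<lambda>P. z P + z' P"]) (auto simp: I01_iff Oq_aug_add)
  next
    fix w assume "w \<in> form_cls n q (\<lambda>P. x P + y P)"
    then obtain z where z: "z \<in> I01 n q" "w = (\<lambda>P. x P + y P + z P)"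
      by (auto simp: form_cls_def)
    then show "w \<in> {\<lambda>P. x' P + y' P | x' y'. x' \<in> form_cls n q x \<and> y' \<in> form_cls n q y}"
      using form_cls_self[of x]
      by (intro CollectI exI[of _ x] exI[of _ "\<lambda>P. y P + z P"]) (auto simp: form_cls_def add.assoc)
  qed
  then show ?thesis by (simp add: Lambda1_def)
qed

lemma Lambda1_smult:
  assumes "x \<in> Oq_aug n q"
  shows "c \<odot>\<^bsub>Lambda1 n q\<^esub> form_cls n q x = form_cls n q (\<lambda>P. c * x P)"
proof -
  have *: "form_cls n q (\<lambda>P. c * y P) = form_cls n q (\<lambda>P. c * x P)" if y: "y \<in> form_cls n q x" for y
  proof -
    obtain z where z: "z \<in> I01 n q" "y = (\<lambda>P. x P + z P)"
      using y by (auto simp: form_cls_def)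
    then show ?thesis
      using form_cls_closed[OF assms y] assms
      by (intro form_cls_eqI Oq_aug_scal) (auto simp: I01_iff)
  qed
  have "(\<Union>y\<in>form_cls n q x. form_cls n q (\<lambda>P. c * y P)) = (\<Union>y\<in>form_cls n q x. form_cls n q (\<lambda>P. c * x P))"
    by (rule SUP_cong) (simp_all only: *)
  also have "\<dots> = form_cls n q (\<lambda>P. c * x P)"
    using form_cls_self[of x] by blast
  finally show ?thesis by (simp add: Lambda1_def)
qed

abbreviation "S \<equiv> carrier (Lambda1 n q)"
abbreviation "LI \<equiv> linear_ideal (Lambda1 n q)"

definition v :: "nat \<times> nat \<Rightarrow> uq_functional set" where
  "v \<gamma> = form_cls n q (u \<gamma>)"

lemma v_mem: "\<gamma> \<in> pos_roots n \<Longrightarrow> v \<gamma> \<in> S"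
  by (simp add: v_def Lambda1_carrier u_aug)

subsection \<open>The tensor algebra and the quantum exterior algebra as quotients of a free algebra\<close>

lemma linear_rels_closed: "linear_rels (Lambda1 n q) \<subseteq> carrier (free_alg S)"
proof -
  have "P \<oplus>\<^bsub>Lambda1 n q\<^esub> Q \<in> S" "c \<odot>\<^bsub>Lambda1 n q\<^esub> P \<in> S" if "P \<in> S" "Q \<in> S" for P Q c
    using that by (auto simp: Lambda1_carrier Lambda1_add Lambda1_smult Oq_aug_add Oq_aug_scal)
  then show ?thesis
    by (auto simp: linear_rels_def intro!: free_alg_closed)
qed

lemma tensor_quotient: "quotient_algebra (free_alg S) LI"
proof -
  interpret complex_algebra "free_alg S" by (rule complex_algebra_free_alg)
  show ?thesis
    unfolding quotient_algebra_def linear_ideal_def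
    using complex_algebra_free_alg genideal_ideal[OF linear_rels_closed] by blast
qed

lemmas tensor_cls_mult = quotient_algebra.cls_mult[OF tensor_quotient, folded tensor_cls_def tensor_alg_def, simplified]
  and tensor_cls_add = quotient_algebra.cls_add[OF tensor_quotient, folded tensor_cls_def tensor_alg_def, simplified]
  and tensor_cls_smult = quotient_algebra.cls_smult[OF tensor_quotient, folded tensor_cls_def tensor_alg_def, simplified]
  and tensor_cls_closed = quotient_algebra.cls_carrier[OF tensor_quotient, folded tensor_cls_def tensor_alg_def]
  and complex_algebra_tensor = quotient_algebra.complex_algebra_quot[OF tensor_quotient, folded tensor_alg_def]

lemma tensor_carrier: "carrier (Tens1 n q) = tensor_cls (Lambda1 n q) ` carrier (free_alg S)"
  by (simp add: tensor_alg_def quot_alg_simps tensor_cls_def[abs_def])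

lemma tensor_one: "\<one>\<^bsub>Tens1 n q\<^esub> = tensor_cls (Lambda1 n q) 1"
  by (simp add: tensor_alg_def quot_alg_simps tensor_cls_def)

lemma tensor_cls_eqI:
  assumes "p \<in> carrier (free_alg S)" "r \<in> carrier (free_alg S)" "p - r \<in> LI"
  shows "tensor_cls (Lambda1 n q) p = tensor_cls (Lambda1 n q) r"
  using quotient_algebra.cls_eq_iff[OF tensor_quotient, folded tensor_cls_def, OF assms(1,2)] assms
  by (simp add: free_alg_a_minus)

lemma linear_rels_subset: "linear_rels (Lambda1 n q) \<subseteq> LI"
proof -
  interpret complex_algebra "free_alg S" by (rule complex_algebra_free_alg)
  show ?thesis unfolding linear_ideal_def by (rule genideal_self[OF linear_rels_closed])
qed

lemma tensor_form_add:
  assumes "x \<in> Oq_aug n q" "y \<in> Oq_aug n q"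
  shows "tensor_form n q (\<lambda>P. x P + y P) = tensor_form n q x \<oplus>\<^bsub>Tens1 n q\<^esub> tensor_form n q y"
proof -
  have mem: "form_cls n q x \<in> S" "form_cls n q y \<in> S" "form_cls n q (\<lambda>P. x P + y P) \<in> S"
    using assms by (auto simp: Lambda1_carrier Oq_aug_add)
  have "gen (form_cls n q (\<lambda>P. x P + y P)) - gen (form_cls n q x) - gen (form_cls n q y) \<in> linear_rels (Lambda1 n q)"
    using mem Lambda1_add[OF assms] unfolding linear_rels_def
    by - (rule UnI1, rule CollectI, rule exI[of _ "form_cls n q x"], rule exI[of _ "form_cls n q y"], simp)
  then have "gen (form_cls n q (\<lambda>P. x P + y P)) - (gen (form_cls n q x) + gen (form_cls n q y)) \<in> LI"
    using linear_rels_subset by (auto simp: diff_diff_eq)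
  from tensor_cls_eqI[OF _ _ this] mem show ?thesis
    by (simp add: tensor_form_def tensor_cls_add free_alg_closed)
qed

lemma tensor_form_scal:
  assumes "x \<in> Oq_aug n q"
  shows "tensor_form n q (\<lambda>P. c * x P) = c \<odot>\<^bsub>Tens1 n q\<^esub> tensor_form n q x"
proof -
  have mem: "form_cls n q x \<in> S" "form_cls n q (\<lambda>P. c * x P) \<in> S"
    using assms by (auto simp: Lambda1_carrier Oq_aug_scal)
  have "gen (form_cls n q (\<lambda>P. c * x P)) - scal c (gen (form_cls n q x)) \<in> linear_rels (Lambda1 n q)"
    using mem Lambda1_smult[OF assms, of c] unfolding linear_rels_def
    by (intro UnI2 CollectI exI[of _ c] exI[of _ "form_cls n q x"]) simp
  then have "gen (form_cls n q (\<lambda>P. c * x P)) - scal c (gen (form_cls n q x)) \<in> LI"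
    using linear_rels_subset by auto
  from tensor_cls_eqI[OF _ _ this] mem show ?thesis
    by (simp add: tensor_form_def tensor_cls_smult free_alg_closed)
qed

text \<open>
  In the cotangent space a form is determined by its values on the root vectors, and the $u_{ji}$
  are dual to them.
\<close>

lemma tensor_form_expansion:
  assumes "x \<in> Oq_aug n q"
  shows "tensor_form n q x
    = tensor_cls (Lambda1 n q) (\<Sum>\<gamma>\<in>pos_roots n. scal (x (E_cls n q \<gamma>)) (gen (v \<gamma>)))"
proof -
  let ?c = "\<lambda>\<gamma>. x (E_cls n q \<gamma>)"
  have mem: "(\<lambda>P. \<Sum>\<gamma>\<in>A. ?c \<gamma> * u \<gamma> P) \<in> Oq_aug n q" if "A \<subseteq> pos_roots n" for A
    using that u_aug by (intro Oq_aug_sum Oq_aug_scal) auto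
  have sum: "tensor_form n q (\<lambda>P. \<Sum>\<gamma>\<in>A. ?c \<gamma> * u \<gamma> P)
      = tensor_cls (Lambda1 n q) (\<Sum>\<gamma>\<in>A. scal (?c \<gamma>) (gen (v \<gamma>)))" if "A \<subseteq> pos_roots n" for A
    using finite_subset[OF that finite_pos_roots] that
  proof (induction A)
    case empty
    have "tensor_form n q (\<lambda>P. 0) = 0 \<odot>\<^bsub>Tens1 n q\<^esub> tensor_form n q (\<lambda>P. 0)"
      using tensor_form_scal[OF Oq_aug_zero, of 0] by simp
    also have "\<dots> = tensor_cls (Lambda1 n q) 0"
      using Oq_aug_zero by (simp add: tensor_form_def tensor_cls_smult Lambda1_carrier)
    finally show ?case by simp
  next
    case (insert \<gamma> A)
    then have \<gamma>: "\<gamma> \<in> pos_roots n" and A: "A \<subseteq> pos_roots n" by auto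
    have "gen (v \<gamma>) \<in> carrier (free_alg S)" "(\<Sum>\<gamma>\<in>A. scal (?c \<gamma>) (gen (v \<gamma>))) \<in> carrier (free_alg S)"
      using \<gamma> A v_mem by (auto intro!: free_alg_closed)
    moreover have "tensor_form n q (\<lambda>P. ?c \<gamma> * u \<gamma> P) = ?c \<gamma> \<odot>\<^bsub>Tens1 n q\<^esub> tensor_cls (Lambda1 n q) (gen (v \<gamma>))"
      using tensor_form_scal[OF u_aug[OF \<gamma>]] by (simp add: tensor_form_def v_def)
    ultimately show ?case
      using insert(1,2) insert.IH[OF A] tensor_form_add[OF Oq_aug_scal[OF u_aug[OF \<gamma>]] mem[OF A]]
      by (simp add: tensor_cls_add tensor_cls_smult free_alg_closed)
  qed
  have "form_cls n q x = form_cls n q (\<lambda>P. \<Sum>\<gamma>\<in>pos_roots n. ?c \<gamma> * u \<gamma> P)"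
  proof (rule form_cls_eqI)
    fix \<beta> assume \<beta>: "\<beta> \<in> pos_roots n"
    have "(\<Sum>\<gamma>\<in>pos_roots n. ?c \<gamma> * u \<gamma> (E_cls n q \<beta>)) = (\<Sum>\<gamma>\<in>pos_roots n. if \<gamma> = \<beta> then ?c \<gamma> else 0)"
      by (intro sum.cong) (auto simp: u_E \<beta>)
    then show "x (E_cls n q \<beta>) = (\<Sum>\<gamma>\<in>pos_roots n. ?c \<gamma> * u \<gamma> (E_cls n q \<beta>))"
      using \<beta> by simp
  qed (use assms mem in auto)
  then show ?thesis
    using sum[of "pos_roots n"] by (simp add: tensor_form_def)
qed

lemma tensor_form_closed: "x \<in> Oq_aug n q \<Longrightarrow> tensor_form n q x \<in> carrier (Tens1 n q)"
  unfolding tensor_form_def by (intro tensor_cls_closed) (simp add: Lambda1_carrier)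

lemma I2_closed: "I2 n q \<subseteq> carrier (Tens1 n q)"
proof -
  interpret complex_algebra "Tens1 n q" by (rule complex_algebra_tensor)
  show ?thesis
    unfolding I2_def by (auto intro!: finsum_closed m_closed tensor_form_closed Oq_plus_aug)
qed

lemma Lambda_quotient: "quotient_algebra (Tens1 n q) (Idl\<^bsub>Tens1 n q\<^esub> (I2 n q))"
proof -
  interpret complex_algebra "Tens1 n q" by (rule complex_algebra_tensor)
  show ?thesis
    unfolding quotient_algebra_def
    using complex_algebra_tensor genideal_ideal[OF I2_closed] by blast
qed

text \<open>
  The exterior algebra is a quotient of the tensor algebra, which is itself a quotient of a free
  algebra.  The composite projection allows to compute with words.
\<close>

definition proj :: "uq_functional set falg \<Rightarrow> uq_functional set falg set set" where
  "proj p = Lambda_cls n q (tensor_cls (Lambda1 n q) p)"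

lemmas Lambda_cls_mult = quotient_algebra.cls_mult[OF Lambda_quotient, folded Lambda_cls_def Lambda_def]
  and Lambda_cls_add = quotient_algebra.cls_add[OF Lambda_quotient, folded Lambda_cls_def Lambda_def]
  and Lambda_cls_smult = quotient_algebra.cls_smult[OF Lambda_quotient, folded Lambda_cls_def Lambda_def]
  and Lambda_cls_eq_zero = quotient_algebra.cls_eq_zero_iff[OF Lambda_quotient, folded Lambda_cls_def Lambda_def]
  and complex_algebra_Lambda = quotient_algebra.complex_algebra_quot[OF Lambda_quotient, folded Lambda_def]

lemma Lambda_carrier: "carrier (Lambda n q) = proj ` carrier (free_alg S)"
  by (simp add: Lambda_def quot_alg_simps tensor_carrier image_image proj_def[abs_def] Lambda_cls_def[abs_def])

lemma proj_mult: "p \<in> carrier (free_alg S) \<Longrightarrow> r \<in> carrier (free_alg S) \<Longrightarrow>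
    proj (p * r) = proj p \<otimes>\<^bsub>Lambda n q\<^esub> proj r"
  by (simp add: proj_def Lambda_cls_mult tensor_cls_mult tensor_cls_closed)

lemma proj_add: "p \<in> carrier (free_alg S) \<Longrightarrow> r \<in> carrier (free_alg S) \<Longrightarrow>
    proj (p + r) = proj p \<oplus>\<^bsub>Lambda n q\<^esub> proj r"
  by (simp add: proj_def Lambda_cls_add tensor_cls_add tensor_cls_closed)

lemma proj_scal: "p \<in> carrier (free_alg S) \<Longrightarrow> proj (scal c p) = c \<odot>\<^bsub>Lambda n q\<^esub> proj p"
  by (simp add: proj_def Lambda_cls_smult tensor_cls_smult tensor_cls_closed)

lemma proj_one: "proj 1 = \<one>\<^bsub>Lambda n q\<^esub>"
  by (simp add: proj_def Lambda_def quot_alg_simps Lambda_cls_def tensor_one)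

lemma proj_closed: "p \<in> carrier (free_alg S) \<Longrightarrow> proj p \<in> carrier (Lambda n q)"
  by (simp add: Lambda_carrier)

lemma e_root_eq: "e_root n q \<gamma> = proj (gen (v \<gamma>))"
  by (cases \<gamma>) (simp add: e_root_def proj_def tensor_form_def v_def u_def)

definition J :: "uq_functional set falg set" where
  "J = {p \<in> carrier (free_alg S). proj p = \<zero>\<^bsub>Lambda n q\<^esub>}"

lemma J_ideal: "ideal J (free_alg S)"
proof -
  let ?F = "free_alg S"
  interpret F: complex_algebra ?F by (rule complex_algebra_free_alg)
  interpret L: complex_algebra "Lambda n q" by (rule complex_algebra_Lambda)
  have zero: "proj 0 = \<zero>\<^bsub>Lambda n q\<^esub>"
    using proj_scal[of 1 0] L.smult_zero_left[OF proj_closed[OF free_alg_one]] by simp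
  show ?thesis
  proof (rule idealI)
    show "subgroup J (add_monoid ?F)"
    proof (rule subgroup.intro)
      fix x assume x: "x \<in> J"
      have "inv\<^bsub>add_monoid ?F\<^esub> x = \<ominus>\<^bsub>?F\<^esub> x" by (simp add: a_inv_def)
      also have "\<dots> = scal (- 1) x"
        using x free_alg_a_minus[of 0 S x] by (simp add: a_minus_def scal_minus_left J_def)
      finally show "inv\<^bsub>add_monoid ?F\<^esub> x \<in> J"
        using x by (auto simp: J_def free_alg_scal_closed proj_scal L.smult_zero_right)
    qed (auto simp: J_def free_alg_closed zero proj_add)
  next
    fix p x assume "p \<in> J" "x \<in> carrier ?F"
    then show "x \<otimes>\<^bsub>?F\<^esub> p \<in> J" "p \<otimes>\<^bsub>?F\<^esub> x \<in> J"
      by (auto simp: J_def free_alg_closed proj_mult proj_closed)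
  qed (rule F.ring_axioms)
qed

lemma diff_mem_J:
  assumes "p \<in> carrier (free_alg S)" "r \<in> carrier (free_alg S)" "proj p = proj r"
  shows "p - r \<in> J"
proof -
  interpret L: complex_algebra "Lambda n q" by (rule complex_algebra_Lambda)
  have "p - r = p + scal (- 1) r" by (simp add: scal_minus_left)
  also have "proj \<dots> = proj r \<oplus>\<^bsub>Lambda n q\<^esub> (- 1) \<odot>\<^bsub>Lambda n q\<^esub> proj r"
    using assms proj_add[of p "scal (- 1) r"] by (simp only: proj_scal free_alg_scal_closed)
  also have "\<dots> = \<zero>\<^bsub>Lambda n q\<^esub>"
    using proj_closed[OF assms(2)] by (simp add: L.smult_minus_one L.r_neg)
  finally show ?thesis using assms by (simp add: J_def free_alg_closed)
qed

lemma letters_span: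
  assumes "s \<in> S"
  shows "\<exists>c. gen s - (\<Sum>\<gamma>\<in>pos_roots n. scal (c \<gamma>) (gen (v \<gamma>))) \<in> J"
proof -
  obtain x where x: "x \<in> Oq_aug n q" "s = form_cls n q x"
    using assms by (auto simp: Lambda1_carrier)
  let ?r = "\<Sum>\<gamma>\<in>pos_roots n. scal (x (E_cls n q \<gamma>)) (gen (v \<gamma>))"
  have r: "?r \<in> carrier (free_alg S)" using v_mem by (auto intro!: free_alg_closed)
  have "proj (gen s) = proj ?r"
    using tensor_form_expansion[OF x(1)] by (simp add: proj_def tensor_form_def x(2))
  then have "gen s - ?r \<in> J"
    using assms r by (intro diff_mem_J) simp_all
  then show ?thesis by (rule exI[of _ "\<lambda>\<gamma>. x (E_cls n q \<gamma>)"])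
qed

text \<open>
  For \<open>y\<close> in the coordinate algebra, \<open>[y\<^sup>+]\<close> has coordinates $\langle E_\gamma, y\rangle$, because root
  vectors annihilate the unit.  So $[x_{(1)}^+] \otimes [x_{(2)}^+]$ has coordinates
  $\langle E_\gamma, x_{(1)}\rangle \langle E_\beta, x_{(2)}\rangle = \langle E_\gamma E_\beta, x\rangle$.
\<close>

lemma quadratic_relation:
  assumes x: "x \<in> I01 n q" and ab: "\<And>k. k \<in> A \<Longrightarrow> a k \<in> Oq n q" "\<And>k. k \<in> A \<Longrightarrow> b k \<in> Oq n q"
    and "finite A"
    and coprod: "\<And>P Q. P \<in> carrier (Uq n q) \<Longrightarrow> Q \<in> carrier (Uq n q) \<Longrightarrow>
      x (P \<otimes>\<^bsub>Uq n q\<^esub> Q) = (\<Sum>k\<in>A. a k P * b k Q)"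
  shows "(\<Sum>\<gamma>\<in>pos_roots n. \<Sum>\<beta>\<in>pos_roots n.
      scal (x (E_cls n q \<gamma> \<otimes>\<^bsub>Uq n q\<^esub> E_cls n q \<beta>)) (gen (v \<gamma>) * gen (v \<beta>))) \<in> J"
proof -
  let ?T = "Tens1 n q" and ?\<tau> = "tensor_cls (Lambda1 n q)" and ?F = "carrier (free_alg S)"
  interpret T: complex_algebra ?T by (rule complex_algebra_tensor)
  obtain h where h: "bij_betw h {..<card A} A"
    using ex_bij_betw_nat_finite[OF \<open>finite A\<close>] by (auto simp: atLeast0LessThan)
  let ?a = "\<lambda>k. a (h k)" and ?b = "\<lambda>k. b (h k)"
  have hA: "h k \<in> A" if "k < card A" for k using h that by (auto simp: bij_betw_def)
  \<comment> \<open>a representative of the class of \<open>y\<^sup>+\<close> in the free algebra\<close>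
  define P where "P y = (\<Sum>\<gamma>\<in>pos_roots n. scal (y (E_cls n q \<gamma>)) (gen (v \<gamma>)))" for y
  have P: "P y \<in> ?F" for y unfolding P_def using v_mem by (auto intro!: free_alg_closed)
  have form: "tensor_form n q (Oq_plus n q y) = ?\<tau> (P y)" if "y \<in> Oq n q" for y
    using tensor_form_expansion[OF Oq_plus_aug[OF that]] by (simp add: P_def Oq_plus_E cong: sum.cong_simp)
  have "(\<Oplus>\<^bsub>?T\<^esub>k\<in>{..<m}. tensor_form n q (Oq_plus n q (?a k)) \<otimes>\<^bsub>?T\<^esub> tensor_form n q (Oq_plus n q (?b k)))
      = ?\<tau> (\<Sum>k<m. P (?a k) * P (?b k))" if "m \<le> card A" for m
    using that
  proof (induction m)
    case 0
    have "?\<tau> 0 = \<zero>\<^bsub>?T\<^esub>"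
      using tensor_cls_smult[of 1 0] T.smult_zero_left[OF tensor_cls_closed[OF free_alg_one]] by simp
    then show ?case by simp
  next
    case (Suc m)
    have "tensor_form n q (Oq_plus n q (?a k)) \<otimes>\<^bsub>?T\<^esub> tensor_form n q (Oq_plus n q (?b k)) \<in> carrier ?T"
      if "k < Suc m" for k
      using that Suc.prems hA ab by (intro T.m_closed tensor_form_closed Oq_plus_aug) auto
    then have "(\<Oplus>\<^bsub>?T\<^esub>k\<in>{..<Suc m}. tensor_form n q (Oq_plus n q (?a k)) \<otimes>\<^bsub>?T\<^esub> tensor_form n q (Oq_plus n q (?b k)))
      = (tensor_form n q (Oq_plus n q (?a m)) \<otimes>\<^bsub>?T\<^esub> tensor_form n q (Oq_plus n q (?b m))) \<oplus>\<^bsub>?T\<^esub>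
        (\<Oplus>\<^bsub>?T\<^esub>k\<in>{..<m}. tensor_form n q (Oq_plus n q (?a k)) \<otimes>\<^bsub>?T\<^esub> tensor_form n q (Oq_plus n q (?b k)))"
      unfolding lessThan_Suc by (subst T.finsum_insert) auto
    also have "\<dots> = ?\<tau> (P (?a m) * P (?b m)) \<oplus>\<^bsub>?T\<^esub> ?\<tau> (\<Sum>k<m. P (?a k) * P (?b k))"
      using Suc hA ab by (simp add: form tensor_cls_mult P)
    also have "\<dots> = ?\<tau> (\<Sum>k<Suc m. P (?a k) * P (?b k))"
      using P by (simp add: tensor_cls_add free_alg_closed add.commute)
    finally show ?case .
  qed
  then have fin: "(\<Oplus>\<^bsub>?T\<^esub>k\<in>{..<card A}. tensor_form n q (Oq_plus n q (?a k)) \<otimes>\<^bsub>?T\<^esub> tensor_form n q (Oq_plus n q (?b k)))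
      = ?\<tau> (\<Sum>k<card A. P (?a k) * P (?b k))" by simp
  have "?\<tau> (\<Sum>k<card A. P (?a k) * P (?b k)) \<in> I2 n q"
    unfolding I2_def fin[symmetric]
  proof (rule CollectI, rule exI[of _ x], rule exI[of _ "card A"], rule exI[of _ ?a], rule exI[of _ ?b], intro conjI refl)
    show "\<forall>k<card A. ?a k \<in> Oq n q \<and> ?b k \<in> Oq n q" using hA ab by auto
    show "\<forall>X\<in>carrier (Uq n q). \<forall>Y\<in>carrier (Uq n q). x (X \<otimes>\<^bsub>Uq n q\<^esub> Y) = (\<Sum>k<card A. ?a k X * ?b k Y)"
      using sum.reindex_bij_betw[OF h, of "\<lambda>k. a k X * b k Y" for X Y] coprod by simp
  qed (rule x)
  moreover have "I2 n q \<subseteq> Idl\<^bsub>?T\<^esub> (I2 n q)"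
    by (rule T.genideal_self[OF I2_closed])
  moreover have mem: "(\<Sum>k<card A. P (?a k) * P (?b k)) \<in> ?F"
    using P by (auto intro!: free_alg_closed)
  ultimately have "proj (\<Sum>k<card A. P (?a k) * P (?b k)) = \<zero>\<^bsub>Lambda n q\<^esub>"
    unfolding proj_def using Lambda_cls_eq_zero[OF tensor_cls_closed] by blast
  then have J: "(\<Sum>k<card A. P (?a k) * P (?b k)) \<in> J"
    using mem by (simp add: J_def)
  have "(\<Sum>k<card A. P (?a k) * P (?b k)) = (\<Sum>k\<in>A. P (a k) * P (b k))"
    using sum.reindex_bij_betw[OF h, of "\<lambda>k. P (a k) * P (b k)"] .
  also have "\<dots> = (\<Sum>k\<in>A. \<Sum>\<gamma>\<in>pos_roots n. \<Sum>\<beta>\<in>pos_roots n.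
      scal (a k (E_cls n q \<gamma>) * b k (E_cls n q \<beta>)) (gen (v \<gamma>) * gen (v \<beta>)))"
    unfolding P_def sum_product by (simp add: scal_mult_left scal_mult_right scal_scal mult.commute)
  also have "\<dots> = (\<Sum>\<gamma>\<in>pos_roots n. \<Sum>\<beta>\<in>pos_roots n. \<Sum>k\<in>A.
      scal (a k (E_cls n q \<gamma>) * b k (E_cls n q \<beta>)) (gen (v \<gamma>) * gen (v \<beta>)))"
    by (subst sum.swap, rule sum.cong[OF refl], rule sum.swap)
  also have "\<dots> = (\<Sum>\<gamma>\<in>pos_roots n. \<Sum>\<beta>\<in>pos_roots n.
      scal (x (E_cls n q \<gamma> \<otimes>\<^bsub>Uq n q\<^esub> E_cls n q \<beta>)) (gen (v \<gamma>) * gen (v \<beta>)))"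
  proof (intro sum.cong refl)
    fix \<gamma> \<beta> assume "\<gamma> \<in> pos_roots n" "\<beta> \<in> pos_roots n"
    then have "x (E_cls n q \<gamma> \<otimes>\<^bsub>Uq n q\<^esub> E_cls n q \<beta>) = (\<Sum>k\<in>A. a k (E_cls n q \<gamma>) * b k (E_cls n q \<beta>))"
      by (intro coprod E_cls_closed)
    then show "(\<Sum>k\<in>A. scal (a k (E_cls n q \<gamma>) * b k (E_cls n q \<beta>)) (gen (v \<gamma>) * gen (v \<beta>)))
        = scal (x (E_cls n q \<gamma> \<otimes>\<^bsub>Uq n q\<^esub> E_cls n q \<beta>)) (gen (v \<gamma>) * gen (v \<beta>))"
      by (simp add: scal_sum_left)
  qed
  finally show ?thesis using J by simp
qed

end


section \<open>Nakayama automorphisms from a twisted trace\<close>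

inductive_set generated :: "(complex, 'a) module \<Rightarrow> 'a set \<Rightarrow> 'a set" for R and G where
  generated_one: "\<one>\<^bsub>R\<^esub> \<in> generated R G"
| generated_mult: "g \<in> G \<Longrightarrow> x \<in> generated R G \<Longrightarrow> g \<otimes>\<^bsub>R\<^esub> x \<in> generated R G"
| generated_add: "x \<in> generated R G \<Longrightarrow> y \<in> generated R G \<Longrightarrow> x \<oplus>\<^bsub>R\<^esub> y \<in> generated R G"
| generated_smult: "x \<in> generated R G \<Longrightarrow> c \<odot>\<^bsub>R\<^esub> x \<in> generated R G"

text \<open>
  A linear functional on an algebra generated by \<open>G\<close> that defines a nondegenerate pairing and
  satisfies \<open>\<tau> (g y) = s \<tau> (y g)\<close> for the generators \<open>g\<close>.  The scalar \<open>s\<close> then describes the Nakayama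
  automorphism.
\<close>

locale twisted_trace = complex_algebra R for R :: "(complex, 'a) module" (structure) +
  fixes G :: "'a set" and \<tau> :: "'a \<Rightarrow> complex" and s :: complex
  assumes G_closed: "g \<in> G \<Longrightarrow> g \<in> carrier R"
    and carrier_generated: "x \<in> carrier R \<Longrightarrow> x \<in> generated R G"
    and trace_add: "x \<in> carrier R \<Longrightarrow> y \<in> carrier R \<Longrightarrow> \<tau> (x \<oplus> y) = \<tau> x + \<tau> y"
    and trace_smult: "x \<in> carrier R \<Longrightarrow> \<tau> (c \<odot> x) = c * \<tau> x"
    and nondegenerate_left: "x \<in> carrier R \<Longrightarrow> (\<And>y. y \<in> carrier R \<Longrightarrow> \<tau> (x \<otimes> y) = 0) \<Longrightarrow> x = \<zero>"
    and nondegenerate_right: "y \<in> carrier R \<Longrightarrow> (\<And>x. x \<in> carrier R \<Longrightarrow> \<tau> (x \<otimes> y) = 0) \<Longrightarrow> y = \<zero>"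
    and twist: "g \<in> G \<Longrightarrow> y \<in> carrier R \<Longrightarrow> \<tau> (g \<otimes> y) = s * \<tau> (y \<otimes> g)"
    and twist_nonzero: "s \<noteq> 0"
begin

abbreviation "B x y \<equiv> \<tau> (x \<otimes> y)"

lemma generated_closed: "x \<in> generated R G \<Longrightarrow> x \<in> carrier R"
  by (induction rule: generated.induct) (auto intro: G_closed)

lemma frobenius: "frobenius_form R B"
  unfolding frobenius_form_def
  using nondegenerate_left nondegenerate_right
  by (simp add: l_distr r_distr trace_add trace_smult smult_mult_left smult_mult_right m_assoc)

lemma eq_if_minus_eq_zero: "x \<in> carrier R \<Longrightarrow> y \<in> carrier R \<Longrightarrow> x \<oplus> (- 1) \<odot> y = \<zero> \<Longrightarrow> x = y"
  using r_neg minus_equality minus_minus by (metis a_inv_closed smult_minus_one)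

lemma right_partner_unique:
  assumes "z \<in> carrier R" "z' \<in> carrier R" "\<And>y. y \<in> carrier R \<Longrightarrow> B y z = B y z'"
  shows "z = z'"
proof (rule eq_if_minus_eq_zero[OF assms(1,2)], rule nondegenerate_right)
  fix y assume "y \<in> carrier R"
  then show "B y (z \<oplus> (- 1) \<odot> z') = 0"
    using assms by (simp add: r_distr trace_add trace_smult smult_mult_right)
qed (use assms in auto)

lemma left_partner_unique:
  assumes "z \<in> carrier R" "z' \<in> carrier R" "\<And>y. y \<in> carrier R \<Longrightarrow> B z y = B z' y"
  shows "z = z'"
proof (rule eq_if_minus_eq_zero[OF assms(1,2)], rule nondegenerate_left)
  fix y assume "y \<in> carrier R"
  then show "B (z \<oplus> (- 1) \<odot> z') y = 0"
    using assms by (simp add: l_distr trace_add trace_smult smult_mult_left)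
qed (use assms in auto)

text \<open>
  If \<open>z\<close> is the image of \<open>x\<close> under the Nakayama automorphism, then that of \<open>g x\<close> is \<open>s g z\<close>.
\<close>

lemma twist_word:
  assumes g: "g \<in> G" and x: "x \<in> carrier R" and z: "z \<in> carrier R"
    and B: "\<And>y. y \<in> carrier R \<Longrightarrow> B x y = B y z" and y: "y \<in> carrier R"
  shows "B (g \<otimes> x) y = s * B y (g \<otimes> z)"
proof -
  note gc = G_closed[OF g]
  have "B (g \<otimes> x) y = s * \<tau> ((x \<otimes> y) \<otimes> g)"
    using twist[OF g, of "x \<otimes> y"] gc x y by (simp add: m_assoc)
  also have "\<dots> = s * B (y \<otimes> g) z"
    using B[of "y \<otimes> g"] gc x y by (simp add: m_assoc)
  finally show ?thesis using gc y z by (simp add: m_assoc)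
qed

lemma partner_exists: "x \<in> generated R G \<Longrightarrow> \<exists>z\<in>carrier R. \<forall>y\<in>carrier R. B x y = B y z"
proof (induction rule: generated.induct)
  case generated_one
  then show ?case by (intro bexI[of _ \<one>]) auto
next
  case (generated_mult g x)
  then obtain z where z: "z \<in> carrier R" "\<And>y. y \<in> carrier R \<Longrightarrow> B x y = B y z" by blast
  have "B (g \<otimes> x) y = B y (s \<odot> (g \<otimes> z))" if "y \<in> carrier R" for y
    using twist_word[OF generated_mult(1) generated_closed[OF generated_mult(2)] z that]
      G_closed[OF generated_mult(1)] z that by (simp add: smult_mult_right trace_smult)
  then show ?case
    using G_closed[OF generated_mult(1)] z by (intro bexI[of _ "s \<odot> (g \<otimes> z)"]) auto
next
  case (generated_add x x')
  then obtain z z' where "z \<in> carrier R" "\<And>y. y \<in> carrier R \<Longrightarrow> B x y = B y z"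
    "z' \<in> carrier R" "\<And>y. y \<in> carrier R \<Longrightarrow> B x' y = B y z'" by blast
  then show ?case
    using generated_closed[OF generated_add(1)] generated_closed[OF generated_add(2)]
    by (intro bexI[of _ "z \<oplus> z'"]) (auto simp: l_distr r_distr trace_add)
next
  case (generated_smult x c)
  then obtain z where "z \<in> carrier R" "\<And>y. y \<in> carrier R \<Longrightarrow> B x y = B y z" by blast
  then show ?case
    using generated_closed[OF generated_smult(1)]
    by (intro bexI[of _ "c \<odot> z"]) (auto simp: smult_mult_left smult_mult_right trace_smult)
qed

lemma partner_onto: "z \<in> generated R G \<Longrightarrow> \<exists>x\<in>carrier R. \<forall>y\<in>carrier R. B x y = B y z"
proof (induction rule: generated.induct)
  case generated_one
  then show ?case by (intro bexI[of _ \<one>]) auto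
next
  case (generated_mult g z)
  then obtain x where x: "x \<in> carrier R" "\<And>y. y \<in> carrier R \<Longrightarrow> B x y = B y z" by blast
  have "B (inverse s \<odot> (g \<otimes> x)) y = B y (g \<otimes> z)" if "y \<in> carrier R" for y
    using twist_word[OF generated_mult(1) x(1) generated_closed[OF generated_mult(2)] x(2) that]
      G_closed[OF generated_mult(1)] x that twist_nonzero by (simp add: smult_mult_left trace_smult)
  then show ?case
    using G_closed[OF generated_mult(1)] x by (intro bexI[of _ "inverse s \<odot> (g \<otimes> x)"]) auto
next
  case (generated_add z z')
  then obtain x x' where "x \<in> carrier R" "\<And>y. y \<in> carrier R \<Longrightarrow> B x y = B y z"
    "x' \<in> carrier R" "\<And>y. y \<in> carrier R \<Longrightarrow> B x' y = B y z'" by blast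
  then show ?case
    using generated_closed[OF generated_add(1)] generated_closed[OF generated_add(2)]
    by (intro bexI[of _ "x \<oplus> x'"]) (auto simp: l_distr r_distr trace_add)
next
  case (generated_smult z c)
  then obtain x where "x \<in> carrier R" "\<And>y. y \<in> carrier R \<Longrightarrow> B x y = B y z" by blast
  then show ?case
    using generated_closed[OF generated_smult(1)]
    by (intro bexI[of _ "c \<odot> x"]) (auto simp: smult_mult_left smult_mult_right trace_smult)
qed

text \<open>
  By \<open>twist_word\<close> every element has a partner, and every element is a partner.  Nondegeneracy makes
  partners unique, from which all algebraic properties of the partner map follow.
\<close>

lemma nakayama_exists: "\<exists>\<sigma>. nakayama_automorphism R B \<sigma>"
proof -
  have "\<forall>x\<in>carrier R. \<exists>z. z \<in> carrier R \<and> (\<forall>y\<in>carrier R. B x y = B y z)"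
    using partner_exists[OF carrier_generated] by blast
  then obtain \<sigma> where \<sigma>: "\<And>x. x \<in> carrier R \<Longrightarrow> \<sigma> x \<in> carrier R"
      "\<And>x y. x \<in> carrier R \<Longrightarrow> y \<in> carrier R \<Longrightarrow> B x y = B y (\<sigma> x)"
    by metis
  have eqI: "\<sigma> x = z"
    if x: "x \<in> carrier R" and z: "z \<in> carrier R" and B: "\<And>y. y \<in> carrier R \<Longrightarrow> B x y = B y z" for x z
  proof (rule right_partner_unique[OF \<sigma>(1)[OF x] z])
    fix y assume y: "y \<in> carrier R"
    show "B y (\<sigma> x) = B y z"
      using \<sigma>(2)[OF x y] B[OF y] by simp
  qed
  have hom: "\<sigma> \<in> Ring.ring_hom R R"
  proof (rule ring_hom_memI)
    fix x y assume xy: "x \<in> carrier R" "y \<in> carrier R"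
    show "\<sigma> x \<in> carrier R" using xy \<sigma> by simp
    show "\<sigma> (x \<otimes> y) = \<sigma> x \<otimes> \<sigma> y"
    proof (rule eqI)
      fix w assume w: "w \<in> carrier R"
      have "B (x \<otimes> y) w = B (y \<otimes> w) (\<sigma> x)"
        using \<sigma>(2)[of x "y \<otimes> w"] xy w by (simp add: m_assoc)
      also have "\<dots> = B (w \<otimes> \<sigma> x) (\<sigma> y)"
        using \<sigma>(2)[of y "w \<otimes> \<sigma> x"] \<sigma>(1) xy w by (simp add: m_assoc)
      finally show "B (x \<otimes> y) w = B w (\<sigma> x \<otimes> \<sigma> y)"
        using \<sigma>(1) xy w by (simp add: m_assoc)
    qed (use xy \<sigma>(1) in auto)
    show "\<sigma> (x \<oplus> y) = \<sigma> x \<oplus> \<sigma> y"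
    proof (rule eqI)
      fix w assume w: "w \<in> carrier R"
      show "B (x \<oplus> y) w = B w (\<sigma> x \<oplus> \<sigma> y)"
        using \<sigma>(2)[OF xy(1) w] \<sigma>(2)[OF xy(2) w] \<sigma>(1) xy w by (simp add: l_distr r_distr trace_add)
    qed (use xy \<sigma>(1) in auto)
  next
    show "\<sigma> \<one> = \<one>" by (rule eqI) simp_all
  qed
  have "bij_betw \<sigma> (carrier R) (carrier R)"
    unfolding bij_betw_def
  proof
    show "inj_on \<sigma> (carrier R)"
    proof (rule inj_onI)
      fix x x' assume x: "x \<in> carrier R" "x' \<in> carrier R" and eq: "\<sigma> x = \<sigma> x'"
      show "x = x'"
        by (rule left_partner_unique[OF x]) (simp only: \<sigma>(2)[OF x(1)] \<sigma>(2)[OF x(2)] eq)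
    qed
    have "z \<in> \<sigma> ` carrier R" if z: "z \<in> carrier R" for z
    proof -
      obtain x where x: "x \<in> carrier R" "\<And>y. y \<in> carrier R \<Longrightarrow> B x y = B y z"
        using partner_onto[OF carrier_generated[OF z]] by blast
      have "\<sigma> x = z" using x z by (intro eqI)
      then show ?thesis using x(1) by blast
    qed
    then show "\<sigma> ` carrier R = carrier R" using \<sigma>(1) by blast
  qed
  moreover have "\<sigma> (c \<odot> x) = c \<odot> \<sigma> x" if "x \<in> carrier R" for c x
  proof (rule eqI)
    fix w assume w: "w \<in> carrier R"
    show "B (c \<odot> x) w = B w (c \<odot> \<sigma> x)"
      using \<sigma>(2)[OF that w] \<sigma>(1) that w by (simp add: smult_mult_left smult_mult_right trace_smult)
  qed (use that \<sigma>(1) in auto)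
  ultimately show ?thesis
    using hom \<sigma>(2) unfolding nakayama_automorphism_def algebra_automorphism_def ring_iso_def by blast
qed

text \<open>
  For the converse implication, the defining identity passes from the generators to all
  elements by \<open>twist_word\<close>.
\<close>

lemma nakayama_iff:
  "nakayama_automorphism R B \<sigma> \<longleftrightarrow> algebra_automorphism R \<sigma> \<and> (\<forall>g\<in>G. \<sigma> g = s \<odot> g)"
proof
  assume N: "nakayama_automorphism R B \<sigma>"
  then have closed: "\<sigma> x \<in> carrier R" if "x \<in> carrier R" for x
    using that unfolding nakayama_automorphism_def algebra_automorphism_def ring_iso_def
    by (auto intro: ring_hom_closed)
  have "\<sigma> g = s \<odot> g" if g: "g \<in> G" for g
  proof (rule right_partner_unique)
    fix y assume "y \<in> carrier R"
    then have "B g y = B y (\<sigma> g)" "B g y = s * B y g"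
      using N g G_closed twist[OF g] unfolding nakayama_automorphism_def by auto
    then show "B y (\<sigma> g) = B y (s \<odot> g)"
      using G_closed[OF g] \<open>y \<in> carrier R\<close> by (simp add: smult_mult_right trace_smult)
  qed (use G_closed[OF g] closed in auto)
  with N show "algebra_automorphism R \<sigma> \<and> (\<forall>g\<in>G. \<sigma> g = s \<odot> g)"
    by (simp add: nakayama_automorphism_def)
next
  assume A: "algebra_automorphism R \<sigma> \<and> (\<forall>g\<in>G. \<sigma> g = s \<odot> g)"
  then have hom: "\<sigma> \<in> Ring.ring_hom R R" and smult: "\<And>c x. x \<in> carrier R \<Longrightarrow> \<sigma> (c \<odot> x) = c \<odot> \<sigma> x"
    unfolding algebra_automorphism_def ring_iso_def by auto
  note closed = ring_hom_closed[OF hom]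
  have "\<forall>y\<in>carrier R. B x y = B y (\<sigma> x)" if "x \<in> generated R G" for x
    using that
  proof (induction rule: generated.induct)
    case generated_one
    then show ?case using ring_hom_one[OF hom] by simp
  next
    case (generated_mult g x)
    have x: "x \<in> carrier R" by (rule generated_closed) fact
    note g = G_closed[OF generated_mult(1)]
    have "\<sigma> (g \<otimes> x) = s \<odot> (g \<otimes> \<sigma> x)"
      using A generated_mult(1) g x closed[OF x] ring_hom_mult[OF hom g x] by (simp add: smult_mult_left)
    then show ?case
      using twist_word[OF generated_mult(1) x closed[OF x]] generated_mult(3) g closed[OF x]
      by (simp add: smult_mult_right trace_smult)
  next
    case (generated_add x x')
    have "x \<in> carrier R" "x' \<in> carrier R" using generated_add by (auto intro: generated_closed)
    then show ?case
      using generated_add closed ring_hom_add[OF hom] by (simp add: l_distr r_distr trace_add)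
  next
    case (generated_smult x c)
    have "x \<in> carrier R" using generated_smult by (auto intro: generated_closed)
    then show ?case
      using generated_smult closed smult by (simp add: smult_mult_left smult_mult_right trace_smult)
  qed
  then show "nakayama_automorphism R B \<sigma>"
    using A carrier_generated by (simp add: nakayama_automorphism_def)
qed

end

section \<open>The Nakayama automorphism of the quantum exterior algebra\<close>

context quantum_sl
begin

lemma sum_single_pair:
  assumes "\<gamma>0 \<in> A" "\<beta>0 \<in> A" "finite A"
  shows "(\<Sum>\<gamma>\<in>A. \<Sum>\<beta>\<in>A. scal (if \<gamma> = \<gamma>0 \<and> \<beta> = \<beta>0 then t else 0) (f \<gamma> \<beta>)) = scal t (f \<gamma>0 \<beta>0)"
proof -
  have "(\<Sum>\<beta>\<in>A. scal (if \<gamma> = \<gamma>0 \<and> \<beta> = \<beta>0 then t else 0) (f \<gamma> \<beta>))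
      = (if \<gamma> = \<gamma>0 then scal t (f \<gamma>0 \<beta>0) else 0)" for \<gamma>
  proof -
    have "(\<Sum>\<beta>\<in>A. scal (if \<gamma> = \<gamma>0 \<and> \<beta> = \<beta>0 then t else 0) (f \<gamma> \<beta>))
      = (\<Sum>\<beta>\<in>A. if \<beta> = \<beta>0 then if \<gamma> = \<gamma>0 then scal t (f \<gamma>0 \<beta>0) else 0 else 0)"
      by (intro sum.cong) auto
    then show ?thesis using assms by simp
  qed
  then show ?thesis using assms by simp
qed

lemma quantum_exterior: "quantum_exterior n (of_real q) S v J"
proof (rule quantum_exterior.intro)
  show "(of_real q :: complex) \<noteq> 0" using q by simp
  show "(of_real q :: complex)\<^sup>2 \<noteq> - 1"
  proof
    assume "(of_real q :: complex)\<^sup>2 = - 1"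
    then have "complex_of_real (q\<^sup>2) = complex_of_real (- 1)" by simp
    then have "q\<^sup>2 = - 1" by (simp only: of_real_eq_iff)
    then show False using zero_le_power2[of q] by simp
  qed
  show "ideal J (free_alg S)" by (rule J_ideal)
next
  fix b a c d assume bounds: "1 \<le> b" "b \<le> a" "a < c" "b < d" "c \<le> n + 1" "d \<le> n + 1"
  let ?X = "{1..n+1} \<times> {1..n+1}"
  let ?x = "sq.coeff (c, d) (a, b)"
  let ?g = "\<lambda>\<gamma> \<beta>. gen (v \<gamma>) * gen (v \<beta>)"
  have mem: "(a, b) \<in> ?X" "(c, d) \<in> ?X" using bounds by auto
  have "(\<Sum>\<gamma>\<in>pos_roots n. \<Sum>\<beta>\<in>pos_roots n.
      scal (?x (E_cls n q \<gamma> \<otimes>\<^bsub>Uq n q\<^esub> E_cls n q \<beta>)) (?g \<gamma> \<beta>)) \<in> J"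
    using mem by (intro quadratic_relation[where A = ?X and a = "sq.coeff (c, d)" and b = "\<lambda>k. sq.coeff k (a, b)"]
        sq_coeff_I01[OF bounds] sq.coeff_Oq sq.coeff_mult) auto
  also have "(\<Sum>\<gamma>\<in>pos_roots n. \<Sum>\<beta>\<in>pos_roots n.
      scal (?x (E_cls n q \<gamma> \<otimes>\<^bsub>Uq n q\<^esub> E_cls n q \<beta>)) (?g \<gamma> \<beta>)) =
    (\<Sum>\<gamma>\<in>pos_roots n. \<Sum>\<beta>\<in>pos_roots n.
      scal (if \<gamma> = (a, c) \<and> \<beta> = (b, d) then if c = d then of_real q else if a = d then inverse (of_real q) else 1 else 0) (?g \<gamma> \<beta>))
    + (\<Sum>\<gamma>\<in>pos_roots n. \<Sum>\<beta>\<in>pos_roots n.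
      scal (if \<gamma> = (b, d) \<and> \<beta> = (a, c) then if a = b then inverse (of_real q) else 1 else 0) (?g \<gamma> \<beta>))
    + (\<Sum>\<gamma>\<in>pos_roots n. \<Sum>\<beta>\<in>pos_roots n.
      scal (if \<gamma> = (a, d) \<and> \<beta> = (b, c) then if c < d then of_real q - inverse (of_real q) else 0 else 0) (?g \<gamma> \<beta>))"
    unfolding sum.distrib[symmetric] scal_add_left[symmetric]
    by (intro sum.cong refl arg_cong2[where f = scal] sq_coeff_E_E[OF bounds])
  also have "(\<Sum>\<gamma>\<in>pos_roots n. \<Sum>\<beta>\<in>pos_roots n.
      scal (if \<gamma> = (a, c) \<and> \<beta> = (b, d) then if c = d then of_real q else if a = d then inverse (of_real q) else 1 else 0) (?g \<gamma> \<beta>))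
    = scal (if c = d then of_real q else if a = d then inverse (of_real q) else 1) (?g (a, c) (b, d))"
    using bounds by (intro sum_single_pair finite_pos_roots) (auto simp: pos_roots_def)
  also have "(\<Sum>\<gamma>\<in>pos_roots n. \<Sum>\<beta>\<in>pos_roots n.
      scal (if \<gamma> = (b, d) \<and> \<beta> = (a, c) then if a = b then inverse (of_real q) else 1 else 0) (?g \<gamma> \<beta>))
    = scal (if a = b then inverse (of_real q) else 1) (?g (b, d) (a, c))"
    using bounds by (intro sum_single_pair finite_pos_roots) (auto simp: pos_roots_def)
  also have "(\<Sum>\<gamma>\<in>pos_roots n. \<Sum>\<beta>\<in>pos_roots n.
      scal (if \<gamma> = (a, d) \<and> \<beta> = (b, c) then if c < d then of_real q - inverse (of_real q) else 0 else 0) (?g \<gamma> \<beta>))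
    = scal (if c < d then of_real q - inverse (of_real q) else 0) (?g (a, d) (b, c))"
  proof (cases "c < d")
    case True
    then show ?thesis using bounds by (intro sum_single_pair finite_pos_roots) (auto simp: pos_roots_def)
  qed simp
  finally show "scal (if a = b then inverse (of_real q) else 1) (?g (b, d) (a, c))
      + scal (if c = d then of_real q else if a = d then inverse (of_real q) else 1) (?g (a, c) (b, d))
      + scal (if c < d then of_real q - inverse (of_real q) else 0) (?g (a, d) (b, c)) \<in> J"
    by (simp only: add.commute[of "scal (if c = d then _ else _) _"])
qed (fact v_mem letters_span)+

lemma Lambda_component_eq: "Lambda_component n q k =
    proj ` {p \<in> carrier (free_alg S). \<forall>w\<in>Poly_Mapping.keys p. length (letters w) = k}"
  by (simp add: Lambda_component_def tensor_component_def image_image proj_def[abs_def])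

lemma quantum_exterior_form:
  assumes "top_form n q (card (pos_roots n)) \<iota>"
  shows "quantum_exterior_form n (of_real q) S v J (\<lambda>p. \<iota> (proj p))"
proof -
  interpret L: complex_algebra "Lambda n q" by (rule complex_algebra_Lambda)
  have add: "\<iota> (x \<oplus>\<^bsub>Lambda n q\<^esub> y) = \<iota> x + \<iota> y"
    if "x \<in> carrier (Lambda n q)" "y \<in> carrier (Lambda n q)" for x y
    using assms that by (simp add: top_form_def)
  have scal: "\<iota> (c \<odot>\<^bsub>Lambda n q\<^esub> x) = c * \<iota> x" if "x \<in> carrier (Lambda n q)" for c x
    using assms that by (simp add: top_form_def)
  have zero: "\<iota> \<zero>\<^bsub>Lambda n q\<^esub> = 0"
    using scal[of "\<zero>\<^bsub>Lambda n q\<^esub>" 0] by (simp add: L.smult_zero_right)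
  show ?thesis
  proof (intro quantum_exterior_form.intro quantum_exterior quantum_exterior_form_axioms.intro)
    fix w assume w: "set w \<subseteq> S" "length w \<noteq> card (pos_roots n)"
    then have "proj (word w) \<in> Lambda_component n q (length w)"
      unfolding Lambda_component_eq by (intro imageI) (simp add: word_def free_alg_def)
    with w show "\<iota> (proj (word w)) = 0"
      using assms by (simp add: top_form_def)
  next
    have "1 \<in> \<iota> ` Lambda_component n q (card (pos_roots n))"
      using assms by (auto simp: top_form_def bij_betw_def)
    then obtain p where "p \<in> carrier (free_alg S)" "\<iota> (proj p) = 1"
      unfolding Lambda_component_eq by auto
    then show "\<exists>p\<in>carrier (free_alg S). \<iota> (proj p) \<noteq> 0"
      by (intro bexI[of _ p]) simp_all
  qed (auto simp: proj_add proj_scal proj_closed add scal J_def zero)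
qed

lemma twisted_trace:
  assumes "top_form n q (card (pos_roots n)) \<iota>"
  shows "twisted_trace (Lambda n q) (e_root n q ` pos_roots n) \<iota> ((- 1) ^ (card (pos_roots n) - 1))"
proof -
  interpret L: complex_algebra "Lambda n q" by (rule complex_algebra_Lambda)
  interpret form: quantum_exterior_form n "of_real q" S v J "\<lambda>p. \<iota> (proj p)"
    by (rule quantum_exterior_form[OF assms])
  have gen: "gen (v \<gamma>) \<in> carrier (free_alg S)" if "\<gamma> \<in> pos_roots n" for \<gamma>
    using v_mem[OF that] by simp
  have zero: "x = \<zero>\<^bsub>Lambda n q\<^esub>" if "x = proj p" "p \<in> J" for x p
    using that unfolding J_def by blast
  show ?thesis
  proof (intro twisted_trace.intro complex_algebra_Lambda twisted_trace_axioms.intro)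
    fix g assume "g \<in> e_root n q ` pos_roots n"
    then show "g \<in> carrier (Lambda n q)"
      using gen by (auto simp: e_root_eq intro!: proj_closed)
  next
    fix x assume "x \<in> carrier (Lambda n q)"
    then obtain p where p: "p \<in> carrier (free_alg S)" "x = proj p" by (auto simp: Lambda_carrier)
    let ?G = "generated (Lambda n q) (e_root n q ` pos_roots n)"
    have word: "proj (form.mon w) \<in> ?G" if "set w \<subseteq> pos_roots n" for w
      using that
    proof (induction w)
      case Nil
      then show ?case using generated_one by (simp add: form.mon_Nil proj_one)
    next
      case (Cons \<gamma> w)
      then have "proj (form.mon (\<gamma> # w)) = e_root n q \<gamma> \<otimes>\<^bsub>Lambda n q\<^esub> proj (form.mon w)"
        using gen form.mon_closed by (simp add: form.mon_Cons proj_mult e_root_eq)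
      then show ?case using Cons by (auto intro: generated_mult)
    qed
    have "proj p \<in> ?G" using form.carrier_span_basis[OF p(1)]
    proof (induction rule: form.span_mod.induct)
      case (span_base p)
      have "proj p = 0 \<odot>\<^bsub>Lambda n q\<^esub> \<one>\<^bsub>Lambda n q\<^esub>"
        using zero[OF refl span_base] L.smult_zero_left[OF L.one_closed] by (rule trans[OF _ sym])
      then show ?case by (metis generated_smult generated_one)
    next
      case (span_step p w c)
      have w: "set w \<subseteq> pos_roots n" using form.basis_props[OF span_step(2)] by simp
      have "p \<in> carrier (free_alg S)"
        using form.span_closed[OF span_step(1)] form.basis_props by blast
      then have "proj (p + scal c (form.mon w)) = proj p \<oplus>\<^bsub>Lambda n q\<^esub> c \<odot>\<^bsub>Lambda n q\<^esub> proj (form.mon w)"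
        using form.mon_closed[OF w] by (simp add: proj_add proj_scal free_alg_scal_closed)
      then show ?case
        using span_step(3) word[OF w] by (auto intro: generated_add generated_smult)
    qed
    with p show "x \<in> ?G" by simp
  next
    fix x assume x: "x \<in> carrier (Lambda n q)"
      and 0: "\<And>y. y \<in> carrier (Lambda n q) \<Longrightarrow> \<iota> (x \<otimes>\<^bsub>Lambda n q\<^esub> y) = 0"
    then obtain p where p: "p \<in> carrier (free_alg S)" "x = proj p" by (auto simp: Lambda_carrier)
    then show "x = \<zero>\<^bsub>Lambda n q\<^esub>"
      using 0 by (intro zero[OF p(2)] form.nondegenerate_left) (auto simp: proj_mult proj_closed)
  next
    fix x assume x: "x \<in> carrier (Lambda n q)"
      and 0: "\<And>y. y \<in> carrier (Lambda n q) \<Longrightarrow> \<iota> (y \<otimes>\<^bsub>Lambda n q\<^esub> x) = 0"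
    then obtain p where p: "p \<in> carrier (free_alg S)" "x = proj p" by (auto simp: Lambda_carrier)
    then show "x = \<zero>\<^bsub>Lambda n q\<^esub>"
      using 0 by (intro zero[OF p(2)] form.nondegenerate_right) (auto simp: proj_mult proj_closed)
  next
    fix g y assume "g \<in> e_root n q ` pos_roots n" "y \<in> carrier (Lambda n q)"
    then obtain \<gamma> r where "\<gamma> \<in> pos_roots n" "g = proj (gen (v \<gamma>))" "r \<in> carrier (free_alg S)" "y = proj r"
      by (auto simp: e_root_eq Lambda_carrier)
    then show "\<iota> (g \<otimes>\<^bsub>Lambda n q\<^esub> y) = (- 1) ^ (card (pos_roots n) - 1) * \<iota> (y \<otimes>\<^bsub>Lambda n q\<^esub> g)"
      using form.letter_cyclic[of \<gamma> r] gen by (simp add: proj_mult)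
  qed (use assms in \<open>auto simp: top_form_def\<close>)
qed

end

theorem corollary3p22:
  fixes n :: nat and q :: real and \<iota> :: "uq_functional set falg set set \<Rightarrow> complex"
  assumes "n \<ge> 1" and "q \<noteq> -1" and "q \<noteq> 0" and "q \<noteq> 1"
    and "top_form n q (card (pos_roots n)) \<iota>"
  shows "frobenius_form (Lambda n q) (Lambda_pairing n q \<iota>) \<and>
    (\<exists>\<sigma>. nakayama_automorphism (Lambda n q) (Lambda_pairing n q \<iota>) \<sigma>) \<and>
    (\<forall>\<sigma>. nakayama_automorphism (Lambda n q) (Lambda_pairing n q \<iota>) \<sigma> \<longleftrightarrow>
       algebra_automorphism (Lambda n q) \<sigma> \<and>
       (\<forall>\<gamma>\<in>pos_roots n. \<sigma> (e_root n q \<gamma>) =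
          (- 1) ^ (card (pos_roots n) - 1) \<odot>\<^bsub>Lambda n q\<^esub> e_root n q \<gamma>))"
proof -
  interpret quantum_sl n q using assms by unfold_locales auto
  interpret twisted_trace "Lambda n q" "e_root n q ` pos_roots n" \<iota> "(- 1) ^ (card (pos_roots n) - 1)"
    by (rule twisted_trace[OF assms(5)])
  have "Lambda_pairing n q \<iota> = B"
    by (simp add: Lambda_pairing_def fun_eq_iff)
  then show ?thesis
    using frobenius nakayama_exists nakayama_iff by simp
qed

end
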